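(* Let $\phi=(\phi_1,\phi_2)\in\mathcal O(\mathbb D^2,\mathbb D^2)$ extend to a $\mathcal C^3$-smooth map on $\overline{\mathbb D^2}$. (A) If $C_\phi f=f\circ\phi$ is compact on $H^2(\mathbb D^2)$, then (1) $\phi(\mathbb T^2)\cap\mathbb T^2=\varnothing$, and (2) for every $\xi\in\mathbb T^2$ and every $j\in\{1,2\}$ with $\phi_j(\xi)\in\mathbb T$, $\phi_j$ is truly two-dimensional at $\xi$. (B) Conversely, if (1) $\phi(\mathbb T^2)\cap\mathbb T^2=\varnothing$ and (2) for every $\xi\in\mathbb T^2$ and every $j\in\{1,2\}$ with $\phi_j(\xi)\in\mathbb T$, $\phi_j$ is truly two-dimensional at $\xi$ of order $2$, then $C_\phi$ is compact on $H^2(\mathbb D^2)$.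
   Context: $H^2(\mathbb D^2)$ is the Hardy space of holomorphic $f$ on $\mathbb D^2$ with $\sup_{0<r<1}\int_{\mathbb T^2}|f(r\zeta)|^2d\sigma_2(\zeta)<\infty$. For $\varphi\in\mathcal O(\mathbb D^2,\mathbb D)\cap\mathcal C^2(\overline{\mathbb D^2})$ and $\xi=(e^{i\alpha_1},e^{i\alpha_2})\in\mathbb T^2$ with $\varphi(\xi)\in\mathbb T$, let $\tilde\varphi(z)=\overline{\varphi(\xi)}\varphi(e^{i\alpha_1}z_1,e^{i\alpha_2}z_2)$ and $\psi(\theta)=\tilde\varphi(e^{i\theta_1},e^{i\theta_2})$, $\theta\in\mathbb R^2$. We say $\varphi$ is truly two-dimensional at $\xi$ if: (i) $\frac{\partial\tilde\varphi}{\partial z_1}(e)\ne0$ and $\frac{\partial\tilde\varphi}{\partial z_2}(e)\ne0$, where $e=(1,1)$; and (ii) writing $\mathrm{Im}\,\psi(\theta)=L(\theta)+G(\theta)$ with $L$ linear and $G(\theta)=O(|\theta|^2)$, the map $U(\theta)=(L(\theta)+G(\theta),\theta_2)$ is a diffeomorphism between neighbourhoods of $0$ in $\mathbb R^2$, and writing $\mathrm{Re}\,\psi\circ U^{-1}(u)=1+H(u)$, there is no function $h$ of one real variable with $H(u_1,u_2)=h(u_1)$ on a neighbourhood of $0$. We say $\varphi$ is truly two-dimensional at $\xi$ of order $2$ if, writing $\mathrm{Re}\,\psi(\theta)=1-Q(\theta)+o(|\theta|^2)$ with $Q$ a real quadratic form, $Q$ has signature $(2,0)$. *)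

theory Defs
  imports "HOL-Analysis.Analysis" "HOL-Library.Landau_Symbols"
begin

definition bidisc :: "(complex \<times> complex) set" where
  "bidisc = ball 0 1 \<times> ball 0 1"

definition cbidisc :: "(complex \<times> complex) set" where
  "cbidisc = cball 0 1 \<times> cball 0 1"

definition torus2 :: "(complex \<times> complex) set" where
  "torus2 = sphere 0 1 \<times> sphere 0 1"

definition holo2_on :: "(complex \<times> complex) set \<Rightarrow> (complex \<times> complex \<Rightarrow> complex) \<Rightarrow> bool" where
  "holo2_on S f \<longleftrightarrow>
     (\<forall>z\<in>S. \<exists>a b. (f has_derivative (\<lambda>h. a * fst h + b * snd h)) (at z))"

fun Ck_open :: "nat \<Rightarrow> 'a::real_normed_vector set \<Rightarrow> ('a \<Rightarrow> 'b::real_normed_vector) \<Rightarrow> bool" where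
  "Ck_open 0 U f = continuous_on U f"
| "Ck_open (Suc n) U f =
     ((\<forall>x\<in>U. f differentiable (at x)) \<and> (\<forall>v. Ck_open n U (\<lambda>x. frechet_derivative f (at x) v)))"

definition Ck_on :: "nat \<Rightarrow> 'a::real_normed_vector set \<Rightarrow> ('a \<Rightarrow> 'b::real_normed_vector) \<Rightarrow> bool" where
  "Ck_on k S f \<longleftrightarrow> (\<exists>U g. open U \<and> S \<subseteq> U \<and> Ck_open k U g \<and> (\<forall>z\<in>S. g z = f z))"

definition H2mean :: "real \<Rightarrow> (complex \<times> complex \<Rightarrow> complex) \<Rightarrow> real" where
  "H2mean r f = integral (cbox (0,0) (2*pi, 2*pi))
      (\<lambda>\<theta>::real\<times>real. (cmod (f (of_real r * cis (fst \<theta>), of_real r * cis (snd \<theta>))))\<^sup>2) / (4 * pi\<^sup>2)"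

definition H2 :: "(complex \<times> complex \<Rightarrow> complex) set" where
  "H2 = {f. holo2_on bidisc f \<and> bdd_above ((\<lambda>r. H2mean r f) ` {0<..<1})}"

definition H2norm :: "(complex \<times> complex \<Rightarrow> complex) \<Rightarrow> real" where
  "H2norm f = sqrt (SUP r\<in>{0<..<1}. H2mean r f)"

definition compact_comp_H2 :: "(complex \<times> complex \<Rightarrow> complex \<times> complex) \<Rightarrow> bool" where
  "compact_comp_H2 \<phi> \<longleftrightarrow>
     (\<forall>f\<in>H2. (\<lambda>z. f (\<phi> z)) \<in> H2) \<and>
     (\<forall>F :: nat \<Rightarrow> complex \<times> complex \<Rightarrow> complex.
        (\<forall>n. F n \<in> H2) \<and> bounded (range (\<lambda>n. H2norm (F n))) \<longrightarrow>
        (\<exists>s g. strict_mono s \<and> g \<in> H2 \<and>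
               (\<lambda>k. H2norm (\<lambda>z. F (s k) (\<phi> z) - g z)) \<longlonglongrightarrow> 0))"

text \<open>tilde phi (z) = conj(phi xi) * phi(e^{i alpha_1} z_1, e^{i alpha_2} z_2), xi = (e^{i alpha_1}, e^{i alpha_2}).\<close>
definition phi_tilde :: "(complex \<times> complex \<Rightarrow> complex) \<Rightarrow> complex \<times> complex \<Rightarrow> complex \<times> complex \<Rightarrow> complex" where
  "phi_tilde f \<xi> z = cnj (f \<xi>) * f (fst \<xi> * fst z, snd \<xi> * snd z)"

definition psi_map :: "(complex \<times> complex \<Rightarrow> complex) \<Rightarrow> complex \<times> complex \<Rightarrow> real \<times> real \<Rightarrow> complex" where
  "psi_map f \<xi> \<theta> = phi_tilde f \<xi> (cis (fst \<theta>), cis (snd \<theta>))"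

text \<open>Wirtinger derivatives d/dz_1, d/dz_2 at a point of the closed bidisc (derivative
  taken within the closed bidisc).\<close>
definition dz1 :: "(complex \<times> complex \<Rightarrow> complex) \<Rightarrow> complex \<times> complex \<Rightarrow> complex" where
  "dz1 f z = (frechet_derivative f (at z within cbidisc) (1, 0)
              - \<i> * frechet_derivative f (at z within cbidisc) (\<i>, 0)) / 2"

definition dz2 :: "(complex \<times> complex \<Rightarrow> complex) \<Rightarrow> complex \<times> complex \<Rightarrow> complex" where
  "dz2 f z = (frechet_derivative f (at z within cbidisc) (0, 1)
              - \<i> * frechet_derivative f (at z within cbidisc) (0, \<i>)) / 2"

definition truly_2d :: "(complex \<times> complex \<Rightarrow> complex) \<Rightarrow> complex \<times> complex \<Rightarrow> bool" where
  "truly_2d f \<xi> \<longleftrightarrow>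
     dz1 (phi_tilde f \<xi>) (1, 1) \<noteq> 0 \<and> dz2 (phi_tilde f \<xi>) (1, 1) \<noteq> 0 \<and>
     (\<exists>V W Uinv. open V \<and> open W \<and> (0::real\<times>real) \<in> V \<and> (0::real\<times>real) \<in> W \<and>
        homeomorphism V W (\<lambda>\<theta>. (Im (psi_map f \<xi> \<theta>), snd \<theta>)) Uinv \<and>
        Ck_open 1 V (\<lambda>\<theta>. (Im (psi_map f \<xi> \<theta>), snd \<theta>)) \<and> Ck_open 1 W Uinv \<and>
        \<not> (\<exists>h :: real \<Rightarrow> real. \<forall>\<^sub>F u in nhds 0. Re (psi_map f \<xi> (Uinv u)) - 1 = h (fst u)))"

definition truly_2d_ord2 :: "(complex \<times> complex \<Rightarrow> complex) \<Rightarrow> complex \<times> complex \<Rightarrow> bool" where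
  "truly_2d_ord2 f \<xi> \<longleftrightarrow>
     truly_2d f \<xi> \<and>
     (\<exists>a b c :: real.
        let Q = (\<lambda>\<theta>::real\<times>real. a * (fst \<theta>)\<^sup>2 + b * fst \<theta> * snd \<theta> + c * (snd \<theta>)\<^sup>2) in
        (\<lambda>\<theta>. Re (psi_map f \<xi> \<theta>) - (1 - Q \<theta>)) \<in> o[at 0](\<lambda>\<theta>. (norm \<theta>)\<^sup>2) \<and>
        (\<forall>\<theta>. \<theta> \<noteq> 0 \<longrightarrow> Q \<theta> > 0))"

end

theory Submission
  imports Defs "HOL-Complex_Analysis.Complex_Analysis"
begin

text \<open>Sufficiency. Let \<open>K\<close> be the Szego kernel of the bidisc. By duality and Schur's test, the weighted
  norm of \<open>f \<circ> \<phi>\<close> on the torus is controlled by the supremum over \<open>\<theta>\<close> of the integral of the weight times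
  \<open>\<bar>K (\<phi> \<theta>) (\<phi> \<theta>')\<bar>\<close> in \<open>\<theta>'\<close>. Since the two contact sets are disjoint, one factor of the kernel is always
  bounded, so only the one-variable kernels \<open>1 / (1 - \<phi>\<^sub>j \<theta> * cnj (\<phi>\<^sub>j \<theta>'))\<close> matter. At a contact point of order 2,
  \<open>Re \<psi>\<close> is strongly concave and \<open>Im \<psi>\<close> is monotone in one variable, so that the sets
  \<open>\<bar>1 - \<zeta> * \<phi>\<^sub>j\<bar> \<le> \<delta>\<close> have measure \<open>O(\<delta> powr (3/2))\<close> uniformly in \<open>\<zeta>\<close>. This makes the kernels uniformly
  integrable; compactness follows by cutting off near the contact sets and using Montel's theorem.

  Necessity. Normalised kernels tend to zero locally uniformly, so under a compact operator their
  images tend to zero in norm. A common contact point keeps these norms bounded below, and so does a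
  level set \<open>\<phi>\<^sub>j = \<eta>\<close> with \<open>\<bar>\<eta>\<bar> = 1\<close> whose projection to a coordinate axis contains an interval. If a
  complex partial derivative vanishes at a contact point, then by the Hopf lemma \<open>\<phi>\<^sub>j\<close> is constant on the
  corresponding slice; if \<open>H\<close> depends on \<open>u\<^sub>1\<close> only, then \<open>\<psi> = 1\<close> on the curve \<open>u\<^sub>1 = 0\<close>. Either way such a
  level set exists.\<close>


subsection \<open>Hardy space of the bidisc\<close>

text \<open>Elements of \<open>H2\<close> have no values on the torus, and \<phi> may carry torus
  points to the boundary of the bidisc, so \<open>f (\<phi> z)\<close> cannot be integrated over the
  torus directly. The sufficiency estimates are made for the dilates
  \<open>f (s *\<^sub>R \<phi> z)\<close> with \<open>s < 1\<close>, uniformly in \<open>s\<close>;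
  monotonicity of the means in the radius then removes the dilation. The parameter \<zeta> of the
  level sets runs over the whole disc because in the Schur integral it is \<open>q\<^sup>2\<close>
  times the conjugate of a coordinate of \<open>\<phi> (tor \<theta>)\<close>, where both the
  dilation and the base point are arbitrary. The gain of 1/2 over the exponent 1 is decisive: it
  makes the dyadic sum of height times measure converge, with a tail \<open>O(1 / sqrt T)\<close>
  above height \<open>T\<close>. Uniform smallness of this tail, not mere boundedness of the
  integrals, yields compactness. For necessity the scales are tuned so that nothing tends to zero: a
  kernel whose parameter has distance d from the circle has squared normalised modulus of order 1/d
  on an interval of length d around a contact point, because the symbol is Lipschitz on the
  torus.\<close>

lemma circle_Cauchy_formula:
  fixes h :: "complex \<Rightarrow> complex"
  assumes "continuous_on (cball 0 1) h" "h holomorphic_on ball 0 1" "norm z < 1"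
  shows "((\<lambda>t. h (cis t) / (1 - z * cnj (cis t))) has_integral (2 * pi * h z)) {0..2*pi}"
proof -
  have "((\<lambda>u. h u/(u-z)) has_contour_integral (2 * of_real pi * \<i> * h z)) (circlepath 0 1)"
    using assms by (intro Cauchy_integral_circlepath) auto
  then have "((\<lambda>t. h (0 + 1 * cis t) / (0 + 1 * cis t - z) * 1 * \<i> * cis t)
      has_integral (2 * of_real pi * \<i> * h z)) {0..2*pi}"
    unfolding circlepath_def by (subst (asm) has_contour_integral_part_circlepath_iff) auto
  \<comment> \<open>The velocity \<open>\<i> * cis t\<close> of the circle turns the Cauchy kernel
    into the Szego kernel, since \<open>u / (u - z) = 1 / (1 - z * cnj u)\<close> for unimodular
    \<open>u\<close>; the factor \<open>- \<i>\<close> removes the remaining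
    \<open>\<i>\<close>.\<close>
  then have "((\<lambda>t. - \<i> * (h (0 + 1 * cis t) / (0 + 1 * cis t - z) * 1 * \<i> * cis t))
      has_integral (- \<i> * (2 * of_real pi * \<i> * h z))) {0..2*pi}"
    by (rule has_integral_mult_right)
  moreover have "- \<i> * (h (0 + 1 * cis t) / (0 + 1 * cis t - z) * 1 * \<i> * cis t)
      = h (cis t) / (1 - z * cnj (cis t))" for t
  proof -
    have 1: "cis t * cnj (cis t) = 1"
      by (simp add: cis_cnj cis_mult)
    have ne: "cis t - z \<noteq> 0" using assms(3) by (metis eq_iff_diff_eq_0 norm_cis order_less_irrefl)
    have "cis t * (1 - z * cnj (cis t)) = cis t - z * (cis t * cnj (cis t))" by (simp add: algebra_simps)
    then have e: "cis t * (1 - z * cnj (cis t)) = cis t - z" using 1 by simp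
    then have ne2: "1 - z * cnj (cis t) \<noteq> 0" using ne by auto
    have "\<i> * (h (cis t) * \<i> * cis t) = - (h (cis t) * cis t)" by (simp add: algebra_simps)
    then have "- \<i> * (h (0 + 1 * cis t) / (0 + 1 * cis t - z) * 1 * \<i> * cis t) = h (cis t) * cis t / (cis t - z)"
      by simp
    also have "\<dots> = h (cis t) / (1 - z * cnj (cis t))"
      using ne ne2 e 1 by (simp add: field_simps)
    finally show ?thesis .
  qed
  ultimately show ?thesis by (simp add: algebra_simps)
qed

lemma norm_mult_lt_one: "norm z < 1 \<Longrightarrow> norm w \<le> 1 \<Longrightarrow> (1::complex) - z * w \<noteq> 0"
proof
  assume a: "norm z < 1" "norm w \<le> 1" "1 - z * w = 0"
  then have "norm z * norm w = 1" by (metis norm_mult norm_one right_minus_eq)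
  moreover have "norm z * norm w \<le> norm z * 1" using a by (intro mult_left_mono) auto
  ultimately show False using a by simp
qed

text \<open>The Poisson kernel is the Szego kernel times
  \<open>(1 - (norm z)\<^sup>2) / (1 - cnj z * u)\<close>. This factor is holomorphic in
  \<open>u\<close> up to the circle and equals 1 at \<open>u = z\<close>, so Cauchy's formula for
  its product with \<open>h\<close> is the claim.\<close>

lemma circle_Poisson_formula:
  fixes h :: "complex \<Rightarrow> complex"
  assumes "continuous_on (cball 0 1) h" "h holomorphic_on ball 0 1" "norm z < 1"
  shows "((\<lambda>t. h (cis t) * of_real ((1 - (norm z)\<^sup>2) / (norm (1 - z * cnj (cis t)))\<^sup>2))
     has_integral (2 * pi * h z)) {0..2*pi}"
proof -
  let ?g = "\<lambda>u. h u * of_real (1 - (norm z)\<^sup>2) / (1 - cnj z * u)"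
  have ne: "1 - cnj z * u \<noteq> 0" if "norm u \<le> 1" for u
    using norm_mult_lt_one[of "cnj z" u] assms that by simp
  have 1: "continuous_on (cball 0 1) ?g"
    using assms ne by (intro continuous_intros) auto
  have 2: "?g holomorphic_on ball 0 1"
    using assms ne by (intro holomorphic_intros) auto
  have "((\<lambda>t. ?g (cis t) / (1 - z * cnj (cis t))) has_integral (2 * pi * ?g z)) {0..2*pi}"
    by (rule circle_Cauchy_formula[OF 1 2 assms(3)])
  moreover have E1: "?g (cis t) / (1 - z * cnj (cis t)) =
      h (cis t) * of_real ((1 - (norm z)\<^sup>2) / (norm (1 - z * cnj (cis t)))\<^sup>2)" for t
  proof -
    have "of_real ((norm (1 - z * cnj (cis t)))\<^sup>2) = (1 - z * cnj (cis t)) * cnj (1 - z * cnj (cis t))"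
      by (simp add: complex_norm_square del: of_real_power)
    also have "\<dots> = (1 - z * cnj (cis t)) * (1 - cnj z * cis t)" by simp
    finally have "of_real ((norm (1 - z * cnj (cis t)))\<^sup>2) = (1 - z * cnj (cis t)) * (1 - cnj z * cis t)" .
    then show ?thesis unfolding of_real_divide by simp
  qed
  moreover have E2: "?g z = h z"
  proof -
    have "1 - cnj z * z = of_real (1 - (norm z)\<^sup>2)"
      by (simp add: complex_norm_square mult.commute del: of_real_power)
    then show ?thesis using ne[of z] assms by simp
  qed
  ultimately show ?thesis by (simp only: E1 E2)
qed

text \<open>The Poisson formula is applied to \<open>h\<^sup>2\<close>, which avoids any Cauchy-Schwarz inequality.\<close>

lemma circle_mean_square_mono:
  fixes h :: "complex \<Rightarrow> complex"
  assumes c: "continuous_on (cball 0 1) h" and h: "h holomorphic_on ball 0 1" and r: "0 \<le> r" "r < 1"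
  shows "integral {0..2*pi} (\<lambda>s. (norm (h (of_real r * cis s)))\<^sup>2) \<le> integral {0..2*pi} (\<lambda>t. (norm (h (cis t)))\<^sup>2)"
proof -
  define P where "P = (\<lambda>s t. (1 - r\<^sup>2) / (norm (1 - of_real r * cis s * cnj (cis t)))\<^sup>2)"
  have ne: "norm (1 - of_real r * cis s * cnj (cis t)) \<noteq> 0" for s t
    using norm_mult_lt_one[of "of_real r * cis s" "cnj (cis t)"] r by (simp add: norm_mult)
  have P0: "P s t \<ge> 0" for s t using r unfolding P_def by (simp add: power_le_one)
  have Pcont: "continuous_on UNIV (\<lambda>p. P (fst p) (snd p))"
    unfolding P_def using ne by (intro continuous_intros) auto
  have Psym: "P s t = P t s" for s t
  proof -
    have "norm (1 - of_real r * cis s * cnj (cis t)) = norm (cnj (1 - of_real r * cis s * cnj (cis t)))"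
      by (metis complex_mod_cnj)
    also have "\<dots> = norm (1 - of_real r * cis t * cnj (cis s))" by (simp add: mult_ac)
    finally show ?thesis unfolding P_def by simp
  qed
  have hc: "continuous_on UNIV (\<lambda>t. h (cis t))"
    by (rule continuous_on_compose2[OF c]) (auto intro!: continuous_intros)
  have hr: "continuous_on UNIV (\<lambda>t. h (of_real r * cis t))"
    by (rule continuous_on_compose2[OF c]) (use r in \<open>auto intro!: continuous_intros simp: norm_mult\<close>)
  have I1: "integral {0..2*pi} (P s) = 2 * pi" for s
  proof -
    have "norm (of_real r * cis s) < 1" using r by (simp add: norm_mult)
    from circle_Poisson_formula[of "\<lambda>u. 1", OF _ _ this] have "((\<lambda>t. complex_of_real (P s t)) has_integral of_real (2 * pi)) {0..2*pi}"
      unfolding P_def using r by (simp add: norm_mult)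
    from has_integral_linear[OF this bounded_linear_Re] have "(P s has_integral (2 * pi)) {0..2*pi}"
      by (simp add: o_def)
    then show ?thesis by (rule integral_unique)
  qed
  have bound: "2 * pi * (norm (h (of_real r * cis s)))\<^sup>2 \<le> integral {0..2*pi} (\<lambda>t. (norm (h (cis t)))\<^sup>2 * P s t)" for s
  proof -
    let ?z = "of_real r * cis s"
    have z: "norm ?z < 1" using r by (simp add: norm_mult)
    have c2: "continuous_on (cball 0 1) (\<lambda>u. (h u)\<^sup>2)" by (intro continuous_intros c)
    have h2: "(\<lambda>u. (h u)\<^sup>2) holomorphic_on ball 0 1" by (intro holomorphic_intros h)
    from circle_Poisson_formula[OF c2 h2 z] have hi: "((\<lambda>t. (h (cis t))\<^sup>2 * of_real (P s t)) has_integral (2 * pi * (h ?z)\<^sup>2)) {0..2*pi}"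
      unfolding P_def using r by (simp add: norm_mult)
    have "norm (2 * pi * (h ?z)\<^sup>2) = norm (integral {0..2*pi} (\<lambda>t. (h (cis t))\<^sup>2 * of_real (P s t)))"
      using hi by (simp add: integral_unique)
    also have "\<dots> \<le> integral {0..2*pi} (\<lambda>t. (norm (h (cis t)))\<^sup>2 * P s t)"
    proof (rule integral_norm_bound_integral)
      show "(\<lambda>t. (h (cis t))\<^sup>2 * of_real (P s t)) integrable_on {0..2*pi}" using hi by blast
      have "continuous_on UNIV (\<lambda>t::real. (s, t))" by (intro continuous_intros)
      from continuous_on_compose2[OF Pcont this] have "continuous_on UNIV (P s)" by simp
      then have "continuous_on UNIV (\<lambda>t. (norm (h (cis t)))\<^sup>2 * P s t)"
        by (intro continuous_intros hc)
      then show "(\<lambda>t. (norm (h (cis t)))\<^sup>2 * P s t) integrable_on {0..2*pi}"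
        by (meson continuous_on_subset integrable_continuous_real top_greatest)
      show "norm ((h (cis t))\<^sup>2 * of_real (P s t)) \<le> (norm (h (cis t)))\<^sup>2 * P s t" for t
        using P0 by (simp add: norm_mult norm_power)
    qed
    finally show ?thesis by (simp add: norm_mult norm_power)
  qed
  have Q: "continuous_on UNIV (\<lambda>p. (norm (h (cis (snd p))))\<^sup>2 * P (fst p) (snd p))"
    by (intro continuous_intros Pcont continuous_on_compose2[OF hc]) auto
  have "2 * pi * integral {0..2*pi} (\<lambda>s. (norm (h (of_real r * cis s)))\<^sup>2)
     = integral {0..2*pi} (\<lambda>s. 2 * pi * (norm (h (of_real r * cis s)))\<^sup>2)" by simp
  also have "\<dots> \<le> integral {0..2*pi} (\<lambda>s. integral {0..2*pi} (\<lambda>t. (norm (h (cis t)))\<^sup>2 * P s t))"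
  proof (rule integral_le)
    have "continuous_on UNIV (\<lambda>s. 2 * pi * (norm (h (of_real r * cis s)))\<^sup>2)" by (intro continuous_intros hr)
    then show "(\<lambda>s. 2 * pi * (norm (h (of_real r * cis s)))\<^sup>2) integrable_on {0..2*pi}"
      by (meson continuous_on_subset integrable_continuous_real top_greatest)
    have "continuous_on UNIV (\<lambda>s. integral (cbox 0 (2*pi)) (\<lambda>t. (norm (h (cis t)))\<^sup>2 * P s t))"
      by (rule integral_continuous_on_param) (use continuous_on_subset[OF Q] in \<open>simp add: split_beta\<close>)
    then show "(\<lambda>s. integral {0..2*pi} (\<lambda>t. (norm (h (cis t)))\<^sup>2 * P s t)) integrable_on {0..2*pi}"
      unfolding cbox_interval by (meson continuous_on_subset integrable_continuous_real top_greatest)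
  qed (use bound in auto)
  also have "\<dots> = integral {0..2*pi} (\<lambda>t. integral {0..2*pi} (\<lambda>s. (norm (h (cis t)))\<^sup>2 * P s t))"
    using integral_swap_continuous[of 0 0 "2*pi" "2*pi" "\<lambda>s t. (norm (h (cis t)))\<^sup>2 * P s t"]
      continuous_on_subset[OF Q] by (simp add: split_beta cbox_interval)
  \<comment> \<open>The kernel is symmetric, so integrating out \<open>s\<close> instead of
    \<open>t\<close> also gives \<open>2 * pi\<close>.\<close>
  also have "\<dots> = integral {0..2*pi} (\<lambda>t. (norm (h (cis t)))\<^sup>2 * (2 * pi))"
    using I1 by (simp add: Psym[of _ "t::real" for t])
  also have "\<dots> = 2 * pi * integral {0..2*pi} (\<lambda>t. (norm (h (cis t)))\<^sup>2)" by simp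
  finally show ?thesis by simp
qed


section \<open>The Szego kernel and square means on the bidisc\<close>

definition tor :: "real \<times> real \<Rightarrow> complex \<times> complex" where
  "tor \<theta> = (cis (fst \<theta>), cis (snd \<theta>))"

abbreviation tbox :: "(real \<times> real) set" where
  "tbox \<equiv> cbox (0,0) (2*pi, 2*pi)"

definition szego :: "complex \<times> complex \<Rightarrow> complex \<times> complex \<Rightarrow> complex" where
  "szego z w = 1 / ((1 - fst z * cnj (fst w)) * (1 - snd z * cnj (snd w)))"

lemma tor_in_torus2: "tor \<theta> \<in> torus2"
  by (simp add: tor_def torus2_def)

lemma torus2_subset_cbidisc: "torus2 \<subseteq> cbidisc"
  by (auto simp: torus2_def cbidisc_def)

lemma bidisc_subset_cbidisc: "bidisc \<subseteq> cbidisc"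
  by (auto simp: bidisc_def cbidisc_def)

lemma tor_in_cbidisc: "tor \<theta> \<in> cbidisc"
  using tor_in_torus2 torus2_subset_cbidisc by blast

lemma open_bidisc: "open bidisc"
  unfolding bidisc_def by (intro open_Times) auto

lemma compact_cbidisc: "compact cbidisc"
  unfolding cbidisc_def by (intro compact_Times) auto

lemma scaleR_in_bidisc: "z \<in> cbidisc \<Longrightarrow> 0 \<le> r \<Longrightarrow> r < 1 \<Longrightarrow> r *\<^sub>R z \<in> bidisc"
  unfolding cbidisc_def bidisc_def
  by (cases z) (auto intro: le_less_trans[OF mult_left_le])

lemma scaleR_in_cbidisc: "z \<in> cbidisc \<Longrightarrow> 0 \<le> r \<Longrightarrow> r \<le> 1 \<Longrightarrow> r *\<^sub>R z \<in> cbidisc"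
  unfolding cbidisc_def
  by (cases z) (auto intro: mult_le_one)

lemma continuous_on_tor [continuous_intros]:
  "continuous_on S f \<Longrightarrow> continuous_on S (\<lambda>x. tor (f x))"
  unfolding tor_def by (intro continuous_intros)

lemma holo2_on_imp_continuous_on: "holo2_on S f \<Longrightarrow> continuous_on S f"
  unfolding holo2_on_def
  by (meson continuous_at_imp_continuous_on has_derivative_continuous)

lemma holo2_on_slice1:
  assumes "holo2_on S f" "\<And>z. z \<in> A \<Longrightarrow> (z, w) \<in> S"
  shows "(\<lambda>z. f (z, w)) holomorphic_on A"
  unfolding holomorphic_on_def
proof
  fix z assume "z \<in> A"
  then obtain a b where d: "(f has_derivative (\<lambda>h. a * fst h + b * snd h)) (at (z, w))"
    using assms unfolding holo2_on_def by blast
  have "((\<lambda>z. (z, w)) has_derivative (\<lambda>h. (h, 0))) (at z)" by (auto intro!: derivative_eq_intros)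
  from diff_chain_at[OF this d] have "((\<lambda>z. f (z, w)) has_derivative (\<lambda>h. a * h)) (at z)"
    by (simp add: o_def)
  then have "((\<lambda>z. f (z, w)) has_field_derivative a) (at z)" by (simp add: has_field_derivative_def)
  then show "(\<lambda>z. f (z, w)) field_differentiable at z within A"
    using field_differentiable_at_within field_differentiable_def by blast
qed

lemma holo2_on_slice2:
  assumes "holo2_on S f" "\<And>w. w \<in> A \<Longrightarrow> (z, w) \<in> S"
  shows "(\<lambda>w. f (z, w)) holomorphic_on A"
  unfolding holomorphic_on_def
proof
  fix w assume "w \<in> A"
  then obtain a b where d: "(f has_derivative (\<lambda>h. a * fst h + b * snd h)) (at (z, w))"
    using assms unfolding holo2_on_def by blast
  have "((\<lambda>w. (z, w)) has_derivative (\<lambda>h. (0, h))) (at w)" by (auto intro!: derivative_eq_intros)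
  from diff_chain_at[OF this d] have "((\<lambda>w. f (z, w)) has_derivative (\<lambda>h. b * h)) (at w)"
    by (simp add: o_def)
  then have "((\<lambda>w. f (z, w)) has_field_derivative b) (at w)" by (simp add: has_field_derivative_def)
  then show "(\<lambda>w. f (z, w)) field_differentiable at w within A"
    using field_differentiable_at_within field_differentiable_def by blast
qed

lemma tbox_integral_iterated:
  fixes f :: "real \<times> real \<Rightarrow> 'a::banach"
  assumes "continuous_on tbox f"
  shows "integral tbox f = integral {0..2*pi} (\<lambda>s. integral {0..2*pi} (\<lambda>t. f (s, t)))"
  using integral_prod_continuous[OF assms] by (simp add: cbox_interval)

lemma tbox_integral_iterated':
  fixes f :: "real \<times> real \<Rightarrow> 'a::banach"
  assumes "continuous_on tbox f"
  shows "integral tbox f = integral {0..2*pi} (\<lambda>t. integral {0..2*pi} (\<lambda>s. f (s, t)))"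
  using tbox_integral_iterated[OF assms] integral_swap_continuous[of 0 0 "2*pi" "2*pi" "\<lambda>x y. f (x, y)"] assms
  by (simp add: cbox_interval)

lemma continuous_on_dilated:
  assumes "holo2_on bidisc f" "0 \<le> r" "r < 1" "continuous_on S g" "\<And>x. x \<in> S \<Longrightarrow> g x \<in> cbidisc"
  shows "continuous_on S (\<lambda>x. f (r *\<^sub>R g x))"
proof (rule continuous_on_compose2[OF holo2_on_imp_continuous_on[OF assms(1)]])
  show "continuous_on S (\<lambda>x. r *\<^sub>R g x)" using assms by (intro continuous_intros)
  show "(\<lambda>x. r *\<^sub>R g x) ` S \<subseteq> bidisc" using assms by (intro image_subsetI scaleR_in_bidisc) auto
qed

lemma szego_denom_ne:
  assumes "z \<in> bidisc" "w \<in> cbidisc"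
  shows "(1 - fst z * cnj (fst w)) \<noteq> 0" "(1 - snd z * cnj (snd w)) \<noteq> 0"
  using assms norm_mult_lt_one[of "fst z" "cnj (fst w)"] norm_mult_lt_one[of "snd z" "cnj (snd w)"]
  by (auto simp: bidisc_def cbidisc_def)

lemma continuous_on_szego:
  assumes "continuous_on S f" "continuous_on S g" "\<And>x. x \<in> S \<Longrightarrow> f x \<in> bidisc" "\<And>x. x \<in> S \<Longrightarrow> g x \<in> cbidisc"
  shows "continuous_on S (\<lambda>x. szego (f x) (g x))"
  unfolding szego_def using assms szego_denom_ne by (intro continuous_intros) auto

text \<open>The dilation supplies continuity up to the closed disc, which the circle formulas
  require and \<open>f\<close> itself may lack.\<close>

lemma dilated_slices:
  fixes f :: "complex \<times> complex \<Rightarrow> complex"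
  assumes f: "holo2_on bidisc f" and r: "0 \<le> r" "r < 1" and b: "cmod b < 1"
  shows "continuous_on (cball 0 1) (\<lambda>u. f (of_real r * u, b))" "(\<lambda>u. f (of_real r * u, b)) holomorphic_on ball 0 1"
    and "continuous_on (cball 0 1) (\<lambda>u. f (b, of_real r * u))" "(\<lambda>u. f (b, of_real r * u)) holomorphic_on ball 0 1"
proof -
  have lt: "r * norm u < 1" if "norm u \<le> 1" for u :: complex
    using r that by (meson le_less_trans mult_left_le)
  have sub: "(\<lambda>u. of_real r * u) ` ball (0::complex) 1 \<subseteq> ball 0 1"
    using lt r by (auto simp: norm_mult)
  have lin: "(\<lambda>u. of_real r * u) holomorphic_on ball 0 1" by (intro holomorphic_intros)
  note fc = holo2_on_imp_continuous_on[OF f]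
  show "continuous_on (cball 0 1) (\<lambda>u. f (of_real r * u, b))" "continuous_on (cball 0 1) (\<lambda>u. f (b, of_real r * u))"
    by (rule continuous_on_compose2[OF fc]; use lt b r in \<open>auto intro!: continuous_intros simp: bidisc_def norm_mult\<close>)+
  have "(\<lambda>w. f (w, b)) holomorphic_on ball 0 1" "(\<lambda>w. f (b, w)) holomorphic_on ball 0 1"
    using b by (auto intro!: holo2_on_slice1[OF f] holo2_on_slice2[OF f] simp: bidisc_def)
  from holomorphic_on_compose_gen[OF lin this(1) sub] holomorphic_on_compose_gen[OF lin this(2) sub]
  show "(\<lambda>u. f (of_real r * u, b)) holomorphic_on ball 0 1" "(\<lambda>u. f (b, of_real r * u)) holomorphic_on ball 0 1"
    by (simp_all add: o_def)
qed

text \<open>One circle formula in each variable. The dilation by \<open>r\<close> stands in for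
  boundary values: the torus integral samples \<open>f\<close> on the torus of radius
  \<open>r\<close> and returns its value at \<open>r *\<^sub>R z\<close>.\<close>

lemma bidisc_Cauchy_formula:
  fixes f :: "complex \<times> complex \<Rightarrow> complex"
  assumes f: "holo2_on bidisc f" and r: "0 \<le> r" "r < 1" and z: "z \<in> bidisc"
  shows "integral tbox (\<lambda>\<theta>. f (r *\<^sub>R tor \<theta>) * szego z (tor \<theta>)) = 4 * pi\<^sup>2 * f (r *\<^sub>R z)"
proof -
  obtain z1 z2 where zz: "z = (z1, z2)" by force
  have z1: "norm z1 < 1" and z2: "norm z2 < 1" using z zz by (auto simp: bidisc_def)
  have lt: "cmod (of_real r * a) < 1" if "norm a \<le> 1" for a :: complex
    using r that mult_left_le[of "norm a" r] by (simp add: norm_mult le_less_trans)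
  have c: "continuous_on tbox (\<lambda>\<theta>. f (r *\<^sub>R tor \<theta>) * szego z (tor \<theta>))"
    by (intro continuous_intros continuous_on_dilated[OF f r] continuous_on_szego) (auto simp: tor_in_cbidisc z)
  have in1: "integral {0..2*pi} (\<lambda>t. f (of_real r * a, of_real r * cis t) / (1 - z2 * cnj (cis t)))
      = 2 * pi * f (of_real r * a, of_real r * z2)" if a: "norm a \<le> 1" for a
    using circle_Cauchy_formula[OF dilated_slices(3,4)[OF f r lt[OF a]] z2] by (rule integral_unique)
  have in2: "integral {0..2*pi} (\<lambda>t. f (of_real r * cis t, of_real r * z2) / (1 - z1 * cnj (cis t)))
      = 2 * pi * f (of_real r * z1, of_real r * z2)"
    using circle_Cauchy_formula[OF dilated_slices(1,2)[OF f r lt[OF less_imp_le[OF z2]]] z1] by (rule integral_unique)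
  have "integral tbox (\<lambda>\<theta>. f (r *\<^sub>R tor \<theta>) * szego z (tor \<theta>))
     = integral {0..2*pi} (\<lambda>s. integral {0..2*pi} (\<lambda>t. f (r *\<^sub>R tor (s,t)) * szego z (tor (s,t))))"
    by (rule tbox_integral_iterated[OF c])
  also have "\<dots> = integral {0..2*pi} (\<lambda>s. integral {0..2*pi} (\<lambda>t. (1 / (1 - z1 * cnj (cis s))) *
        (f (of_real r * cis s, of_real r * cis t) / (1 - z2 * cnj (cis t)))))"
    unfolding szego_def tor_def zz by (simp add: scaleR_conv_of_real)
  also have "\<dots> = integral {0..2*pi} (\<lambda>s. (1 / (1 - z1 * cnj (cis s))) * (2 * pi * f (of_real r * cis s, of_real r * z2)))"
    by (subst integral_mult_right, subst in1) auto
  also have "\<dots> = integral {0..2*pi} (\<lambda>s. (2 * pi) * (f (of_real r * cis s, of_real r * z2) / (1 - z1 * cnj (cis s))))"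
    by (simp add: field_simps)
  also have "\<dots> = (2 * pi) * (2 * pi * f (of_real r * z1, of_real r * z2))"
    by (subst integral_mult_right, subst in2) auto
  also have "\<dots> = 4 * pi\<^sup>2 * f (r *\<^sub>R z)"
    by (simp add: zz scaleR_conv_of_real power2_eq_square)
  finally show ?thesis .
qed

lemma H2mean_eq: "H2mean r f = integral tbox (\<lambda>\<theta>. (cmod (f (r *\<^sub>R tor \<theta>)))\<^sup>2) / (4 * pi\<^sup>2)"
  unfolding H2mean_def tor_def by (simp add: scaleR_conv_of_real)

lemma H2mean_nonneg: "0 \<le> H2mean r f"
proof -
  have "0 \<le> integral tbox g" if "\<And>x. 0 \<le> g x" for g :: "real \<times> real \<Rightarrow> real"
    using that by (cases "g integrable_on tbox") (auto intro: integral_nonneg simp: not_integrable_integral)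
  then show ?thesis unfolding H2mean_def by (intro divide_nonneg_nonneg) auto
qed

text \<open>\<open>H2mean\<close> enlarges both radii at once, while the circle inequality enlarges
  one. The mixed mean \<open>?F 1 q\<close> is the intermediate stage, and Fubini in either order
  isolates the variable whose radius grows.\<close>

lemma H2mean_mono:
  assumes f: "holo2_on bidisc f" and r: "0 \<le> r" "r \<le> r'" "r' < 1"
  shows "H2mean r f \<le> H2mean r' f"
proof (cases "r = r'")
  case False
  with r have rr: "r < r'" and r': "0 < r'" by auto
  define q where "q = r / r'"
  have q: "0 \<le> q" "q < 1" "r = q * r'" using rr r r' by (auto simp: q_def field_simps)
  have fc: "continuous_on bidisc f" by (rule holo2_on_imp_continuous_on[OF f])
  have A: "integral {0..2*pi} (\<lambda>s. (norm (f (of_real r' * (of_real q * cis s), b)))\<^sup>2)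
      \<le> integral {0..2*pi} (\<lambda>s. (norm (f (of_real r' * cis s, b)))\<^sup>2)" if b: "norm b < 1" for b
    by (rule circle_mean_square_mono[OF dilated_slices(1,2)[OF f less_imp_le[OF r'] r(3) b] q(1,2)])
  have B: "integral {0..2*pi} (\<lambda>s. (norm (f (b, of_real r' * (of_real q * cis s))))\<^sup>2)
      \<le> integral {0..2*pi} (\<lambda>s. (norm (f (b, of_real r' * cis s)))\<^sup>2)" if b: "norm b < 1" for b
    by (rule circle_mean_square_mono[OF dilated_slices(3,4)[OF f less_imp_le[OF r'] r(3) b] q(1,2)])
  have cont: "continuous_on X (\<lambda>\<theta>. (norm (f (of_real (p*r') * cis (fst \<theta>), of_real (p'*r') * cis (snd \<theta>))))\<^sup>2)"
    if "0 \<le> p" "p \<le> 1" "0 \<le> p'" "p' \<le> 1" for p p' X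
  proof -
    have "p * r' < 1" "p' * r' < 1" using that r r' by (auto intro: le_less_trans[OF mult_left_le_one_le])
    then show ?thesis using that r r'
      by (intro continuous_intros continuous_on_compose2[OF fc]) (auto simp: bidisc_def norm_mult)
  qed
  have ci: "(\<lambda>s. integral {0..2*pi} (\<lambda>t. g (s, t))) integrable_on {0..2*pi}"
     if "continuous_on UNIV g" for g :: "real \<times> real \<Rightarrow> real"
  proof -
    have "continuous_on {0..2*pi} (\<lambda>s. integral (cbox 0 (2*pi)) (\<lambda>t. g (s, t)))"
      by (rule integral_continuous_on_param) (use continuous_on_subset[OF that] in auto)
    then show ?thesis by (auto simp: cbox_interval intro: integrable_continuous_real)
  qed
  have ci': "(\<lambda>t. integral {0..2*pi} (\<lambda>s. g (s, t))) integrable_on {0..2*pi}"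
     if "continuous_on UNIV g" for g :: "real \<times> real \<Rightarrow> real"
  proof -
    have "continuous_on UNIV (\<lambda>p. g (snd p, fst p))"
      by (intro continuous_intros continuous_on_compose2[OF that]) auto
    from ci[OF this] show ?thesis by simp
  qed
  let ?F = "\<lambda>p p' \<theta>. (norm (f (of_real (p*r') * cis (fst \<theta>), of_real (p'*r') * cis (snd \<theta>))))\<^sup>2"
  have "integral tbox (?F q q) = integral {0..2*pi} (\<lambda>t. integral {0..2*pi} (\<lambda>s. ?F q q (s,t)))"
    using q by (intro tbox_integral_iterated' cont) auto
  also have "\<dots> \<le> integral {0..2*pi} (\<lambda>t. integral {0..2*pi} (\<lambda>s. ?F 1 q (s,t)))"
  proof (rule integral_le)
    fix t assume "t \<in> {0..2*pi}"
    have "norm (of_real (q*r') * cis t) < 1" using q r by (simp add: norm_mult)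
    from A[OF this] show "integral {0..2*pi} (\<lambda>s. ?F q q (s,t)) \<le> integral {0..2*pi} (\<lambda>s. ?F 1 q (s,t))"
      by (simp add: mult_ac)
  qed (intro ci' cont; use q in auto)+
  also have "\<dots> = integral tbox (?F 1 q)"
    using q by (intro tbox_integral_iterated'[symmetric] cont) auto
  also have "\<dots> = integral {0..2*pi} (\<lambda>s. integral {0..2*pi} (\<lambda>t. ?F 1 q (s,t)))"
    using q by (intro tbox_integral_iterated cont) auto
  also have "\<dots> \<le> integral {0..2*pi} (\<lambda>s. integral {0..2*pi} (\<lambda>t. ?F 1 1 (s,t)))"
  proof (rule integral_le)
    fix t assume "t \<in> {0..2*pi}"
    have "norm (of_real r' * cis t) < 1" using r r' by (simp add: norm_mult)
    from B[OF this] show "integral {0..2*pi} (\<lambda>s. ?F 1 q (t,s)) \<le> integral {0..2*pi} (\<lambda>s. ?F 1 1 (t,s))"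
      by (simp add: mult_ac)
  qed (intro ci cont; use q in auto)+
  also have "\<dots> = integral tbox (?F 1 1)"
    using q by (intro tbox_integral_iterated[symmetric] cont) auto
  finally have "integral tbox (?F q q) \<le> integral tbox (?F 1 1)" .
  then show ?thesis unfolding H2mean_def by (intro divide_right_mono) (auto simp: q(3))
qed simp

text \<open>In the torus variable \<open>cnj (szego w _)\<close> is the boundary value of a
  holomorphic function, and integration against \<open>szego z\<close> evaluates it at
  \<open>z\<close>. This identifies the Gram kernel of the Szego kernels, which Schur's test
  needs.\<close>

lemma szego_reproducing:
  assumes z: "z \<in> bidisc" and w: "w \<in> bidisc"
  shows "integral tbox (\<lambda>\<theta>. szego z (tor \<theta>) * cnj (szego w (tor \<theta>))) = 4 * pi\<^sup>2 * szego z w"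
proof -
  obtain w1 w2 where ww: "w = (w1, w2)" by force
  obtain z1 z2 where zz: "z = (z1, z2)" by force
  have w1: "norm w1 < 1" and w2: "norm w2 < 1" using w ww by (auto simp: bidisc_def)
  have z1: "norm z1 < 1" and z2: "norm z2 < 1" using z zz by (auto simp: bidisc_def)
  have one: "integral {0..2*pi} (\<lambda>t. (1 / (1 - z * cnj (cis t))) * cnj (1 / (1 - w * cnj (cis t)))) = 2 * pi * (1 / (1 - z * cnj w))"
    if "norm z < 1" "norm w < 1" for z w :: complex
  proof -
    have ne: "1 - cnj w * u \<noteq> 0" if "norm u \<le> 1" for u
      using norm_mult_lt_one[of "cnj w" u] \<open>norm w < 1\<close> that by simp
    have "continuous_on (cball 0 1) (\<lambda>u. 1 / (1 - cnj w * u))" "(\<lambda>u. 1 / (1 - cnj w * u)) holomorphic_on ball 0 1"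
      using ne by (auto intro!: continuous_intros holomorphic_intros)
    from circle_Cauchy_formula[OF this \<open>norm z < 1\<close>] show ?thesis
      by (intro integral_unique) (simp add: mult_ac)
  qed
  have c: "continuous_on tbox (\<lambda>\<theta>. szego z (tor \<theta>) * cnj (szego w (tor \<theta>)))"
    by (intro continuous_intros continuous_on_szego) (auto simp: tor_in_cbidisc z w)
  have "integral tbox (\<lambda>\<theta>. szego z (tor \<theta>) * cnj (szego w (tor \<theta>)))
     = integral {0..2*pi} (\<lambda>s. integral {0..2*pi} (\<lambda>t. szego z (tor (s,t)) * cnj (szego w (tor (s,t)))))"
    by (rule tbox_integral_iterated[OF c])
  also have "\<dots> = integral {0..2*pi} (\<lambda>s. integral {0..2*pi} (\<lambda>t. ((1 / (1 - z1 * cnj (cis s))) * cnj (1 / (1 - w1 * cnj (cis s)))) *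
     ((1 / (1 - z2 * cnj (cis t))) * cnj (1 / (1 - w2 * cnj (cis t))))))"
    unfolding szego_def tor_def zz ww by (simp add: mult_ac)
  also have "\<dots> = integral {0..2*pi} (\<lambda>s. ((1 / (1 - z1 * cnj (cis s))) * cnj (1 / (1 - w1 * cnj (cis s)))) * (2 * pi * (1 / (1 - z2 * cnj w2))))"
    by (subst integral_mult_right, subst one[OF z2 w2]) simp
  also have "\<dots> = (2 * pi * (1 / (1 - z1 * cnj w1))) * (2 * pi * (1 / (1 - z2 * cnj w2)))"
    by (subst integral_mult_left, subst one[OF z1 w1]) simp
  also have "\<dots> = 4 * pi\<^sup>2 * szego z w"
    unfolding szego_def zz ww by (simp add: power2_eq_square)
  finally show ?thesis .
qed


section \<open>Schur's test for a reproducing kernel\<close>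

lemma continuous_on_fst_lift: "continuous_on A u \<Longrightarrow> continuous_on (A \<times> B) (\<lambda>p. u (fst p))"
  by (rule continuous_on_compose2[of A u]) (auto intro!: continuous_intros)

lemma continuous_on_snd_lift: "continuous_on B u \<Longrightarrow> continuous_on (A \<times> B) (\<lambda>p. u (snd p))"
  by (rule continuous_on_compose2[of B u]) (auto intro!: continuous_intros)

lemma continuous_on_section:
  assumes "continuous_on (A \<times> B) (\<lambda>p. f (fst p) (snd p))" "x \<in> A"
  shows "continuous_on B (f x)"
proof -
  have "continuous_on B (\<lambda>y. (x, y))" by (intro continuous_intros)
  from continuous_on_compose2[OF assms(1) this] assms(2) show ?thesis by auto
qed

lemma continuous_on_swap_args:
  assumes "continuous_on (A \<times> B) (\<lambda>p. f (fst p) (snd p))"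
  shows "continuous_on (B \<times> A) (\<lambda>p. f (snd p) (fst p))"
proof -
  have "continuous_on (B \<times> A) (\<lambda>p. (snd p, fst p))" by (intro continuous_intros)
  from continuous_on_compose2[OF assms this] show ?thesis by (simp add: image_subset_iff)
qed

lemma continuous_on_integral_right:
  fixes f :: "'a::topological_space \<Rightarrow> 'b::euclidean_space \<Rightarrow> 'c::banach"
  assumes "continuous_on (A \<times> cbox a b) (\<lambda>p. f (fst p) (snd p))"
  shows "continuous_on A (\<lambda>x. integral (cbox a b) (f x))"
  using assms by (intro integral_continuous_on_param) (simp add: split_beta)

lemma integral_swap_fst_snd:
  fixes f :: "'a::euclidean_space \<Rightarrow> 'b::euclidean_space \<Rightarrow> 'c::banach"
  assumes "continuous_on (cbox a b \<times> cbox c d) (\<lambda>p. f (fst p) (snd p))"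
  shows "integral (cbox a b) (\<lambda>x. integral (cbox c d) (f x)) =
    integral (cbox c d) (\<lambda>y. integral (cbox a b) (\<lambda>x. f x y))"
  using integral_swap_continuous[of a c b d f] assms by (simp add: split_beta cbox_Pair_eq)

lemma integral_complex_of_real':
  fixes f :: "'a::euclidean_space \<Rightarrow> real"
  assumes "f integrable_on S"
  shows "integral S (\<lambda>x. complex_of_real (f x)) = complex_of_real (integral S f)"
  using integral_linear[OF assms bounded_linear_of_real[where 'a=complex]] by (simp add: o_def)

lemma integral_cnj':
  fixes f :: "'a::euclidean_space \<Rightarrow> complex"
  assumes "f integrable_on S"
  shows "integral S (\<lambda>x. cnj (f x)) = cnj (integral S f)"
  using integral_linear[OF assms bounded_linear_cnj] by (simp add: o_def)

text \<open>The square of the weighted norm of \<open>u\<close> is written as a pairing of \<open>g\<close> with the adjoint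
  \<open>W\<close>, whose norm is controlled by the Gram kernel \<open>G\<close> through Schur's test with constant test
  function; balancing the two terms of the arithmetic-geometric inequality with the weight \<open>M\<close>
  absorbs one half of the left-hand side.\<close>

lemma Schur_embedding:
  fixes k G :: "'a::euclidean_space \<Rightarrow> 'a \<Rightarrow> complex" and u g :: "'a \<Rightarrow> complex" and v :: "'a \<Rightarrow> real"
    and c M :: real and a b :: 'a
  defines "B \<equiv> cbox a b"
  assumes k: "continuous_on (B \<times> B) (\<lambda>p. k (fst p) (snd p))"
    and G: "continuous_on (B \<times> B) (\<lambda>p. G (fst p) (snd p))"
    and u: "continuous_on B u" and g: "continuous_on B g" and v: "continuous_on B v"
    and v0: "\<And>x. x \<in> B \<Longrightarrow> 0 \<le> v x" and c: "0 < c" and M: "0 < M"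
    and ueq: "\<And>x. x \<in> B \<Longrightarrow> u x = c * integral B (\<lambda>t. g t * k x t)"
    and Geq: "\<And>x y. x \<in> B \<Longrightarrow> y \<in> B \<Longrightarrow> c * integral B (\<lambda>t. k x t * cnj (k y t)) = G x y"
    and Mb: "\<And>x. x \<in> B \<Longrightarrow> integral B (\<lambda>y. v y * cmod (G x y)) \<le> M"
  shows "integral B (\<lambda>x. v x * (cmod (u x))\<^sup>2) \<le> M * (c * integral B (\<lambda>t. (cmod (g t))\<^sup>2))"
proof -
  note lift = continuous_on_fst_lift continuous_on_snd_lift
  have intg: "f integrable_on B" if "continuous_on B f" for f :: "'a \<Rightarrow> complex"
    using that unfolding B_def by (rule integrable_continuous)
  have intr: "f integrable_on B" if "continuous_on B f" for f :: "'a \<Rightarrow> real"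
    using that unfolding B_def by (rule integrable_continuous)
  define X where "X = integral B (\<lambda>x. v x * (cmod (u x))\<^sup>2)"
  \<comment> \<open>Chosen so that \<open>X\<close> is the integral of \<open>w * u\<close>;
    inserting \<open>ueq\<close> and exchanging the integrals moves the kernel onto \<open>w\<close>
    and leaves \<open>g\<close> paired with \<open>W\<close>.\<close>
  define w where "w = (\<lambda>x. v x * cnj (u x))"
  have w: "continuous_on B w" unfolding w_def by (intro continuous_intros u v)
  define W where "W = (\<lambda>t. integral B (\<lambda>x. w x * k x t))"
  have wk: "continuous_on (B \<times> B) (\<lambda>p. w (fst p) * k (fst p) (snd p))"
    by (intro continuous_intros lift w k)
  have kt: "continuous_on B (\<lambda>x. k x t)" if "t \<in> B" for t
    using continuous_on_section[OF continuous_on_swap_args[OF k] that] .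
  have kx: "continuous_on B (k x)" if "x \<in> B" for x
    using continuous_on_section[OF k that] .
  have Wc: "continuous_on B W" unfolding W_def
    using continuous_on_integral_right[OF continuous_on_swap_args[OF wk[unfolded B_def]]] by (simp add: B_def)
  have c1: "complex_of_real X = c * integral B (\<lambda>t. g t * W t)"
  proof -
    have "complex_of_real X = integral B (\<lambda>x. complex_of_real (v x * (cmod (u x))\<^sup>2))"
      unfolding X_def by (intro integral_complex_of_real'[symmetric] intr continuous_intros u v)
    also have "\<dots> = integral B (\<lambda>x. c * integral B (\<lambda>t. w x * k x t * g t))"
    proof (rule integral_cong)
      fix x assume x: "x \<in> B"
      have "complex_of_real (v x * (cmod (u x))\<^sup>2) = w x * u x"
        unfolding w_def by (simp add: complex_norm_square mult_ac del: of_real_power)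
      also have "\<dots> = c * (w x * integral B (\<lambda>t. g t * k x t))" by (simp add: ueq[OF x])
      also have "\<dots> = c * integral B (\<lambda>t. w x * (g t * k x t))" by simp
      finally show "complex_of_real (v x * (cmod (u x))\<^sup>2) = c * integral B (\<lambda>t. w x * k x t * g t)"
        by (simp add: mult_ac)
    qed
    also have "\<dots> = c * integral B (\<lambda>x. integral B (\<lambda>t. w x * k x t * g t))" by simp
    also have "integral B (\<lambda>x. integral B (\<lambda>t. w x * k x t * g t)) = integral B (\<lambda>t. integral B (\<lambda>x. w x * k x t * g t))"
      unfolding B_def by (rule integral_swap_fst_snd) (intro continuous_intros lift w k g; simp flip: B_def add: w k g lift)
    also have "\<dots> = integral B (\<lambda>t. g t * W t)" unfolding W_def by (simp add: mult.commute)
    finally show ?thesis .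
  qed
  \<comment> \<open>Expanding the square of \<open>W\<close> and integrating out \<open>t\<close>
    leaves \<open>k x t * cnj (k y t)\<close> integrated in \<open>t\<close>, which is the Gram
    kernel up to the factor \<open>c\<close>.\<close>
  have c2: "complex_of_real (c * integral B (\<lambda>t. (cmod (W t))\<^sup>2)) = integral B (\<lambda>x. integral B (\<lambda>y. w x * cnj (w y) * G x y))"
  proof -
    have "complex_of_real (integral B (\<lambda>t. (cmod (W t))\<^sup>2)) = integral B (\<lambda>t. complex_of_real ((cmod (W t))\<^sup>2))"
      by (intro integral_complex_of_real'[symmetric] intr continuous_intros Wc)
    also have "\<dots> = integral B (\<lambda>t. integral B (\<lambda>x. w x * k x t * cnj (W t)))"
      by (simp add: W_def complex_norm_square del: of_real_power)
    also have "\<dots> = integral B (\<lambda>x. integral B (\<lambda>t. w x * k x t * cnj (W t)))"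
      unfolding B_def by (rule integral_swap_fst_snd[symmetric])
        (intro continuous_intros lift w k g Wc; simp flip: B_def add: w k g lift Wc)
    also have "\<dots> = integral B (\<lambda>x. w x * integral B (\<lambda>t. k x t * cnj (W t)))" by (simp add: mult.assoc)
    also have "\<dots> = integral B (\<lambda>x. w x * integral B (\<lambda>y. cnj (w y) * integral B (\<lambda>t. k x t * cnj (k y t))))"
    proof (rule integral_cong)
      fix x assume x: "x \<in> B"
      have "integral B (\<lambda>t. k x t * cnj (W t)) = integral B (\<lambda>t. integral B (\<lambda>y. k x t * (cnj (w y) * cnj (k y t))))"
      proof (rule integral_cong)
        fix t assume t: "t \<in> B"
        have "cnj (W t) = integral B (\<lambda>y. cnj (w y * k y t))"
          unfolding W_def by (intro integral_cnj'[symmetric] intg continuous_intros w kt t)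
        then show "k x t * cnj (W t) = integral B (\<lambda>y. k x t * (cnj (w y) * cnj (k y t)))" by simp
      qed
      also have "\<dots> = integral B (\<lambda>y. integral B (\<lambda>t. k x t * (cnj (w y) * cnj (k y t))))"
        unfolding B_def by (rule integral_swap_fst_snd)
         (intro continuous_intros lift; simp flip: B_def add: w kx[OF x] continuous_on_swap_args[OF k] lift)
      also have "\<dots> = integral B (\<lambda>y. cnj (w y) * integral B (\<lambda>t. k x t * cnj (k y t)))"
        by (subst integral_mult_right[symmetric]) (simp add: mult_ac)
      finally show "w x * integral B (\<lambda>t. k x t * cnj (W t)) = w x * integral B (\<lambda>y. cnj (w y) * integral B (\<lambda>t. k x t * cnj (k y t)))"
        by simp
    qed
    finally have "complex_of_real (c * integral B (\<lambda>t. (cmod (W t))\<^sup>2)) =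
       c * integral B (\<lambda>x. w x * integral B (\<lambda>y. cnj (w y) * integral B (\<lambda>t. k x t * cnj (k y t))))" by simp
    also have "\<dots> = integral B (\<lambda>x. integral B (\<lambda>y. w x * cnj (w y) * (c * integral B (\<lambda>t. k x t * cnj (k y t)))))"
      by (subst integral_mult_right[symmetric], subst integral_mult_right[symmetric], subst integral_mult_right[symmetric])
         (simp add: mult_ac)
    also have "\<dots> = integral B (\<lambda>x. integral B (\<lambda>y. w x * cnj (w y) * G x y))"
      by (intro integral_cong) (simp add: Geq)
    finally show ?thesis .
  qed
  have Gsym: "cmod (G x y) = cmod (G y x)" if "x \<in> B" "y \<in> B" for x y
  proof -
    have "integral B (\<lambda>t. k y t * cnj (k x t)) = integral B (\<lambda>t. cnj (k x t * cnj (k y t)))"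
      by (simp add: mult.commute)
    also have "\<dots> = cnj (integral B (\<lambda>t. k x t * cnj (k y t)))"
      using that by (intro integral_cnj' intg continuous_intros kx)
    finally have "G y x = cnj (G x y)" using that by (simp flip: Geq)
    then show ?thesis by simp
  qed
  have Gx: "continuous_on B (G x)" if "x \<in> B" for x
    using continuous_on_section[OF G that] .
  \<comment> \<open>Applying the arithmetic-geometric inequality to
    \<open>cmod (u x) * cmod (u y)\<close> produces \<open>E x y\<close> and \<open>E y x\<close>.
    In the first, \<open>y\<close> occurs only in the integral bounded by \<open>Mb\<close>; the
    second has the same double integral by Fubini.\<close>
  define E where "E = (\<lambda>x y. v x * (cmod (u x))\<^sup>2 * (v y * cmod (G x y)))"
  have Ec: "continuous_on (B \<times> B) (\<lambda>p. E (fst p) (snd p))"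
    unfolding E_def by (intro continuous_intros lift u v G)
  have E': "E y x = v y * (cmod (u y))\<^sup>2 * (v x * cmod (G x y))" if "x \<in> B" "y \<in> B" for x y
    unfolding E_def using Gsym[OF that] by simp
  have EM: "integral B (\<lambda>x. integral B (E x)) \<le> M * X"
  proof -
    have "integral B (\<lambda>x. integral B (E x)) \<le> integral B (\<lambda>x. v x * (cmod (u x))\<^sup>2 * M)"
    proof (rule integral_le)
      show "(\<lambda>x. integral B (E x)) integrable_on B"
        using continuous_on_integral_right[OF Ec[unfolded B_def]] intr by (simp add: B_def)
      show "(\<lambda>x. v x * (cmod (u x))\<^sup>2 * M) integrable_on B" by (intro intr continuous_intros u v)
      fix x assume x: "x \<in> B"
      have "integral B (E x) = v x * (cmod (u x))\<^sup>2 * integral B (\<lambda>y. v y * cmod (G x y))"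
        unfolding E_def by simp
      then show "integral B (E x) \<le> v x * (cmod (u x))\<^sup>2 * M"
        using Mb[OF x] v0[OF x] by (auto intro!: mult_left_mono)
    qed
    then show ?thesis unfolding X_def by (simp add: mult.commute)
  qed
  have c3: "c * integral B (\<lambda>t. (cmod (W t))\<^sup>2) \<le> M * X"
  proof -
    have "c * integral B (\<lambda>t. (cmod (W t))\<^sup>2) \<le> norm (complex_of_real (c * integral B (\<lambda>t. (cmod (W t))\<^sup>2)))"
      by (simp only: norm_of_real abs_ge_self)
    also have "\<dots> = norm (integral B (\<lambda>x. integral B (\<lambda>y. w x * cnj (w y) * G x y)))" by (simp only: c2)
    also have "\<dots> \<le> integral B (\<lambda>x. integral B (\<lambda>y. (E x y + E y x) / 2))"
    proof (rule integral_norm_bound_integral)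
      have "continuous_on (B \<times> B) (\<lambda>p. w (fst p) * cnj (w (snd p)) * G (fst p) (snd p))"
        by (intro continuous_intros lift w G)
      from continuous_on_integral_right[OF this[unfolded B_def]]
      show "(\<lambda>x. integral B (\<lambda>y. w x * cnj (w y) * G x y)) integrable_on B" by (intro intg) (simp add: B_def)
      have "continuous_on (B \<times> B) (\<lambda>p. (E (fst p) (snd p) + E (snd p) (fst p)) / 2)"
        by (intro continuous_intros Ec continuous_on_swap_args[OF Ec]) auto
      from continuous_on_integral_right[OF this[unfolded B_def]]
      show "(\<lambda>x. integral B (\<lambda>y. (E x y + E y x) / 2)) integrable_on B" by (intro intr) (simp add: B_def)
      fix x assume x: "x \<in> B"
      show "norm (integral B (\<lambda>y. w x * cnj (w y) * G x y)) \<le> integral B (\<lambda>y. (E x y + E y x) / 2)"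
      proof (rule integral_norm_bound_integral)
        show "(\<lambda>y. w x * cnj (w y) * G x y) integrable_on B" by (intro intg continuous_intros w Gx x)
        show "(\<lambda>y. (E x y + E y x) / 2) integrable_on B"
          by (intro intr continuous_intros continuous_on_section[OF Ec x]
             continuous_on_section[OF continuous_on_swap_args[OF Ec] x]) auto
        fix y assume y: "y \<in> B"
        have "2 * (cmod (u x) * cmod (u y)) \<le> (cmod (u x))\<^sup>2 + (cmod (u y))\<^sup>2"
          using sum_squares_bound[of "cmod (u x)" "cmod (u y)"] by (simp add: mult.assoc)
        then have "v x * v y * cmod (G x y) * (cmod (u x) * cmod (u y)) \<le> v x * v y * cmod (G x y) * (((cmod (u x))\<^sup>2 + (cmod (u y))\<^sup>2) / 2)"
          using v0 x y by (intro mult_left_mono) auto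
        moreover have "norm (w x * cnj (w y) * G x y) = v x * v y * cmod (G x y) * (cmod (u x) * cmod (u y))"
          unfolding w_def using v0 x y by (simp add: norm_mult)
        moreover have "(E x y + E y x) / 2 = v x * v y * cmod (G x y) * (((cmod (u x))\<^sup>2 + (cmod (u y))\<^sup>2) / 2)"
          unfolding E'[OF x y] unfolding E_def by (simp add: algebra_simps)
        ultimately show "norm (w x * cnj (w y) * G x y) \<le> (E x y + E y x) / 2" by simp
      qed
    qed
    also have "\<dots> = integral B (\<lambda>x. (integral B (E x) + integral B (\<lambda>y. E y x)) / 2)"
    proof (rule integral_cong)
      fix x assume x: "x \<in> B"
      have "integral B (\<lambda>y. E x y + E y x) = integral B (E x) + integral B (\<lambda>y. E y x)"
        by (intro integral_add intr continuous_on_section[OF Ec x]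
             continuous_on_section[OF continuous_on_swap_args[OF Ec] x])
      then show "integral B (\<lambda>y. (E x y + E y x) / 2) = (integral B (E x) + integral B (\<lambda>y. E y x)) / 2" by simp
    qed
    also have "\<dots> = (integral B (\<lambda>x. integral B (E x)) + integral B (\<lambda>x. integral B (\<lambda>y. E y x))) / 2"
      using continuous_on_integral_right[OF Ec[unfolded B_def]]
        continuous_on_integral_right[OF continuous_on_swap_args[OF Ec[unfolded B_def]]]
      by (subst integral_divide, subst integral_add) (auto intro!: integrable_continuous simp: B_def)
    also have "integral B (\<lambda>x. integral B (\<lambda>y. E y x)) = integral B (\<lambda>x. integral B (E x))"
      unfolding B_def by (rule integral_swap_fst_snd[symmetric]) (use Ec in \<open>simp add: B_def\<close>)
    also have "(integral B (\<lambda>x. integral B (E x)) + integral B (\<lambda>x. integral B (E x))) / 2 \<le> M * X"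
      using EM by simp
    finally show ?thesis .
  qed
  define N where "N = c * integral B (\<lambda>t. (cmod (g t))\<^sup>2)"
  have "X \<le> norm (complex_of_real X)" by (simp only: norm_of_real abs_ge_self)
  also have "\<dots> = c * norm (integral B (\<lambda>t. g t * W t))" using c unfolding c1 by (simp add: norm_mult)
  also have "\<dots> \<le> c * integral B (\<lambda>t. (M * (cmod (g t))\<^sup>2 + (cmod (W t))\<^sup>2 / M) / 2)"
  proof (intro mult_left_mono integral_norm_bound_integral)
    show "(\<lambda>t. g t * W t) integrable_on B" by (intro intg continuous_intros g Wc)
    show "(\<lambda>t. (M * (cmod (g t))\<^sup>2 + (cmod (W t))\<^sup>2 / M) / 2) integrable_on B"
      using M by (intro intr continuous_intros g Wc) auto
    fix t
    have "2 * M * (cmod (g t) * cmod (W t)) \<le> M\<^sup>2 * (cmod (g t))\<^sup>2 + (cmod (W t))\<^sup>2"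
      using sum_squares_bound[of "M * cmod (g t)" "cmod (W t)"] by (simp add: power_mult_distrib mult_ac)
    then show "norm (g t * W t) \<le> (M * (cmod (g t))\<^sup>2 + (cmod (W t))\<^sup>2 / M) / 2"
      using M by (simp add: field_simps power2_eq_square norm_mult)
  qed (use c in auto)
  also have "integral B (\<lambda>t. (M * (cmod (g t))\<^sup>2 + (cmod (W t))\<^sup>2 / M) / 2)
     = (M * integral B (\<lambda>t. (cmod (g t))\<^sup>2) + integral B (\<lambda>t. (cmod (W t))\<^sup>2) / M) / 2"
    using M by (subst integral_divide, subst integral_add) (auto intro!: intr continuous_intros g Wc)
  also have "c * \<dots> = (M * N + (c * integral B (\<lambda>t. (cmod (W t))\<^sup>2)) / M) / 2"
    unfolding N_def by (simp add: field_simps)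
  also have "\<dots> \<le> (M * N + X) / 2"
    using c3 M by (simp add: divide_right_mono field_simps)
  finally have "X \<le> M * N" by simp
  then show ?thesis unfolding X_def N_def .
qed


section \<open>Holomorphy of Szego integrals and normal families\<close>

lemma continuous_on_tbox_tor_dilated:
  assumes "holo2_on bidisc f" "0 \<le> r" "r < 1"
  shows "continuous_on S (\<lambda>t. f (r *\<^sub>R tor t))"
  by (rule continuous_on_dilated[OF assms]) (auto intro!: continuous_intros tor_in_cbidisc)

lemma szego_has_derivative:
  assumes "z \<in> bidisc" "w \<in> cbidisc"
  shows "((\<lambda>z. szego z w) has_derivative
     (\<lambda>h. cnj (fst w) / ((1 - fst z * cnj (fst w))\<^sup>2 * (1 - snd z * cnj (snd w))) * fst h
        + cnj (snd w) / ((1 - fst z * cnj (fst w)) * (1 - snd z * cnj (snd w))\<^sup>2) * snd h)) (at z within S)"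
proof -
  define A where "A = 1 - fst z * cnj (fst w)"
  define B where "B = 1 - snd z * cnj (snd w)"
  have ne: "A \<noteq> 0" "B \<noteq> 0" using szego_denom_ne[OF assms] by (auto simp: A_def B_def)
  have "((\<lambda>z. (1 - fst z * cnj (fst w)) * (1 - snd z * cnj (snd w))) has_derivative
     (\<lambda>h. A * (- (snd h * cnj (snd w))) + (- (fst h * cnj (fst w))) * B)) (at z within S)"
    unfolding A_def B_def by (auto intro!: derivative_eq_intros)
  from Deriv.has_derivative_inverse[OF _ this] ne
  have "((\<lambda>z. inverse ((1 - fst z * cnj (fst w)) * (1 - snd z * cnj (snd w)))) has_derivative
     (\<lambda>h. - (inverse (A * B) * (A * (- (snd h * cnj (snd w))) + (- (fst h * cnj (fst w))) * B) * inverse (A * B)))) (at z within S)"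
    by (simp add: A_def B_def)
  then show ?thesis unfolding szego_def A_def[symmetric] B_def[symmetric] inverse_eq_divide
    by (rule has_derivative_eq_rhs) (use ne in \<open>simp add: fun_eq_iff field_simps power2_eq_square\<close>)
qed

text \<open>Serves to show that locally uniform limits are holomorphic: they inherit a Szego
  integral representation, and such integrals can be differentiated under the integral sign.\<close>

lemma holo2_on_szego_integral:
  fixes g :: "real \<times> real \<Rightarrow> complex"
  assumes g: "continuous_on tbox g"
  shows "holo2_on bidisc (\<lambda>z. integral tbox (\<lambda>t. g t * szego z (tor t)))"
  unfolding holo2_on_def
proof
  fix z assume z: "z \<in> bidisc"
  define A where "A = (\<lambda>z t. g t * (cnj (fst (tor t)) / ((1 - fst z * cnj (fst (tor t)))\<^sup>2 * (1 - snd z * cnj (snd (tor t))))))"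
  define B where "B = (\<lambda>z t. g t * (cnj (snd (tor t)) / ((1 - fst z * cnj (fst (tor t))) * (1 - snd z * cnj (snd (tor t)))\<^sup>2)))"
  \<comment> \<open>The Leibniz rule asks for the derivative as a bounded linear function depending
    continuously on both arguments; \<open>A\<close> and \<open>B\<close> are its two complex
    coefficients.\<close>
  define D where "D = (\<lambda>z t. (blinfun_mult_right (A z t) o\<^sub>L fst_blinfun) + (blinfun_mult_right (B z t) o\<^sub>L snd_blinfun))"
  have gl: "continuous_on (bidisc \<times> tbox) (\<lambda>p. g (snd p))" by (rule continuous_on_snd_lift[OF g])
  have ne: "(1 - fst z * cnj (fst (tor t))) \<noteq> 0" "(1 - snd z * cnj (snd (tor t))) \<noteq> 0" if "z \<in> bidisc" for z t
    using szego_denom_ne[OF that tor_in_cbidisc] by auto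
  have Ac: "continuous_on (bidisc \<times> tbox) (\<lambda>p. A (fst p) (snd p))"
    unfolding A_def using ne by (intro continuous_intros gl) auto
  have Bc: "continuous_on (bidisc \<times> tbox) (\<lambda>p. B (fst p) (snd p))"
    unfolding B_def using ne by (intro continuous_intros gl) auto
  have Dc: "continuous_on (bidisc \<times> tbox) (\<lambda>(z, t). D z t)"
    unfolding D_def split_beta
    by (intro continuous_intros Ac Bc bounded_linear.continuous_on[OF bounded_linear_blinfun_mult_right]
      bounded_bilinear.continuous_on[OF bounded_bilinear_blinfun_compose])
  have d: "((\<lambda>z. g t * szego z (tor t)) has_derivative blinfun_apply (D z t)) (at z within bidisc)"
    if "z \<in> bidisc" for z t
    by (rule has_derivative_eq_rhs[OF has_derivative_mult_right[OF szego_has_derivative[OF that tor_in_cbidisc]]])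
      (simp add: D_def A_def B_def fun_eq_iff algebra_simps blinfun.add_left)
  have cv: "convex bidisc" unfolding bidisc_def by (intro convex_Times) auto
  have int: "(\<lambda>t. g t * szego z (tor t)) integrable_on tbox" if "z \<in> bidisc" for z
    by (intro integrable_continuous continuous_intros g continuous_on_szego) (auto simp: that tor_in_cbidisc)
  from leibniz_rule[OF d int Dc z cv]
  have der: "((\<lambda>z. integral tbox (\<lambda>t. g t * szego z (tor t))) has_derivative integral tbox (D z)) (at z)"
    using at_within_open[OF z open_bidisc] by simp
  have Di: "D z integrable_on tbox"
    using continuous_on_section[of bidisc tbox D z] Dc z
    by (intro integrable_continuous) (auto simp: split_beta)
  have Ai: "A z integrable_on tbox" "B z integrable_on tbox"
    using continuous_on_section[OF Ac z] continuous_on_section[OF Bc z] by (auto intro!: integrable_continuous)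
  have "blinfun_apply (integral tbox (D z)) h = integral tbox (A z) * fst h + integral tbox (B z) * snd h" for h
  proof -
    have "blinfun_apply (integral tbox (D z)) h = integral tbox (\<lambda>t. A z t * fst h + B z t * snd h)"
      by (subst blinfun_apply_integral[OF Di]) (simp add: D_def blinfun.add_left)
    also have "\<dots> = integral tbox (A z) * fst h + integral tbox (B z) * snd h"
      using Ai by (subst integral_add) (auto intro: integrable_on_mult_left)
    finally show ?thesis .
  qed
  then have "blinfun_apply (integral tbox (D z)) = (\<lambda>h. integral tbox (A z) * fst h + integral tbox (B z) * snd h)" by auto
  with der show "\<exists>a b. ((\<lambda>z. integral tbox (\<lambda>t. g t * szego z (tor t))) has_derivative (\<lambda>h. a * fst h + b * snd h)) (at z)"
    by auto
qed

lemma bidisc_as_dilate: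
  assumes "z \<in> bidisc"
  obtains r y where "0 < r" "r < 1" "y \<in> bidisc" "z = r *\<^sub>R y"
proof
  define m where "m = max (cmod (fst z)) (cmod (snd z))"
  define r where "r = (1 + m) / 2"
  have m: "0 \<le> m" "m < 1" using assms by (auto simp: m_def bidisc_def max_def)
  show r: "0 < r" "r < 1" using m by (auto simp: r_def)
  have "cmod (fst z) < r" "cmod (snd z) < r" using m by (auto simp: r_def m_def max_def)
  then show "(1 / r) *\<^sub>R z \<in> bidisc" using r by (cases z) (auto simp: bidisc_def field_simps)
  show "z = r *\<^sub>R ((1 / r) *\<^sub>R z)" using r by simp
qed

lemma holo2_on_of_dilates:
  assumes "\<And>r. 0 < r \<Longrightarrow> r < 1 \<Longrightarrow> holo2_on bidisc (\<lambda>z. g (r *\<^sub>R z))"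
  shows "holo2_on bidisc g"
  unfolding holo2_on_def
proof
  fix z assume "z \<in> bidisc"
  then obtain r y where r: "0 < r" "r < 1" and y: "y \<in> bidisc" "z = r *\<^sub>R y" by (rule bidisc_as_dilate)
  obtain a b where d: "((\<lambda>z. g (r *\<^sub>R z)) has_derivative (\<lambda>h. a * fst h + b * snd h)) (at y)"
    using assms[OF r] y unfolding holo2_on_def by blast
  have e: "y = (1 / r) *\<^sub>R z" using r y by simp
  have "((\<lambda>z. (1 / r) *\<^sub>R z) has_derivative (\<lambda>h. (1 / r) *\<^sub>R h)) (at z)" by (auto intro!: derivative_eq_intros)
  from diff_chain_at[OF this, of "\<lambda>z. g (r *\<^sub>R z)"] d e
  have "((\<lambda>z. g (r *\<^sub>R z)) o (\<lambda>z. (1 / r) *\<^sub>R z) has_derivative (\<lambda>h. a * fst h + b * snd h) o (\<lambda>h. (1 / r) *\<^sub>R h)) (at z)"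
    by auto
  then have "(g has_derivative (\<lambda>h. (a / of_real r) * fst h + (b / of_real r) * snd h)) (at z)"
    using r by (simp add: o_def scaleR_conv_of_real divide_inverse mult_ac)
  then show "\<exists>a b. (g has_derivative (\<lambda>h. a * fst h + b * snd h)) (at z)" by blast
qed

lemma cmod_one_minus_ge:
  assumes "cmod z \<le> 1" "cmod w \<le> 1" "0 \<le> \<rho>"
  shows "1 - \<rho> \<le> cmod (1 - of_real \<rho> * z * cnj w)"
proof -
  have "cmod (of_real \<rho> * z * cnj w) = \<rho> * (cmod z * cmod w)" using assms by (simp add: norm_mult)
  also have "\<dots> \<le> \<rho> * 1" using assms by (intro mult_left_mono mult_le_one) auto
  finally show ?thesis using norm_triangle_ineq2[of 1 "of_real \<rho> * z * cnj w"] by simp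
qed

lemma szego_dilated_bound:
  assumes "y \<in> cbidisc" "w \<in> cbidisc" "0 \<le> \<rho>" "\<rho> < 1"
  shows "cmod (szego (\<rho> *\<^sub>R y) w) \<le> 1 / (1 - \<rho>)\<^sup>2"
proof -
  have 1: "1 - \<rho> \<le> cmod (1 - of_real \<rho> * fst y * cnj (fst w))" "1 - \<rho> \<le> cmod (1 - of_real \<rho> * snd y * cnj (snd w))"
    using assms by (auto intro!: cmod_one_minus_ge simp: cbidisc_def)
  have "(1 - \<rho>)\<^sup>2 \<le> cmod (1 - of_real \<rho> * fst y * cnj (fst w)) * cmod (1 - of_real \<rho> * snd y * cnj (snd w))"
    unfolding power2_eq_square using 1 assms by (intro mult_mono) auto
  then show ?thesis unfolding szego_def using assms
    by (simp add: norm_mult norm_divide frac_le scaleR_conv_of_real)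
qed

text \<open>The inequality \<open>x \<le> 1 + x\<^sup>2\<close> replaces Cauchy-Schwarz. The
  resulting bound is not homogeneous in \<open>f\<close>, but it is linear in the size
  \<open>e\<close> of the kernel, which is what growth estimates and equicontinuity use.\<close>

lemma holo2_dilate_kernel_bound:
  assumes f: "holo2_on bidisc f" and r: "0 \<le> r" "r < 1" and k: "continuous_on tbox k"
    and e: "\<And>t. t \<in> tbox \<Longrightarrow> cmod (k t) \<le> e"
  shows "cmod (integral tbox (\<lambda>t. f (r *\<^sub>R tor t) * k t)) \<le> e * (4 * pi\<^sup>2 * (1 + H2mean r f))"
proof -
  note fc = continuous_on_tbox_tor_dilated[OF f r]
  have e0: "0 \<le> e" using order_trans[OF norm_ge_zero e[of "(0,0)"]] by auto
  have i: "(\<lambda>t. (cmod (f (r *\<^sub>R tor t)))\<^sup>2) integrable_on tbox"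
    by (intro integrable_continuous continuous_intros fc)
  have "cmod (integral tbox (\<lambda>t. f (r *\<^sub>R tor t) * k t)) \<le> integral tbox (\<lambda>t. e * (1 + (cmod (f (r *\<^sub>R tor t)))\<^sup>2))"
  proof (rule integral_norm_bound_integral)
    show "(\<lambda>t. f (r *\<^sub>R tor t) * k t) integrable_on tbox"
      by (intro integrable_continuous continuous_intros fc k)
    show "(\<lambda>t. e * (1 + (cmod (f (r *\<^sub>R tor t)))\<^sup>2)) integrable_on tbox"
      by (intro integrable_continuous continuous_intros fc)
    fix t assume t: "t \<in> tbox"
    have "x \<le> 1 + x\<^sup>2" for x :: real
      using zero_le_power2[of "x - 1/2"] by (simp add: power2_diff power_divide)
    then show "norm (f (r *\<^sub>R tor t) * k t) \<le> e * (1 + (cmod (f (r *\<^sub>R tor t)))\<^sup>2)"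
      unfolding norm_mult mult.commute[of e] using e[OF t] by (intro mult_mono) auto
  qed
  also have "\<dots> = e * (integral tbox (\<lambda>t. 1) + integral tbox (\<lambda>t. (cmod (f (r *\<^sub>R tor t)))\<^sup>2))"
    by (subst integral_mult_right, subst integral_add) (auto simp: i)
  also have "\<dots> = e * (4 * pi\<^sup>2 * (1 + H2mean r f))"
    unfolding H2mean_eq by (simp add: content_Pair power2_eq_square field_simps)
  finally show ?thesis .
qed

text \<open>Two dilations are multiplied: \<open>r\<close> fixes the torus on which the mean is
  taken, and \<open>\<rho>\<close> keeps the evaluation point away from it, so that the Szego kernel
  is bounded.\<close>

lemma holo2_growth:
  assumes f: "holo2_on bidisc f" and r: "0 \<le> r" "r < 1" and rho: "0 \<le> \<rho>" "\<rho> < 1" and y: "y \<in> cbidisc"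
  shows "cmod (f ((r * \<rho>) *\<^sub>R y)) \<le> 1 / (1 - \<rho>)\<^sup>2 * (1 + H2mean r f)"
proof -
  have z: "\<rho> *\<^sub>R y \<in> bidisc" by (rule scaleR_in_bidisc[OF y rho])
  have "4 * pi\<^sup>2 * cmod (f ((r * \<rho>) *\<^sub>R y)) = cmod (4 * pi\<^sup>2 * f (r *\<^sub>R (\<rho> *\<^sub>R y)))"
    by (simp add: norm_mult norm_power)
  also have "\<dots> = cmod (integral tbox (\<lambda>\<theta>. f (r *\<^sub>R tor \<theta>) * szego (\<rho> *\<^sub>R y) (tor \<theta>)))"
    by (simp only: bidisc_Cauchy_formula[OF f r z])
  also have "\<dots> \<le> 1 / (1 - \<rho>)\<^sup>2 * (4 * pi\<^sup>2 * (1 + H2mean r f))"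
    by (intro holo2_dilate_kernel_bound f r continuous_on_szego szego_dilated_bound continuous_intros)
      (use z rho y in \<open>auto simp: tor_in_cbidisc\<close>)
  finally have "4 * pi\<^sup>2 * cmod (f ((r * \<rho>) *\<^sub>R y)) \<le> 4 * pi\<^sup>2 * (1 / (1 - \<rho>)\<^sup>2 * (1 + H2mean r f))"
    by (simp add: mult_ac)
  then show ?thesis by (rule mult_left_le_imp_le) simp
qed

text \<open>Arzela-Ascoli. Equicontinuity comes from the kernel and not from the functions:
  differences of values are integrals against differences of Szego kernels, which are uniformly
  small by compactness.\<close>

lemma H2_Montel_dilate:
  fixes F :: "nat \<Rightarrow> complex \<times> complex \<Rightarrow> complex"
  assumes F: "\<And>n. holo2_on bidisc (F n)" and N: "\<And>n. H2mean r (F n) \<le> N"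
    and r: "0 \<le> r" "r < 1" and rho: "0 \<le> \<rho>" "\<rho> < 1"
  obtains g k where "continuous_on cbidisc g" "strict_mono (k :: nat \<Rightarrow> nat)"
    "uniform_limit cbidisc (\<lambda>n y. F (k n) ((r * \<rho>) *\<^sub>R y)) g sequentially"
proof -
  have N0: "0 \<le> N" using N[of 0] H2mean_nonneg[of r "F 0"] by linarith
  obtain g k where "continuous_on cbidisc g" "strict_mono (k :: nat \<Rightarrow> nat)"
     and lim: "\<And>e. 0 < e \<Longrightarrow> \<exists>M. \<forall>n x. n \<ge> M \<and> x \<in> cbidisc \<longrightarrow> norm (F (k n) ((r * \<rho>) *\<^sub>R x) - g x) < e"
  proof (rule Arzela_Ascoli[of cbidisc "\<lambda>n y. F n ((r * \<rho>) *\<^sub>R y)" "1 / (1 - \<rho>)\<^sup>2 * (1 + N)"])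
    show "compact cbidisc" by (rule compact_cbidisc)
    fix n y assume y: "y \<in> cbidisc"
    have "cmod (F n ((r * \<rho>) *\<^sub>R y)) \<le> 1 / (1 - \<rho>)\<^sup>2 * (1 + H2mean r (F n))"
      by (rule holo2_growth[OF F r rho y])
    also have "\<dots> \<le> 1 / (1 - \<rho>)\<^sup>2 * (1 + N)" using N[of n] by (intro mult_left_mono) auto
    finally show "cmod (F n ((r * \<rho>) *\<^sub>R y)) \<le> 1 / (1 - \<rho>)\<^sup>2 * (1 + N)" .
  next
    fix x :: "complex \<times> complex" and e :: real assume x: "x \<in> cbidisc" and e: "0 < e"
    \<comment> \<open>The factor 2 makes the final inequality strict, and \<open>1 + N\<close>
      cancels the bound from \<open>holo2_dilate_kernel_bound\<close>.\<close>
    define e' where "e' = e / (2 * (1 + N))"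
    have e': "0 < e'" using e N0 by (simp add: e'_def)
    have cs: "continuous_on (cbidisc \<times> tbox) (\<lambda>p. szego (\<rho> *\<^sub>R fst p) (tor (snd p)))"
      by (intro continuous_on_szego continuous_intros) (simp_all add: mem_Times_iff scaleR_in_bidisc tor_in_cbidisc rho)
    have "compact (cbidisc \<times> tbox)" by (intro compact_Times compact_cbidisc compact_cbox)
    from compact_uniformly_continuous[OF cs this] e' obtain d where d: "0 < d"
      and dd: "\<And>p q. p \<in> cbidisc \<times> tbox \<Longrightarrow> q \<in> cbidisc \<times> tbox \<Longrightarrow> dist q p < d \<Longrightarrow>
        dist (szego (\<rho> *\<^sub>R fst q) (tor (snd q))) (szego (\<rho> *\<^sub>R fst p) (tor (snd p))) < e'"
      unfolding uniformly_continuous_on_def by meson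
    have "norm (F n ((r * \<rho>) *\<^sub>R x) - F n ((r * \<rho>) *\<^sub>R y)) < e" if y: "y \<in> cbidisc" and xy: "norm (x - y) < d" for n y
    proof -
      have zx: "\<rho> *\<^sub>R x \<in> bidisc" and zy: "\<rho> *\<^sub>R y \<in> bidisc" using scaleR_in_bidisc x y rho by auto
      note fc = continuous_on_tbox_tor_dilated[OF F r]
      have sc: "continuous_on tbox (\<lambda>t. szego (\<rho> *\<^sub>R x) (tor t))" "continuous_on tbox (\<lambda>t. szego (\<rho> *\<^sub>R y) (tor t))"
        by (intro continuous_on_szego continuous_intros; use zx zy in \<open>auto simp: tor_in_cbidisc\<close>)+
      have "4 * pi\<^sup>2 * norm (F n ((r * \<rho>) *\<^sub>R x) - F n ((r * \<rho>) *\<^sub>R y)) =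
         norm (4 * pi\<^sup>2 * F n (r *\<^sub>R (\<rho> *\<^sub>R x)) - 4 * pi\<^sup>2 * F n (r *\<^sub>R (\<rho> *\<^sub>R y)))"
        by (simp add: norm_mult norm_power flip: right_diff_distrib)
      also have "\<dots> = norm (integral tbox (\<lambda>t. F n (r *\<^sub>R tor t) * (szego (\<rho> *\<^sub>R x) (tor t) - szego (\<rho> *\<^sub>R y) (tor t))))"
        unfolding bidisc_Cauchy_formula[OF F r zx, symmetric] bidisc_Cauchy_formula[OF F r zy, symmetric]
        by (subst integral_diff[symmetric]) (auto intro!: integrable_continuous continuous_intros fc sc simp: right_diff_distrib)
      also have "\<dots> \<le> e' * (4 * pi\<^sup>2 * (1 + H2mean r (F n)))"
      proof (intro holo2_dilate_kernel_bound F r)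
        show "continuous_on tbox (\<lambda>t. szego (\<rho> *\<^sub>R x) (tor t) - szego (\<rho> *\<^sub>R y) (tor t))"
          by (intro continuous_intros sc)
        fix t assume "t \<in> tbox"
        then show "cmod (szego (\<rho> *\<^sub>R x) (tor t) - szego (\<rho> *\<^sub>R y) (tor t)) \<le> e'"
          using dd[of "(y, t)" "(x, t)"] x y xy by (simp add: dist_Pair_Pair dist_norm)
      qed
      also have "\<dots> \<le> e' * (4 * pi\<^sup>2 * (1 + N))" using N[of n] e' by (intro mult_left_mono) auto
      finally have "norm (F n ((r * \<rho>) *\<^sub>R x) - F n ((r * \<rho>) *\<^sub>R y)) \<le> e' * (1 + N)" by (simp add: mult.left_commute)
      also have "\<dots> < e" using e N0 by (simp add: e'_def field_simps add_pos_nonneg)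
      finally show ?thesis .
    qed
    then show "\<exists>d. 0 < d \<and> (\<forall>n y. y \<in> cbidisc \<and> norm (x - y) < d \<longrightarrow> cmod (F n ((r * \<rho>) *\<^sub>R x) - F n ((r * \<rho>) *\<^sub>R y)) < e)"
      using d by blast
  qed blast
  then show thesis
    by (intro that[of g k]) (simp_all only: uniform_limit_sequentially_iff dist_norm, meson)
qed

lemma H2_Montel:
  fixes F :: "nat \<Rightarrow> complex \<times> complex \<Rightarrow> complex"
  assumes F: "\<And>n. holo2_on bidisc (F n)" and N: "\<And>n r. 0 < r \<Longrightarrow> r < 1 \<Longrightarrow> H2mean r (F n) \<le> N"
  obtains g k where "strict_mono (k :: nat \<Rightarrow> nat)" "holo2_on bidisc g"
    "\<And>r. 0 < r \<Longrightarrow> r < 1 \<Longrightarrow> uniform_limit cbidisc (\<lambda>n y. F (k n) (r *\<^sub>R y)) (\<lambda>y. g (r *\<^sub>R y)) sequentially"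
proof -
  \<comment> \<open>Radii increasing to 1, with \<open>q 0 = 1 / 2\<close> so that all are positive.
    One factor of \<open>q i * q i\<close> is the radius of the torus, the other the dilation of the
    kernel.\<close>
  define q where "q = (\<lambda>i::nat. 1 - 1 / (real i + 2))"
  have q: "0 < q i" "q i < 1" for i unfolding q_def by (auto simp: field_simps)
  define P where "P = (\<lambda>i (s::nat \<Rightarrow> nat). \<exists>g. uniform_limit cbidisc (\<lambda>n y. F (s n) ((q i * q i) *\<^sub>R y)) g sequentially)"
  have "\<exists>k. strict_mono (k :: nat \<Rightarrow> nat) \<and> P i (s \<circ> k)" for i s
  proof -
    obtain g k where "strict_mono (k :: nat \<Rightarrow> nat)"
      "uniform_limit cbidisc (\<lambda>n y. F (s (k n)) ((q i * q i) *\<^sub>R y)) g sequentially"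
      by (rule H2_Montel_dilate[of "\<lambda>n. F (s n)" "q i" N "q i"]) (auto simp: F N q less_imp_le)
    then show ?thesis unfolding P_def by auto
  qed
  \<comment> \<open>Stability required by the diagonal argument: uniform convergence survives
    passage to a sequence whose tail takes its entries from ever later entries of the given
    one.\<close>
  moreover have "P i (s \<circ> k2)" if "P i (s \<circ> k1)" and k: "\<And>j. M \<le> j \<Longrightarrow> \<exists>j'. j \<le> j' \<and> k2 j = k1 j'"
    for i s and k1 k2 :: "nat \<Rightarrow> nat" and M
  proof -
    from that(1)[unfolded P_def] obtain g
      where g: "uniform_limit cbidisc (\<lambda>n y. F ((s \<circ> k1) n) ((q i * q i) *\<^sub>R y)) g sequentially" ..
    have "uniform_limit cbidisc (\<lambda>n y. F ((s \<circ> k2) n) ((q i * q i) *\<^sub>R y)) g sequentially"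
      unfolding uniform_limit_sequentially_iff
    proof (intro allI impI)
      fix e :: real assume "e > 0"
      then obtain L where L: "\<And>n x. n \<ge> L \<Longrightarrow> x \<in> cbidisc \<Longrightarrow> dist (F ((s \<circ> k1) n) ((q i * q i) *\<^sub>R x)) (g x) < e"
        using g unfolding uniform_limit_sequentially_iff by blast
      have "dist (F ((s \<circ> k2) n) ((q i * q i) *\<^sub>R x)) (g x) < e" if n: "n \<ge> max L M" and x: "x \<in> cbidisc" for n x
      proof -
        obtain j' where "n \<le> j'" "k2 n = k1 j'" using k[of n] n by auto
        then show ?thesis using L[of j' x] n x by auto
      qed
      then show "\<exists>L. \<forall>n\<ge>L. \<forall>x\<in>cbidisc. dist (F ((s \<circ> k2) n) ((q i * q i) *\<^sub>R x)) (g x) < e" by blast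
    qed
    then show ?thesis unfolding P_def by blast
  qed
  ultimately obtain k where k: "strict_mono (k :: nat \<Rightarrow> nat)" and Pk: "\<And>i. P i (id \<circ> k)"
    by (rule subsequence_diagonalization_lemma[of P id]) blast+
  obtain G where G: "\<And>i. uniform_limit cbidisc (\<lambda>n y. F (k n) ((q i * q i) *\<^sub>R y)) (G i) sequentially"
    using Pk unfolding P_def by (simp add: o_def) metis
  define g where "g = (\<lambda>z. lim (\<lambda>n. F (k n) z))"
  have gG: "g ((q i * q i) *\<^sub>R y) = G i y" if "y \<in> cbidisc" for i y
    unfolding g_def using tendsto_uniform_limitI[OF G that] by (rule limI)
  have U: "uniform_limit cbidisc (\<lambda>n y. F (k n) (r *\<^sub>R y)) (\<lambda>y. g (r *\<^sub>R y)) sequentially" if r: "0 < r" "r < 1" for r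
  proof -
    have "(\<lambda>i. q i * q i) \<longlonglongrightarrow> 1"
      unfolding q_def by real_asymp
    then have "eventually (\<lambda>i. r < q i * q i) sequentially" using r by (intro order_tendstoD) auto
    then obtain i where i: "r < q i * q i" by (meson eventually_sequentially order_refl)
    \<comment> \<open>Convergence at radius \<open>r\<close> is read off at the larger radius
      \<open>q i * q i\<close>, at the contracted points \<open>c *\<^sub>R y\<close>.\<close>
    define c where "c = r / (q i * q i)"
    have c: "0 \<le> c" "c \<le> 1" "r = (q i * q i) * c" using i r q[of i] by (auto simp: c_def field_simps)
    show ?thesis unfolding uniform_limit_sequentially_iff
    proof (intro allI impI)
      fix e :: real assume "e > 0"
      then obtain L where L: "\<And>n x. n \<ge> L \<Longrightarrow> x \<in> cbidisc \<Longrightarrow> dist (F (k n) ((q i * q i) *\<^sub>R x)) (G i x) < e"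
        using G[of i] unfolding uniform_limit_sequentially_iff by blast
      have "dist (F (k n) (r *\<^sub>R x)) (g (r *\<^sub>R x)) < e" if "n \<ge> L" "x \<in> cbidisc" for n x
      proof -
        have cx: "c *\<^sub>R x \<in> cbidisc" using c that by (intro scaleR_in_cbidisc) auto
        have rx: "r *\<^sub>R x = (q i * q i) *\<^sub>R (c *\<^sub>R x)" using c by simp
        show ?thesis unfolding rx gG[OF cx] using L[OF that(1) cx] .
      qed
      then show "\<exists>L. \<forall>n\<ge>L. \<forall>x\<in>cbidisc. dist (F (k n) (r *\<^sub>R x)) (g (r *\<^sub>R x)) < e" by blast
    qed
  qed
  have "holo2_on bidisc g"
  proof (rule holo2_on_of_dilates)
    fix r :: real assume r: "0 < r" "r < 1"
    note fc = continuous_on_tbox_tor_dilated[OF F less_imp_le[OF r(1)] r(2)]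
    have Ut: "uniform_limit tbox (\<lambda>n t. F (k n) (r *\<^sub>R tor t)) (\<lambda>t. g (r *\<^sub>R tor t)) sequentially"
      using U[OF r] unfolding uniform_limit_sequentially_iff by (meson tor_in_cbidisc)
    have gc: "continuous_on tbox (\<lambda>t. g (r *\<^sub>R tor t))"
      by (rule uniform_limit_theorem[OF _ Ut]) (auto intro!: always_eventually fc)
    \<comment> \<open>Cauchy's formula passes to the uniform limit and exhibits the dilate of
      \<open>g\<close> as a Szego integral of a continuous function, hence as a holomorphic
      function.\<close>
    have eq: "g (r *\<^sub>R z) = integral tbox (\<lambda>t. (1 / (4 * pi\<^sup>2) * g (r *\<^sub>R tor t)) * szego z (tor t))" if z: "z \<in> bidisc" for z
    proof -
      have sc: "continuous_on tbox (\<lambda>t. szego z (tor t))"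
        by (intro continuous_on_szego continuous_intros) (auto simp: tor_in_cbidisc z)
      have "uniform_limit tbox (\<lambda>n t. F (k n) (r *\<^sub>R tor t) * szego z (tor t)) (\<lambda>t. g (r *\<^sub>R tor t) * szego z (tor t)) sequentially"
        by (intro uniform_lim_mult Ut uniform_limit_const compact_imp_bounded compact_continuous_image gc sc compact_cbox)
      then obtain I J where I: "\<And>n. ((\<lambda>t. F (k n) (r *\<^sub>R tor t) * szego z (tor t)) has_integral I n) tbox"
        and J: "((\<lambda>t. g (r *\<^sub>R tor t) * szego z (tor t)) has_integral J) tbox" and IJ: "I \<longlonglongrightarrow> J"
        by (rule uniform_limit_integral_cbox) (auto intro!: continuous_intros fc sc)
      have "I n = 4 * pi\<^sup>2 * F (k n) (r *\<^sub>R z)" for n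
        using integral_unique[OF I[of n]] bidisc_Cauchy_formula[OF F _ r(2) z] r by simp
      moreover have "(\<lambda>n. F (k n) (r *\<^sub>R z)) \<longlonglongrightarrow> g (r *\<^sub>R z)"
        using tendsto_uniform_limitI[OF U[OF r]] z bidisc_subset_cbidisc by blast
      ultimately have "I \<longlonglongrightarrow> 4 * pi\<^sup>2 * g (r *\<^sub>R z)" 
        using tendsto_mult_left[of "\<lambda>n. F (k n) (r *\<^sub>R z)" "g (r *\<^sub>R z)" sequentially "4 * pi\<^sup>2"] by presburger
      with IJ have "4 * pi\<^sup>2 * g (r *\<^sub>R z) = J" by (rule LIMSEQ_unique[symmetric])
      also have "J = integral tbox (\<lambda>t. g (r *\<^sub>R tor t) * szego z (tor t))" using J by (simp add: integral_unique)
      finally have "4 * pi\<^sup>2 * g (r *\<^sub>R z) = integral tbox (\<lambda>t. g (r *\<^sub>R tor t) * szego z (tor t))" .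
      then have "g (r *\<^sub>R z) = 1 / (4 * pi\<^sup>2) * integral tbox (\<lambda>t. g (r *\<^sub>R tor t) * szego z (tor t))"
        by (simp add: field_simps)
      also have "\<dots> = integral tbox (\<lambda>t. 1 / (4 * pi\<^sup>2) * (g (r *\<^sub>R tor t) * szego z (tor t)))"
        by (rule integral_mult_right[symmetric])
      finally show ?thesis by (simp only: mult.assoc)
    qed
    have h: "holo2_on bidisc (\<lambda>z. integral tbox (\<lambda>t. (1 / (4 * pi\<^sup>2) * g (r *\<^sub>R tor t)) * szego z (tor t)))"
      by (intro holo2_on_szego_integral continuous_intros gc)
    show "holo2_on bidisc (\<lambda>z. g (r *\<^sub>R z))"
      unfolding holo2_on_def
    proof
      fix z assume z: "z \<in> bidisc"
      obtain a b where "((\<lambda>z. integral tbox (\<lambda>t. (1 / (4 * pi\<^sup>2) * g (r *\<^sub>R tor t)) * szego z (tor t))) has_derivative (\<lambda>h. a * fst h + b * snd h)) (at z)"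
        using h z unfolding holo2_on_def by blast
      then have "((\<lambda>z. g (r *\<^sub>R z)) has_derivative (\<lambda>h. a * fst h + b * snd h)) (at z)"
        by (rule has_derivative_transform_within_open[OF _ open_bidisc z]) (simp only: eq)
      then show "\<exists>a b. ((\<lambda>z. g (r *\<^sub>R z)) has_derivative (\<lambda>h. a * fst h + b * snd h)) (at z)" by blast
    qed
  qed
  with k U that show thesis by blast
qed

section \<open>Elementary properties of the H2 norm\<close>

lemma H2I:
  assumes "holo2_on bidisc f" "\<And>r. 0 < r \<Longrightarrow> r < 1 \<Longrightarrow> H2mean r f \<le> C"
  shows "f \<in> H2" "H2norm f \<le> sqrt C"
proof -
  show "f \<in> H2" unfolding H2_def using assms by (auto intro!: bdd_aboveI2)
  have "(SUP r\<in>{0<..<1}. H2mean r f) \<le> C" using assms by (intro cSUP_least) auto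
  then show "H2norm f \<le> sqrt C" unfolding H2norm_def by simp
qed

lemma H2mean_le_norm:
  assumes "f \<in> H2" "0 < r" "r < 1"
  shows "H2mean r f \<le> (H2norm f)\<^sup>2"
proof -
  have "H2mean r f \<le> (SUP r\<in>{0<..<1}. H2mean r f)"
    using assms by (intro cSUP_upper) (auto simp: H2_def)
  moreover have "0 \<le> (SUP r\<in>{0<..<1}. H2mean r f)"
    using calculation H2mean_nonneg[of r f] by linarith
  ultimately show ?thesis unfolding H2norm_def by simp
qed

lemma H2norm_nonneg: "f \<in> H2 \<Longrightarrow> 0 \<le> H2norm f"
proof -
  assume "f \<in> H2"
  have "H2mean (1/2) f \<le> (SUP r\<in>{0<..<1}. H2mean r f)"
    using \<open>f \<in> H2\<close> by (intro cSUP_upper) (auto simp: H2_def)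
  then show ?thesis unfolding H2norm_def using H2mean_nonneg[of "1/2" f] by simp
qed

lemma holo2_on_diff: "holo2_on S f \<Longrightarrow> holo2_on S g \<Longrightarrow> holo2_on S (\<lambda>z. f z - g z)"
  unfolding holo2_on_def
proof
  fix z assume "\<forall>z\<in>S. \<exists>a b. (f has_derivative (\<lambda>h. a * fst h + b * snd h)) (at z)"
    "\<forall>z\<in>S. \<exists>a b. (g has_derivative (\<lambda>h. a * fst h + b * snd h)) (at z)" "z \<in> S"
  then obtain a b a' b' where "(f has_derivative (\<lambda>h. a * fst h + b * snd h)) (at z)"
    "(g has_derivative (\<lambda>h. a' * fst h + b' * snd h)) (at z)" by meson
  from has_derivative_diff[OF this]
  have "((\<lambda>z. f z - g z) has_derivative (\<lambda>h. (a - a') * fst h + (b - b') * snd h)) (at z)"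
    by (simp add: algebra_simps)
  then show "\<exists>a b. ((\<lambda>z. f z - g z) has_derivative (\<lambda>h. a * fst h + b * snd h)) (at z)" by blast
qed

text \<open>The crude factor 2 takes the place of Minkowski's inequality; it is enough to transfer
  boundedness and convergence to zero.\<close>

lemma H2mean_diff_le:
  assumes f: "holo2_on bidisc f" and g: "holo2_on bidisc g" and r: "0 \<le> r" "r < 1"
  shows "H2mean r (\<lambda>z. f z - g z) \<le> 2 * H2mean r f + 2 * H2mean r g"
proof -
  note fc = continuous_on_tbox_tor_dilated[OF f r] and gc = continuous_on_tbox_tor_dilated[OF g r]
  have "integral tbox (\<lambda>t. (cmod (f (r *\<^sub>R tor t) - g (r *\<^sub>R tor t)))\<^sup>2)
     \<le> integral tbox (\<lambda>t. 2 * (cmod (f (r *\<^sub>R tor t)))\<^sup>2 + 2 * (cmod (g (r *\<^sub>R tor t)))\<^sup>2)"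
  proof (intro integral_le integrable_continuous continuous_intros fc gc)
    fix t
    have "(cmod (f (r *\<^sub>R tor t) - g (r *\<^sub>R tor t)))\<^sup>2 \<le> (cmod (f (r *\<^sub>R tor t)) + cmod (g (r *\<^sub>R tor t)))\<^sup>2"
      by (intro power_mono norm_triangle_ineq4) auto
    also have "\<dots> \<le> 2 * (cmod (f (r *\<^sub>R tor t)))\<^sup>2 + 2 * (cmod (g (r *\<^sub>R tor t)))\<^sup>2"
      using sum_squares_bound[of "cmod (f (r *\<^sub>R tor t))" "cmod (g (r *\<^sub>R tor t))"] by (simp add: power2_sum)
    finally show "(cmod (f (r *\<^sub>R tor t) - g (r *\<^sub>R tor t)))\<^sup>2 \<le> 2 * (cmod (f (r *\<^sub>R tor t)))\<^sup>2 + 2 * (cmod (g (r *\<^sub>R tor t)))\<^sup>2" .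
  qed
  also have "\<dots> = 2 * integral tbox (\<lambda>t. (cmod (f (r *\<^sub>R tor t)))\<^sup>2) + 2 * integral tbox (\<lambda>t. (cmod (g (r *\<^sub>R tor t)))\<^sup>2)"
    by (subst integral_add) (auto intro!: integrable_continuous continuous_intros fc gc)
  finally have "integral tbox (\<lambda>t. (cmod (f (r *\<^sub>R tor t) - g (r *\<^sub>R tor t)))\<^sup>2) / (4 * pi\<^sup>2)
     \<le> (2 * integral tbox (\<lambda>t. (cmod (f (r *\<^sub>R tor t)))\<^sup>2) + 2 * integral tbox (\<lambda>t. (cmod (g (r *\<^sub>R tor t)))\<^sup>2)) / (4 * pi\<^sup>2)"
    by (intro divide_right_mono) auto
  then show ?thesis unfolding H2mean_eq by (simp add: add_divide_distrib)
qed

lemma H2_diff: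
  assumes "f \<in> H2" "g \<in> H2"
  shows "(\<lambda>z. f z - g z) \<in> H2"
proof (rule H2I(1))
  show "holo2_on bidisc (\<lambda>z. f z - g z)" using assms by (intro holo2_on_diff) (auto simp: H2_def)
  fix r :: real assume r: "0 < r" "r < 1"
  have "H2mean r (\<lambda>z. f z - g z) \<le> 2 * H2mean r f + 2 * H2mean r g"
    using assms r by (intro H2mean_diff_le) (auto simp: H2_def)
  then show "H2mean r (\<lambda>z. f z - g z) \<le> 2 * (H2norm f)\<^sup>2 + 2 * (H2norm g)\<^sup>2"
    using H2mean_le_norm[OF assms(1) r] H2mean_le_norm[OF assms(2) r] by linarith
qed


subsection \<open>Functions of class \<open>C\<^sup>k\<close>\<close>

lemma Ck_open_SucD:
  assumes "Ck_open (Suc n) U f"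
  shows "x \<in> U \<Longrightarrow> (f has_derivative frechet_derivative f (at x)) (at x)"
    and "Ck_open n U (\<lambda>x. frechet_derivative f (at x) v)"
  using assms by (auto simp: frechet_derivative_works)

text \<open>Because \<open>U\<close> is open, the values on \<open>U\<close> determine the
  derivatives at its points, and the induction repeats this for every order.\<close>

lemma Ck_open_cong:
  assumes "open U" "\<And>x. x \<in> U \<Longrightarrow> f x = g x" "Ck_open n U f"
  shows "Ck_open n U g"
  using assms(2,3)
proof (induction n arbitrary: f g)
  case 0
  then show ?case using continuous_on_cong by (metis Ck_open.simps(1))
next
  case (Suc n)
  have d: "(g has_derivative frechet_derivative f (at x)) (at x)" if "x \<in> U" for x
    using has_derivative_transform_within_open[OF Ck_open_SucD(1)[OF Suc.prems(2) that] assms(1) that] Suc.prems(1) by blast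
  have e: "frechet_derivative g (at x) = frechet_derivative f (at x)" if "x \<in> U" for x
    using frechet_derivative_at[OF d[OF that]] by simp
  have "Ck_open n U (\<lambda>x. frechet_derivative g (at x) v)" for v
    by (rule Suc.IH[OF _ Ck_open_SucD(2)[OF Suc.prems(2), of v]]) (simp add: e)
  then show ?case using d by (auto simp: differentiable_def)
qed

lemma Ck_open_SucI:
  assumes "open U" "\<And>x. x \<in> U \<Longrightarrow> (f has_derivative f' x) (at x)" "\<And>v. Ck_open n U (\<lambda>x. f' x v)"
  shows "Ck_open (Suc n) U f"
proof -
  have "frechet_derivative f (at x) = f' x" if "x \<in> U" for x
    using frechet_derivative_at[OF assms(2)[OF that]] by simp
  then have "Ck_open n U (\<lambda>x. frechet_derivative f (at x) v)" for v
    by (intro Ck_open_cong[OF assms(1) _ assms(3)[of v]]) simp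
  then show ?thesis using assms(2) by (auto simp: differentiable_def)
qed

lemma Ck_open_SucD': "Ck_open (Suc n) U f \<Longrightarrow> Ck_open n U f"
proof (induction n arbitrary: f)
  case 0
  then show ?case by (auto intro!: continuous_at_imp_continuous_on differentiable_imp_continuous_within)
next
  case (Suc n)
  have "Ck_open n U (\<lambda>x. frechet_derivative f (at x) v)" for v
    using Suc.IH[OF Ck_open_SucD(2)[OF Suc.prems]] .
  then show ?case using Suc.prems by simp
qed

lemma Ck_open_imp_continuous_on: "Ck_open n U f \<Longrightarrow> continuous_on U f"
  by (induction n) (use Ck_open_SucD' in auto)

lemma Ck_open_le: "m \<le> n \<Longrightarrow> Ck_open n U f \<Longrightarrow> Ck_open m U f"
  by (induction n rule: nat_induct_at_least[of m]) (use Ck_open_SucD' in auto)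

lemma Ck_open_const: "open U \<Longrightarrow> Ck_open n U (\<lambda>x. c)"
  by (induction n arbitrary: c) (auto simp: frechet_derivative_const)

lemma Ck_open_add:
  assumes "open U" shows "Ck_open n U f \<Longrightarrow> Ck_open n U g \<Longrightarrow> Ck_open n U (\<lambda>x. f x + g x)"
proof (induction n arbitrary: f g)
  case (Suc n)
  show ?case
    by (rule Ck_open_SucI[OF assms has_derivative_add[OF Ck_open_SucD(1)[OF Suc.prems(1)] Ck_open_SucD(1)[OF Suc.prems(2)]]
      Suc.IH[OF Ck_open_SucD(2)[OF Suc.prems(1)] Ck_open_SucD(2)[OF Suc.prems(2)]]])
qed (auto intro: continuous_intros)

lemma Ck_open_bounded_linear:
  assumes "open U" "bounded_linear L" shows "Ck_open n U f \<Longrightarrow> Ck_open n U (\<lambda>x. L (f x))"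
proof (induction n arbitrary: f)
  case 0 then show ?case using bounded_linear.continuous_on[OF assms(2)] by simp
next
  case (Suc n)
  show ?case
    by (rule Ck_open_SucI[OF assms(1) bounded_linear.has_derivative[OF assms(2) Ck_open_SucD(1)[OF Suc.prems]]
      Suc.IH[OF Ck_open_SucD(2)[OF Suc.prems]]])
qed

lemma Ck_open_scaleR:
  assumes "open U" shows "Ck_open n U a \<Longrightarrow> Ck_open n U g \<Longrightarrow> Ck_open n U (\<lambda>x. a x *\<^sub>R g x)"
proof (induction n arbitrary: a g)
  case (Suc n)
  show ?case
    by (rule Ck_open_SucI[OF assms has_derivative_scaleR[OF Ck_open_SucD(1)[OF Suc.prems(1)] Ck_open_SucD(1)[OF Suc.prems(2)]]])
      (assumption+, intro Ck_open_add[OF assms] Suc.IH Ck_open_SucD(2)[OF Suc.prems(1)] Ck_open_SucD(2)[OF Suc.prems(2)]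
        Ck_open_SucD'[OF Suc.prems(1)] Ck_open_SucD'[OF Suc.prems(2)])
qed (auto intro: continuous_intros)

text \<open>Both claims are proved together because the derivative of each function is a multiple of
  the other.\<close>

lemma Ck_open_cos_sin:
  fixes l :: "'a::real_normed_vector \<Rightarrow> real"
  assumes "bounded_linear l"
  shows "Ck_open n UNIV (\<lambda>x. cos (l x)) \<and> Ck_open n UNIV (\<lambda>x. sin (l x))"
proof (induction n)
  case 0 show ?case using bounded_linear.continuous_on[OF assms continuous_on_id] by (auto intro!: continuous_intros)
next
  case (Suc n)
  have l: "(l has_derivative l) (at x)" for x using bounded_linear.has_derivative[OF assms has_derivative_ident] by simp
  have neg: "Ck_open n UNIV (\<lambda>x. (- l v) *\<^sub>R sin (l x))" "Ck_open n UNIV (\<lambda>x. l v *\<^sub>R cos (l x))" for v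
    using Suc Ck_open_scaleR[OF open_UNIV Ck_open_const[OF open_UNIV]] by blast+
  have "Ck_open (Suc n) UNIV (\<lambda>x. cos (l x))"
    by (rule Ck_open_SucI[where f' = "\<lambda>x v. (- l v) *\<^sub>R sin (l x)", OF open_UNIV _ neg(1)])
      (auto intro!: derivative_eq_intros l)
  moreover have "Ck_open (Suc n) UNIV (\<lambda>x. sin (l x))"
    by (rule Ck_open_SucI[where f' = "\<lambda>x v. l v *\<^sub>R cos (l x)", OF open_UNIV _ neg(2)])
      (auto intro!: derivative_eq_intros l)
  ultimately show ?case by blast
qed

lemma tor_has_derivative:
  "(tor has_derivative (\<lambda>h. (fst h *\<^sub>R (\<i> * cis (fst \<theta>)), snd h *\<^sub>R (\<i> * cis (snd \<theta>))))) (at \<theta>)"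
  unfolding tor_def[abs_def] by (auto intro!: derivative_eq_intros)

text \<open>The derivative of \<open>p (tor \<theta>)\<close> in a fixed direction is a combination
  of directional derivatives of \<open>p\<close> along \<open>tor\<close>, with trigonometric
  coefficients. These derivatives have the same shape with \<open>p\<close> replaced, so the
  induction closes when \<open>p\<close> is arbitrary.\<close>

lemma Ck_open_comp_tor:
  assumes U: "\<And>\<theta>. tor \<theta> \<in> U"
  shows "Ck_open n U p \<Longrightarrow> Ck_open n UNIV (\<lambda>\<theta>. p (tor \<theta>))"
proof (induction n arbitrary: p)
  case 0
  then show ?case using U by (auto intro!: continuous_on_compose2[of U p] continuous_intros)
next
  case (Suc n)
  let ?D = "\<lambda>e \<theta>. frechet_derivative p (at (tor \<theta>)) e"
  let ?f' = "\<lambda>\<theta> h. frechet_derivative p (at (tor \<theta>)) (fst h *\<^sub>R (\<i> * cis (fst \<theta>)), snd h *\<^sub>R (\<i> * cis (snd \<theta>)))"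
  have d: "((\<lambda>\<theta>. p (tor \<theta>)) has_derivative ?f' \<theta>) (at \<theta>)" for \<theta>
    using diff_chain_at[OF tor_has_derivative Ck_open_SucD(1)[OF Suc.prems U], of \<theta>] by (simp add: o_def)
  \<comment> \<open>The velocity \<open>\<i> * cis x\<close> is
    \<open>- sin x + \<i> * cos x\<close>, expanded in the four real basis directions so that only
    derivatives in fixed directions remain.\<close>
  have eq: "?f' \<theta> v = (fst v * - sin (fst \<theta>)) *\<^sub>R ?D (1,0) \<theta> + (fst v * cos (fst \<theta>)) *\<^sub>R ?D (\<i>,0) \<theta>
      + (snd v * - sin (snd \<theta>)) *\<^sub>R ?D (0,1) \<theta> + (snd v * cos (snd \<theta>)) *\<^sub>R ?D (0,\<i>) \<theta>" for \<theta> v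
  proof -
    have "linear (frechet_derivative p (at (tor \<theta>)))"
      using Ck_open_SucD(1)[OF Suc.prems U] has_derivative_linear by blast
    moreover have "(fst v *\<^sub>R (\<i> * cis (fst \<theta>)), snd v *\<^sub>R (\<i> * cis (snd \<theta>))) =
        (fst v * - sin (fst \<theta>)) *\<^sub>R (1, 0) + (fst v * cos (fst \<theta>)) *\<^sub>R (\<i>, 0)
      + (snd v * - sin (snd \<theta>)) *\<^sub>R (0, 1) + (snd v * cos (snd \<theta>)) *\<^sub>R (0, \<i>)"
      by (auto simp: complex_eq_iff)
    ultimately show ?thesis by (simp only: linear_add linear_scale)
  qed
  have I: "Ck_open n UNIV (\<lambda>\<theta>. ?D e \<theta>)" for e
    by (rule Suc.IH[OF Ck_open_SucD(2)[OF Suc.prems]])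
  have sc: "Ck_open n UNIV (\<lambda>\<theta>::real\<times>real. c * - sin (fst \<theta>))" "Ck_open n UNIV (\<lambda>\<theta>::real\<times>real. c * cos (fst \<theta>))"
     "Ck_open n UNIV (\<lambda>\<theta>::real\<times>real. c * - sin (snd \<theta>))" "Ck_open n UNIV (\<lambda>\<theta>::real\<times>real. c * cos (snd \<theta>))" for c
    using Ck_open_cos_sin[OF bounded_linear_fst] Ck_open_cos_sin[OF bounded_linear_snd]
      Ck_open_bounded_linear[OF open_UNIV bounded_linear_mult_right, of n _ "- c"]
      Ck_open_bounded_linear[OF open_UNIV bounded_linear_mult_right, of n _ "c"]
    by auto
  show ?case
    by (rule Ck_open_SucI[OF open_UNIV d]) (unfold eq, intro Ck_open_add Ck_open_scaleR sc I open_UNIV)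
qed

lemma Ck_open_2_partials:
  fixes \<psi> :: "real \<times> real \<Rightarrow> complex"
  assumes "Ck_open 2 UNIV \<psi>"
  obtains D1 D2 D11 D12 D21 D22 where
    "\<And>x. (\<psi> has_derivative (\<lambda>h. fst h *\<^sub>R D1 x + snd h *\<^sub>R D2 x)) (at x)"
    "\<And>x. (D1 has_derivative (\<lambda>h. fst h *\<^sub>R D11 x + snd h *\<^sub>R D12 x)) (at x)"
    "\<And>x. (D2 has_derivative (\<lambda>h. fst h *\<^sub>R D21 x + snd h *\<^sub>R D22 x)) (at x)"
    "continuous_on UNIV D1" "continuous_on UNIV D2"
    "continuous_on UNIV D11" "continuous_on UNIV D12" "continuous_on UNIV D21" "continuous_on UNIV D22"
proof -
  have e: "frechet_derivative f (at x) = (\<lambda>h. fst h *\<^sub>R frechet_derivative f (at x) (1,0) + snd h *\<^sub>R frechet_derivative f (at x) (0,1))"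
    if "(f has_derivative frechet_derivative f (at x)) (at x)" for f :: "real \<times> real \<Rightarrow> complex" and x
  proof
    fix h :: "real \<times> real"
    have l: "linear (frechet_derivative f (at x))" using that has_derivative_linear by blast
    have "h = fst h *\<^sub>R (1,0) + snd h *\<^sub>R (0,1)" by (cases h) auto
    then have "frechet_derivative f (at x) h = frechet_derivative f (at x) (fst h *\<^sub>R (1,0) + snd h *\<^sub>R (0,1))" by simp
    also have "\<dots> = fst h *\<^sub>R frechet_derivative f (at x) (1,0) + snd h *\<^sub>R frechet_derivative f (at x) (0,1)"
      using l by (simp only: linear_add linear_scale)
    finally show "frechet_derivative f (at x) h = \<dots>" .
  qed
  let ?D = "\<lambda>v x. frechet_derivative \<psi> (at x) v"
  have C: "Ck_open (Suc (Suc 0)) UNIV \<psi>" using assms by (simp only: numeral_2_eq_2)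
  note C1 = Ck_open_SucD(2)[OF C]
  have d: "(\<psi> has_derivative frechet_derivative \<psi> (at x)) (at x)" for x using Ck_open_SucD(1)[OF C] by blast
  have d1: "(?D v has_derivative frechet_derivative (?D v) (at x)) (at x)" for x v using Ck_open_SucD(1)[OF C1] by blast
  have c: "continuous_on UNIV (?D v)" for v using Ck_open_imp_continuous_on[OF C1] .
  have c2: "continuous_on UNIV (\<lambda>x. frechet_derivative (?D v) (at x) w)" for v w
    using Ck_open_imp_continuous_on[OF Ck_open_SucD(2)[OF C1]] .
  show thesis
    by (rule that[of "?D (1,0)" "?D (0,1)" "\<lambda>x. frechet_derivative (?D (1,0)) (at x) (1,0)"
        "\<lambda>x. frechet_derivative (?D (1,0)) (at x) (0,1)" "\<lambda>x. frechet_derivative (?D (0,1)) (at x) (1,0)"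
        "\<lambda>x. frechet_derivative (?D (0,1)) (at x) (0,1)"])
      (use d d1 e[OF d] e[OF d1] c c2 in simp_all)
qed


subsection \<open>Level sets near a contact point of order two\<close>

text \<open>Symmetrise: the function \<open>W s + W (- s) - B * s\<^sup>2\<close> has derivative
  \<open>E'\<close>, which vanishes at 0 and decreases because \<open>W''\<close> is at most
  \<open>B\<close> on both sides. Monotonicity is thus used twice, without any continuity of
  \<open>W''\<close>.\<close>

lemma second_difference_le:
  fixes W W' W'' :: "real \<Rightarrow> real"
  assumes t: "0 \<le> t"
    and d1: "\<And>s. \<bar>s\<bar> \<le> t \<Longrightarrow> (W has_real_derivative W' s) (at s)"
    and d2: "\<And>s. \<bar>s\<bar> \<le> t \<Longrightarrow> (W' has_real_derivative W'' s) (at s)"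
    and B: "\<And>s. \<bar>s\<bar> \<le> t \<Longrightarrow> W'' s \<le> B"
  shows "W t + W (- t) - 2 * W 0 \<le> B * t\<^sup>2"
proof -
  define E' where "E' = (\<lambda>s. W' s - W' (- s) - 2 * B * s)"
  have E': "E' s \<le> 0" if s: "0 \<le> s" "s \<le> t" for s
  proof -
    have "E' s \<le> E' 0"
    proof (rule DERIV_nonpos_imp_nonincreasing[OF s(1)])
      fix x assume x: "0 \<le> x" "x \<le> s"
      have "((\<lambda>s. W' (- s)) has_real_derivative W'' (- x) * (- 1)) (at x)"
        using x s by (intro DERIV_chain2[OF d2]) (auto intro!: derivative_eq_intros)
      then have "(E' has_real_derivative (W'' x - W'' (- x) * (- 1) - 2 * B)) (at x)"
        unfolding E'_def using x s by (auto intro!: derivative_eq_intros d2)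
      moreover have "W'' x - W'' (- x) * (- 1) - 2 * B \<le> 0" using B[of x] B[of "- x"] x s by auto
      ultimately show "\<exists>y. (E' has_real_derivative y) (at x) \<and> y \<le> 0" by blast
    qed
    then show ?thesis by (simp add: E'_def)
  qed
  have "W t + W (- t) - B * t\<^sup>2 \<le> W 0 + W (- 0) - B * 0\<^sup>2"
  proof (rule DERIV_nonpos_imp_nonincreasing[OF t])
    fix x assume x: "0 \<le> x" "x \<le> t"
    have "((\<lambda>s. W (- s)) has_real_derivative W' (- x) * (- 1)) (at x)"
      using x by (intro DERIV_chain2[OF d1]) (auto intro!: derivative_eq_intros)
    then have "((\<lambda>s. W s + W (- s) - B * s\<^sup>2) has_real_derivative E' x) (at x)"
      unfolding E'_def using x by (auto intro!: derivative_eq_intros d1)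
    then show "\<exists>y. ((\<lambda>s. W s + W (- s) - B * s\<^sup>2) has_real_derivative y) (at x) \<and> y \<le> 0" using E' x by blast
  qed
  then show ?thesis by simp
qed

lemma abs_fst_le_norm: "\<bar>fst (x :: real \<times> real)\<bar> \<le> norm x" and abs_snd_le_norm: "\<bar>snd (x :: real \<times> real)\<bar> \<le> norm x"
  by (metis norm_fst_le prod.collapse real_norm_def) (metis norm_snd_le prod.collapse real_norm_def)

lemma quadratic_form_bound:
  assumes "cmod A \<le> e" "cmod B \<le> e" "cmod C \<le> e" "cmod D \<le> e"
  shows "cmod (fst h *\<^sub>R (fst h *\<^sub>R A + snd h *\<^sub>R B) + snd h *\<^sub>R (fst h *\<^sub>R C + snd h *\<^sub>R D)) \<le> 4 * e * (norm (h :: real \<times> real))\<^sup>2"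
proof -
  have e: "0 \<le> e" using assms(1) norm_ge_zero[of A] by linarith
  note f = abs_fst_le_norm[of h] and s = abs_snd_le_norm[of h]
  have "cmod (fst h *\<^sub>R A + snd h *\<^sub>R B) \<le> \<bar>fst h\<bar> * cmod A + \<bar>snd h\<bar> * cmod B"
    by (rule norm_triangle_le) simp
  also have "\<dots> \<le> norm h * e + norm h * e" using f s assms e by (intro add_mono mult_mono) auto
  finally have 1: "cmod (fst h *\<^sub>R A + snd h *\<^sub>R B) \<le> 2 * norm h * e" by (simp add: mult_ac)
  have "cmod (fst h *\<^sub>R C + snd h *\<^sub>R D) \<le> \<bar>fst h\<bar> * cmod C + \<bar>snd h\<bar> * cmod D"
    by (rule norm_triangle_le) simp
  also have "\<dots> \<le> norm h * e + norm h * e" using f s assms e by (intro add_mono mult_mono) auto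
  finally have 2: "cmod (fst h *\<^sub>R C + snd h *\<^sub>R D) \<le> 2 * norm h * e" by (simp add: mult_ac)
  have "cmod (fst h *\<^sub>R (fst h *\<^sub>R A + snd h *\<^sub>R B) + snd h *\<^sub>R (fst h *\<^sub>R C + snd h *\<^sub>R D))
    \<le> \<bar>fst h\<bar> * cmod (fst h *\<^sub>R A + snd h *\<^sub>R B) + \<bar>snd h\<bar> * cmod (fst h *\<^sub>R C + snd h *\<^sub>R D)"
    by (rule norm_triangle_le) simp
  also have "\<dots> \<le> norm h * (2 * norm h * e) + norm h * (2 * norm h * e)"
    using f s 1 2 e by (intro add_mono mult_mono) auto
  finally show ?thesis by (simp add: power2_eq_square mult_ac)
qed

lemma eventually_norm_le:
  assumes "continuous_on UNIV (f :: real \<times> real \<Rightarrow> complex)" "0 < e"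
  obtains d where "0 < d" "\<And>x. norm x \<le> d \<Longrightarrow> cmod (f x - f 0) \<le> e"
proof -
  obtain d where "0 < d" and d: "\<And>x. dist x 0 < d \<Longrightarrow> dist (f x) (f 0) < e"
    using assms unfolding continuous_on_iff by (metis UNIV_I)
  then show thesis by (intro that[of "d / 2"]) (auto simp: dist_norm less_imp_le)
qed

text \<open>At 0 the real part of the Hessian is at most \<open>- 2 * Q\<close>, hence at most
  \<open>- 2 * q\<close> times the squared norm. Moving the base point and rotating by \<zeta> may
  cost \<open>q / 2\<close> each, which leaves \<open>- q\<close>. Allowing \<zeta> near 1 is what
  makes the later measure bounds uniform.\<close>

lemma local_strong_concavity:
  fixes \<psi> :: "real \<times> real \<Rightarrow> complex" and Q :: "real \<times> real \<Rightarrow> real"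
  assumes \<psi>: "Ck_open 2 UNIV \<psi>" and \<psi>0: "\<psi> 0 = 1"
    and Q: "Q = (\<lambda>\<theta>. a * (fst \<theta>)\<^sup>2 + b * fst \<theta> * snd \<theta> + c * (snd \<theta>)\<^sup>2)"
    and Qpos: "\<And>\<theta>. \<theta> \<noteq> 0 \<Longrightarrow> 0 < Q \<theta>"
    and exp: "(\<lambda>\<theta>. Re (\<psi> \<theta>) - (1 - Q \<theta>)) \<in> o[at 0](\<lambda>\<theta>. (norm \<theta>)\<^sup>2)"
  obtains \<epsilon> \<kappa> q where "0 < \<epsilon>" "0 < \<kappa>" "0 < q"
    "\<And>\<zeta> m h. cmod (\<zeta> - 1) \<le> \<kappa> \<Longrightarrow> norm (m + h) \<le> \<epsilon> \<Longrightarrow> norm (m - h) \<le> \<epsilon> \<Longrightarrow>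
       Re (\<zeta> * \<psi> (m + h)) + Re (\<zeta> * \<psi> (m - h)) - 2 * Re (\<zeta> * \<psi> m) \<le> - q * (norm h)\<^sup>2"
proof -
  obtain D1 D2 D11 D12 D21 D22 where
    d: "\<And>x. (\<psi> has_derivative (\<lambda>h. fst h *\<^sub>R D1 x + snd h *\<^sub>R D2 x)) (at x)"
    and d1: "\<And>x. (D1 has_derivative (\<lambda>h. fst h *\<^sub>R D11 x + snd h *\<^sub>R D12 x)) (at x)"
    and d2: "\<And>x. (D2 has_derivative (\<lambda>h. fst h *\<^sub>R D21 x + snd h *\<^sub>R D22 x)) (at x)"
    and c: "continuous_on UNIV D11" "continuous_on UNIV D12" "continuous_on UNIV D21" "continuous_on UNIV D22"
    by (rule Ck_open_2_partials[OF \<psi>]) (rule that; assumption)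
  define H where "H = (\<lambda>x h. fst h *\<^sub>R (fst h *\<^sub>R D11 x + snd h *\<^sub>R D12 x) + snd h *\<^sub>R (fst h *\<^sub>R D21 x + snd h *\<^sub>R D22 x))"
  define W where "W = (\<lambda>\<zeta> m h s. Re (\<zeta> * \<psi> (m + s *\<^sub>R h)))"
  define W' where "W' = (\<lambda>\<zeta> m h s. Re (\<zeta> * (fst h *\<^sub>R D1 (m + s *\<^sub>R h) + snd h *\<^sub>R D2 (m + s *\<^sub>R h))))"
  define W'' where "W'' = (\<lambda>\<zeta> m h s. Re (\<zeta> * H (m + s *\<^sub>R h) h))"
  have line: "((\<lambda>s. m + s *\<^sub>R h) has_derivative (\<lambda>t. t *\<^sub>R h)) (at s)" for m h :: "real \<times> real" and s
    by (auto intro!: derivative_eq_intros)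
  have W: "(W \<zeta> m h has_real_derivative W' \<zeta> m h s) (at s)" for \<zeta> m h s
    unfolding has_field_derivative_def W_def W'_def
    by (rule has_derivative_eq_rhs, (rule derivative_intros diff_chain_at[OF line d, unfolded o_def])+)
       (simp add: fun_eq_iff algebra_simps)
  have W': "(W' \<zeta> m h has_real_derivative W'' \<zeta> m h s) (at s)" for \<zeta> m h s
    unfolding has_field_derivative_def W'_def W''_def H_def
    by (rule has_derivative_eq_rhs, (rule derivative_intros diff_chain_at[OF line d1, unfolded o_def] diff_chain_at[OF line d2, unfolded o_def])+)
       (simp add: fun_eq_iff algebra_simps)
  have Qs: "Q (s *\<^sub>R h) = s\<^sup>2 * Q h" for s h unfolding Q by (simp add: power2_eq_square algebra_simps)
  have "compact (sphere (0::real\<times>real) 1)" "sphere (0::real\<times>real) 1 \<noteq> {}" "continuous_on (sphere 0 1) Q"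
    unfolding Q by (auto intro!: continuous_intros)
  from continuous_attains_inf[OF this] obtain x0 where x0: "x0 \<in> sphere 0 1" and min: "\<And>x. x \<in> sphere 0 1 \<Longrightarrow> Q x0 \<le> Q x" by blast
  define q where "q = Q x0"
  have "norm x0 = 1" using x0 by simp
  then have "x0 \<noteq> 0" by force
  from Qpos[OF this] have q: "0 < q" unfolding q_def .
  have Qq: "q * (norm h)\<^sup>2 \<le> Q h" for h
  proof (cases "h = 0")
    case True then show ?thesis by (simp add: Q)
  next
    case False
    have "q \<le> Q ((1 / norm h) *\<^sub>R h)" unfolding q_def using False by (intro min) auto
    then show ?thesis unfolding Qs using False by (simp add: field_simps)
  qed
  \<comment> \<open>The expansion of \<open>Re \<psi>\<close> is only of Peano type, so the Hessian
    is identified through second differences: a larger value of \<open>Re (H 0 h)\<close> would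
    persist near 0 and contradict the expansion along the line through \<open>h\<close>.\<close>
  have H0: "Re (H 0 h) \<le> - 2 * Q h" for h
  proof (rule ccontr)
    assume neg: "\<not> Re (H 0 h) \<le> - 2 * Q h"
    then have h: "h \<noteq> 0" by (auto simp: H_def Q)
    \<comment> \<open>The midpoint of \<open>- 2 * Q h\<close> and \<open>Re (H 0 h)\<close>:
      strictly below the Hessian near 0, strictly above what the expansion permits.\<close>
    define B where "B = (Re (H 0 h) - 2 * Q h) / 2"
    have B: "- 2 * Q h < B" "B < Re (H 0 h)" using neg by (auto simp: B_def)
    have "continuous_on UNIV (\<lambda>s. Re (H (s *\<^sub>R h) h))" unfolding H_def
      by (intro continuous_intros continuous_on_compose2[OF c(1)] continuous_on_compose2[OF c(2)]
        continuous_on_compose2[OF c(3)] continuous_on_compose2[OF c(4)]) auto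
    then have "isCont (\<lambda>s. Re (H (s *\<^sub>R h) h)) 0" by (simp add: continuous_on_eq_continuous_at)
    then have "((\<lambda>s. Re (H (s *\<^sub>R h) h)) \<longlongrightarrow> Re (H 0 h)) (at 0)" by (simp add: isCont_def)
    then have "eventually (\<lambda>s. B < Re (H (s *\<^sub>R h) h)) (at 0)" using B by (intro order_tendstoD)
    then obtain d where d0: "0 < d" and dd: "\<And>s. s \<noteq> 0 \<Longrightarrow> \<bar>s\<bar> < d \<Longrightarrow> B < Re (H (s *\<^sub>R h) h)"
      unfolding eventually_at by (auto simp: dist_real_def)
    have dd': "B < Re (H (s *\<^sub>R h) h)" if "\<bar>s\<bar> < d" for s using dd[of s] B that by (cases "s = 0") auto
    \<comment> \<open>With this choice the two error terms of the expansion use up only half of the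
      gap between \<open>- 2 * Q h\<close> and \<open>B\<close>.\<close>
    define e where "e = (B + 2 * Q h) / (4 * (norm h)\<^sup>2)"
    have e: "0 < e" using B h by (simp add: e_def)
    have "eventually (\<lambda>\<theta>. norm (Re (\<psi> \<theta>) - (1 - Q \<theta>)) \<le> e * norm ((norm \<theta>)\<^sup>2)) (at 0)"
      using landau_o.smallD[OF exp e] .
    then obtain d' where d'0: "0 < d'" and d': "\<And>\<theta>. \<theta> \<noteq> 0 \<Longrightarrow> norm \<theta> < d' \<Longrightarrow> \<bar>Re (\<psi> \<theta>) - (1 - Q \<theta>)\<bar> \<le> e * (norm \<theta>)\<^sup>2"
      unfolding eventually_at by (auto simp: dist_norm)
    define t where "t = min (d / 2) (d' / (2 * norm h))"
    have t: "0 < t" "t < d" "t * norm h < d'"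
      using d0 d'0 h by (auto simp: t_def min_def field_simps)
    have "- W 1 0 h t + - W 1 0 h (- t) - 2 * (- W 1 0 h 0) \<le> (- B) * t\<^sup>2"
    proof (rule second_difference_le[OF _ DERIV_minus[OF W] DERIV_minus[OF W']])
      fix s assume "\<bar>s\<bar> \<le> t"
      then show "- W'' 1 0 h s \<le> - B" using dd'[of s] t unfolding W''_def by simp
    qed (use t in simp)
    then have 1: "B * t\<^sup>2 \<le> W 1 0 h t + W 1 0 h (- t) - 2" by (simp add: W_def \<psi>0)
    have 2: "W 1 0 h t \<le> 1 - t\<^sup>2 * Q h + e * t\<^sup>2 * (norm h)\<^sup>2"
      using d'[of "t *\<^sub>R h"] h t by (simp add: W_def Qs power_mult_distrib)
    have 3: "W 1 0 h (- t) \<le> 1 - t\<^sup>2 * Q h + e * t\<^sup>2 * (norm h)\<^sup>2"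
      using d'[of "(- t) *\<^sub>R h"] h t Qs[of "- t" h] by (simp add: W_def power_mult_distrib)
    have "B * t\<^sup>2 \<le> (- 2 * Q h + 2 * e * (norm h)\<^sup>2) * t\<^sup>2" using 1 2 3 by (simp add: algebra_simps)
    then have "B \<le> - 2 * Q h + 2 * e * (norm h)\<^sup>2" using t by simp
    also have "2 * e * (norm h)\<^sup>2 = (B + 2 * Q h) / 2" unfolding e_def using h by (simp add: field_simps)
    finally show False using B by (simp add: field_simps)
  qed
  define K where "K = cmod (D11 0) + cmod (D12 0) + cmod (D21 0) + cmod (D22 0)"
  have K: "0 \<le> K" by (simp add: K_def)
  \<comment> \<open>Chosen so that \<open>\<kappa>\<close> times the bound \<open>4 * K\<close> for
    the Hessian at 0 is at most \<open>q / 2\<close>; \<open>K + 1\<close> avoids division by zero,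
    and \<open>\<kappa> \<le> 1\<close> gives \<open>cmod \<zeta> \<le> 2\<close>.\<close>
  define \<kappa> where "\<kappa> = min 1 (q / (8 * (K + 1)))"
  have \<kappa>: "0 < \<kappa>" "\<kappa> \<le> 1" "\<kappa> * (4 * K) \<le> q / 2"
  proof -
    show "0 < \<kappa>" "\<kappa> \<le> 1" using q K by (auto simp: \<kappa>_def)
    have "\<kappa> * (4 * K) \<le> q / (8 * (K + 1)) * (4 * K)" using K by (intro mult_right_mono) (auto simp: \<kappa>_def)
    also have "\<dots> \<le> q / 2" using q K by (simp add: field_simps)
    finally show "\<kappa> * (4 * K) \<le> q / 2" .
  qed
  \<comment> \<open>The variation of the Hessian is at most \<open>4 * e\<close> times the squared
    norm, and \<zeta> at most doubles it: 8 times \<open>q / 16\<close> is the second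
    \<open>q / 2\<close>.\<close>
  define e where "e = q / 16"
  have e: "0 < e" using q by (simp add: e_def)
  obtain e1 where e1: "0 < e1" "\<And>x. norm x \<le> e1 \<Longrightarrow> cmod (D11 x - D11 0) \<le> e" using eventually_norm_le[OF c(1) e] by blast
  obtain e2 where e2: "0 < e2" "\<And>x. norm x \<le> e2 \<Longrightarrow> cmod (D12 x - D12 0) \<le> e" using eventually_norm_le[OF c(2) e] by blast
  obtain e3 where e3: "0 < e3" "\<And>x. norm x \<le> e3 \<Longrightarrow> cmod (D21 x - D21 0) \<le> e" using eventually_norm_le[OF c(3) e] by blast
  obtain e4 where e4: "0 < e4" "\<And>x. norm x \<le> e4 \<Longrightarrow> cmod (D22 x - D22 0) \<le> e" using eventually_norm_le[OF c(4) e] by blast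
  define \<epsilon> where "\<epsilon> = min (min e1 e2) (min e3 e4)"
  have \<epsilon>: "0 < \<epsilon>" using e1 e2 e3 e4 by (simp add: \<epsilon>_def)
  have HB: "Re (\<zeta> * H x h) \<le> - q * (norm h)\<^sup>2" if \<zeta>: "cmod (\<zeta> - 1) \<le> \<kappa>" and x: "norm x \<le> \<epsilon>" for \<zeta> x h
  proof -
    have "H x h - H 0 h = fst h *\<^sub>R (fst h *\<^sub>R (D11 x - D11 0) + snd h *\<^sub>R (D12 x - D12 0)) + snd h *\<^sub>R (fst h *\<^sub>R (D21 x - D21 0) + snd h *\<^sub>R (D22 x - D22 0))"
      unfolding H_def by (simp add: algebra_simps)
    also have "cmod \<dots> \<le> 4 * e * (norm h)\<^sup>2"
      using x e1(2) e2(2) e3(2) e4(2) by (intro quadratic_form_bound) (auto simp: \<epsilon>_def)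
    finally have 1: "cmod (H x h - H 0 h) \<le> 4 * e * (norm h)\<^sup>2" .
    have 2: "cmod (H 0 h) \<le> 4 * K * (norm h)\<^sup>2"
      unfolding H_def by (intro quadratic_form_bound) (auto simp: K_def)
    have \<zeta>2: "cmod \<zeta> \<le> 2" using \<zeta> \<kappa> norm_triangle_ineq[of "\<zeta> - 1" 1] by simp
    have "\<zeta> * H x h = H 0 h + (\<zeta> - 1) * H 0 h + \<zeta> * (H x h - H 0 h)" by (simp add: algebra_simps)
    then have "Re (\<zeta> * H x h) = Re (H 0 h) + Re ((\<zeta> - 1) * H 0 h) + Re (\<zeta> * (H x h - H 0 h))" by (metis plus_complex.sel(1))
    also have "Re ((\<zeta> - 1) * H 0 h) \<le> \<kappa> * (4 * K * (norm h)\<^sup>2)"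
      using complex_Re_le_cmod[of "(\<zeta> - 1) * H 0 h"] mult_mono[OF \<zeta> 2] \<kappa> by (simp add: norm_mult)
    also have "Re (\<zeta> * (H x h - H 0 h)) \<le> 2 * (4 * e * (norm h)\<^sup>2)"
      using complex_Re_le_cmod[of "\<zeta> * (H x h - H 0 h)"] mult_mono[OF \<zeta>2 1] by (simp add: norm_mult)
    also have "Re (H 0 h) \<le> - 2 * (q * (norm h)\<^sup>2)" using H0[of h] Qq[of h] by linarith
    also have "\<kappa> * (4 * K * (norm h)\<^sup>2) \<le> q / 2 * (norm h)\<^sup>2"
      using mult_right_mono[OF \<kappa>(3), of "(norm h)\<^sup>2"] by (simp add: mult_ac)
    finally show ?thesis by (simp add: e_def algebra_simps)
  qed
  have "Re (\<zeta> * \<psi> (m + h)) + Re (\<zeta> * \<psi> (m - h)) - 2 * Re (\<zeta> * \<psi> m) \<le> - q * (norm h)\<^sup>2"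
    if \<zeta>: "cmod (\<zeta> - 1) \<le> \<kappa>" and mh: "norm (m + h) \<le> \<epsilon>" "norm (m - h) \<le> \<epsilon>" for \<zeta> m h
  proof -
    have "W \<zeta> m h 1 + W \<zeta> m h (- 1) - 2 * W \<zeta> m h 0 \<le> (- q * (norm h)\<^sup>2) * 1\<^sup>2"
    proof (rule second_difference_le[OF _ W W'])
      fix s :: real assume s: "\<bar>s\<bar> \<le> 1"
      have "m + s *\<^sub>R h = ((1 + s) / 2) *\<^sub>R (m + h) + ((1 - s) / 2) *\<^sub>R (m - h)"
        by (cases m, cases h) (simp add: field_simps)
      also have "norm \<dots> \<le> ((1 + s) / 2) * norm (m + h) + ((1 - s) / 2) * norm (m - h)"
        by (rule norm_triangle_le) (use s in auto)
      also have "\<dots> \<le> ((1 + s) / 2) * \<epsilon> + ((1 - s) / 2) * \<epsilon>"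
        using mh s by (intro add_mono mult_left_mono) auto
      also have "\<dots> = \<epsilon>" by (simp add: field_simps)
      finally have "norm (m + s *\<^sub>R h) \<le> \<epsilon>" .
      from HB[OF \<zeta> this] show "W'' \<zeta> m h s \<le> - q * (norm h)\<^sup>2" unfolding W''_def .
    qed simp
    then show ?thesis by (simp add: W_def)
  qed
  with \<epsilon> \<kappa>(1) q that show thesis by blast
qed

text \<open>The function \<open>w = Re (\<zeta> * \<psi>)\<close> is at most 1 everywhere and at least \<open>1 - \<delta>\<close> on the level set, so strong
  concavity at the midpoint of two points of the level set bounds their distance by a multiple of
  \<open>sqrt \<delta>\<close>. Along horizontal lines the distance is even \<open>O(\<delta>)\<close>, because \<open>Im \<psi>\<close> is strictly monotone there.
  Together these bound the measure of the level set by \<open>O(\<delta> * sqrt \<delta>)\<close>.\<close>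

lemma level_set_thin:
  fixes \<psi> :: "real \<times> real \<Rightarrow> complex" and Q :: "real \<times> real \<Rightarrow> real"
  assumes \<psi>: "Ck_open 2 UNIV \<psi>" and \<psi>0: "\<psi> 0 = 1" and le1: "\<And>\<theta>. cmod (\<psi> \<theta>) \<le> 1"
    and Q: "Q = (\<lambda>\<theta>. a * (fst \<theta>)\<^sup>2 + b * fst \<theta> * snd \<theta> + c * (snd \<theta>)\<^sup>2)"
    and Qpos: "\<And>\<theta>. \<theta> \<noteq> 0 \<Longrightarrow> 0 < Q \<theta>"
    and exp: "(\<lambda>\<theta>. Re (\<psi> \<theta>) - (1 - Q \<theta>)) \<in> o[at 0](\<lambda>\<theta>. (norm \<theta>)\<^sup>2)"
    and im: "Im (frechet_derivative \<psi> (at 0) (1, 0)) \<noteq> 0"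
  obtains \<epsilon> C where "0 < \<epsilon>" "0 < C"
    "\<And>\<zeta> \<delta> x y. cmod \<zeta> \<le> 1 \<Longrightarrow> 0 < \<delta> \<Longrightarrow> norm x \<le> \<epsilon> \<Longrightarrow> norm y \<le> \<epsilon> \<Longrightarrow>
       cmod (1 - \<zeta> * \<psi> x) \<le> \<delta> \<Longrightarrow> cmod (1 - \<zeta> * \<psi> y) \<le> \<delta> \<Longrightarrow>
       (norm (x - y))\<^sup>2 \<le> C * \<delta> \<and> (snd x = snd y \<longrightarrow> \<bar>fst x - fst y\<bar> \<le> C * \<delta>)"
proof -
  obtain \<epsilon>0 \<kappa>0 q where \<epsilon>0: "0 < \<epsilon>0" and \<kappa>0: "0 < \<kappa>0" and q: "0 < q" and
    conc: "\<And>\<zeta> m h. cmod (\<zeta> - 1) \<le> \<kappa>0 \<Longrightarrow> norm (m + h) \<le> \<epsilon>0 \<Longrightarrow> norm (m - h) \<le> \<epsilon>0 \<Longrightarrow>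
       Re (\<zeta> * \<psi> (m + h)) + Re (\<zeta> * \<psi> (m - h)) - 2 * Re (\<zeta> * \<psi> m) \<le> - q * (norm h)\<^sup>2"
    using local_strong_concavity[OF \<psi> \<psi>0 Q Qpos exp] by blast
  obtain D1 D2 D11 D12 D21 D22 where
    d: "\<And>x. (\<psi> has_derivative (\<lambda>h. fst h *\<^sub>R D1 x + snd h *\<^sub>R D2 x)) (at x)"
    and cD1: "continuous_on UNIV D1"
    by (rule Ck_open_2_partials[OF \<psi>]) (rule that; assumption)
  define \<mu> where "\<mu> = \<bar>Im (D1 0)\<bar>"
  have \<mu>: "0 < \<mu>" using im frechet_derivative_at[OF d[of 0]] unfolding \<mu>_def by (metis (no_types, lifting) abs_not_less_zero add.right_neutral fst_conv linorder_neqE_linordered_idom scaleR_one scaleR_zero_left snd_conv zero_less_abs_iff)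
  define \<kappa> where "\<kappa> = min \<kappa>0 (1 / 2)"
  have \<kappa>: "0 < \<kappa>" "\<kappa> \<le> \<kappa>0" "\<kappa> \<le> 1 / 2" using \<kappa>0 by (auto simp: \<kappa>_def)
  have c\<psi>: "continuous_on UNIV \<psi>" using Ck_open_imp_continuous_on[OF \<psi>] .
  obtain e1 where e1: "0 < e1" "\<And>x. norm x \<le> e1 \<Longrightarrow> cmod (\<psi> x - \<psi> 0) \<le> \<kappa> / 2"
    using eventually_norm_le[OF c\<psi>, of "\<kappa> / 2"] \<kappa> by auto
  obtain e2 where e2: "0 < e2" "\<And>x. norm x \<le> e2 \<Longrightarrow> cmod (D1 x - D1 0) \<le> \<mu> / 2"
    using eventually_norm_le[OF cD1, of "\<mu> / 2"] \<mu> by auto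
  define \<epsilon> where "\<epsilon> = min \<epsilon>0 (min e1 e2)"
  have \<epsilon>: "0 < \<epsilon>" "\<epsilon> \<le> \<epsilon>0" "\<epsilon> \<le> e1" "\<epsilon> \<le> e2" using \<epsilon>0 e1 e2 by (auto simp: \<epsilon>_def)
  \<comment> \<open>Threshold between two regimes. Below it a nonempty level set forces \<zeta> to
    within \<open>\<kappa>\<close> of 1, where concavity applies; above it the diameter
    \<open>2 * \<epsilon>\<close> of the ball is already an admissible bound.\<close>
  define \<delta>0 where "\<delta>0 = \<kappa> / 2"
  have \<delta>0: "0 < \<delta>0" using \<kappa> by (simp add: \<delta>0_def)
  \<comment> \<open>The summands serve, in order, strong concavity, monotonicity of
    \<open>Im \<psi>\<close> on horizontal lines, and the two trivial bounds for
    \<open>\<delta>\<close> above the threshold.\<close>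
  define C where "C = 8 / q + 8 / \<mu> + 4 * \<epsilon>\<^sup>2 / \<delta>0 + 2 * \<epsilon> / \<delta>0"
  have Cs: "8 / q \<le> C" "8 / \<mu> \<le> C" "4 * \<epsilon>\<^sup>2 / \<delta>0 \<le> C" "2 * \<epsilon> / \<delta>0 \<le> C"
    using q \<mu> \<epsilon> \<delta>0 by (auto simp: C_def add_nonneg_nonneg)
  have C: "0 < C" using Cs(1) q by (meson divide_pos_pos less_le_trans zero_less_numeral)
  have "(norm (x - y))\<^sup>2 \<le> C * \<delta> \<and> (snd x = snd y \<longrightarrow> \<bar>fst x - fst y\<bar> \<le> C * \<delta>)"
    if \<zeta>: "cmod \<zeta> \<le> 1" and \<delta>: "0 < \<delta>" and x: "norm x \<le> \<epsilon>" and y: "norm y \<le> \<epsilon>"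
      and lx: "cmod (1 - \<zeta> * \<psi> x) \<le> \<delta>" and ly: "cmod (1 - \<zeta> * \<psi> y) \<le> \<delta>" for \<zeta> \<delta> x y
  proof (cases "\<delta>0 \<le> \<delta>")
    case True
    have n: "norm (x - y) \<le> 2 * \<epsilon>" using norm_triangle_ineq4[of x y] x y by simp
    then have "(norm (x - y))\<^sup>2 \<le> (2 * \<epsilon>)\<^sup>2" by (intro power_mono) auto
    also have "\<dots> = (4 * \<epsilon>\<^sup>2 / \<delta>0) * \<delta>0" using \<delta>0 by (simp add: power_mult_distrib)
    also have "\<dots> \<le> C * \<delta>" using Cs(3) True \<delta>0 C by (intro mult_mono) auto
    finally have 1: "(norm (x - y))\<^sup>2 \<le> C * \<delta>" .
    have "\<bar>fst x - fst y\<bar> \<le> norm (x - y)" using abs_fst_le_norm[of "x - y"] by simp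
    also have "\<dots> \<le> (2 * \<epsilon> / \<delta>0) * \<delta>0" using n \<delta>0 by simp
    also have "\<dots> \<le> C * \<delta>" using Cs(4) True \<delta>0 C by (intro mult_mono) auto
    finally show ?thesis using 1 by blast
  next
    case False
    have "cmod (1 - \<psi> x) \<le> \<kappa> / 2" using e1(2)[of x] x \<epsilon> \<psi>0 by (simp add: norm_minus_commute)
    then have "cmod (\<zeta> * (1 - \<psi> x)) \<le> 1 * (\<kappa> / 2)" unfolding norm_mult using \<zeta> by (intro mult_mono) auto
    moreover have "\<zeta> - 1 = - (1 - \<zeta> * \<psi> x) + \<zeta> * (1 - \<psi> x)" by (simp add: algebra_simps)
    \<comment> \<open>Two errors of size \<open>\<kappa> / 2\<close>:
      \<open>\<zeta> * \<psi> x\<close> is close to 1 by membership in the level set, and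
      \<open>\<psi> x\<close> is close to 1 by the choice of \<open>e1\<close>.\<close>
    ultimately have \<zeta>1: "cmod (\<zeta> - 1) \<le> \<kappa>"
      using norm_triangle_ineq[of "- (1 - \<zeta> * \<psi> x)" "\<zeta> * (1 - \<psi> x)"] lx False
      by (simp only: norm_minus_cancel \<delta>0_def)
    define m where "m = (1 / 2) *\<^sub>R (x + y)"
    define h where "h = (1 / 2) *\<^sub>R (x - y)"
    have mh: "m + h = x" "m - h = y" by (auto simp: m_def h_def algebra_simps prod_eq_iff)
    have "Re (\<zeta> * \<psi> x) + Re (\<zeta> * \<psi> y) - 2 * Re (\<zeta> * \<psi> m) \<le> - q * (norm h)\<^sup>2"
      using conc[of \<zeta> m h] \<zeta>1 \<kappa> x y \<epsilon> unfolding mh by simp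
    moreover have "Re (\<zeta> * \<psi> m) \<le> 1"
    proof -
      have "cmod (\<zeta> * \<psi> m) \<le> 1" unfolding norm_mult using \<zeta> le1 by (intro mult_le_one) auto
      then show ?thesis using complex_Re_le_cmod order_trans by blast
    qed
    moreover have "1 - \<delta> \<le> Re (\<zeta> * \<psi> x)" "1 - \<delta> \<le> Re (\<zeta> * \<psi> y)"
      using complex_Re_le_cmod[of "1 - \<zeta> * \<psi> x"] complex_Re_le_cmod[of "1 - \<zeta> * \<psi> y"] lx ly by auto
    ultimately have "q * (norm h)\<^sup>2 \<le> 2 * \<delta>" by linarith
    moreover have "(norm (x - y))\<^sup>2 = 4 * (norm h)\<^sup>2" by (simp add: h_def power_divide)
    ultimately have "(norm (x - y))\<^sup>2 \<le> (8 / q) * \<delta>" using q by (simp add: field_simps)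
    also have "\<dots> \<le> C * \<delta>" using Cs \<delta> by (intro mult_right_mono) auto
    finally have 1: "(norm (x - y))\<^sup>2 \<le> C * \<delta>" .
    have 2: "\<bar>fst x - fst y\<bar> \<le> C * \<delta>" if s: "snd x = snd y"
    proof -
      have "cmod \<zeta> \<ge> 1 / 2" using \<zeta>1 \<kappa> norm_triangle_ineq2[of 1 "1 - \<zeta>"] by (simp add: norm_minus_commute)
      have "cmod (\<zeta> * (\<psi> x - \<psi> y)) = cmod ((1 - \<zeta> * \<psi> y) - (1 - \<zeta> * \<psi> x))" by (simp add: algebra_simps)
      also have "\<dots> \<le> 2 * \<delta>" using norm_triangle_ineq4[of "1 - \<zeta> * \<psi> y" "1 - \<zeta> * \<psi> x"] lx ly by linarith
      finally have "cmod \<zeta> * cmod (\<psi> x - \<psi> y) \<le> 2 * \<delta>" by (simp add: norm_mult)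
      moreover have "1 / 2 * cmod (\<psi> x - \<psi> y) \<le> cmod \<zeta> * cmod (\<psi> x - \<psi> y)"
        using \<open>cmod \<zeta> \<ge> 1 / 2\<close> by (intro mult_right_mono) auto
      ultimately have "cmod (\<psi> x - \<psi> y) \<le> 4 * \<delta>" by simp
      then have A: "\<bar>Im (\<psi> x) - Im (\<psi> y)\<bar> \<le> 4 * \<delta>" using abs_Im_le_cmod[of "\<psi> x - \<psi> y"] by simp
      \<comment> \<open>Mean value theorem on a horizontal segment. The segment stays in the ball by
        convexity, and there \<open>Im (D1 _)\<close> keeps at least half of its modulus at
        0.\<close>
      have key: "\<mu> / 2 * (v - u) \<le> \<bar>Im (\<psi> (v, w)) - Im (\<psi> (u, w))\<bar>"
        if uv: "u < v" and nu: "norm (u, w) \<le> \<epsilon>" "norm (v, w) \<le> \<epsilon>" for u v w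
      proof -
        have der: "((\<lambda>s. Im (\<psi> (s, w))) has_real_derivative Im (D1 (s, w))) (at s)" for s
        proof -
          have "((\<lambda>s. (s, w)) has_derivative (\<lambda>t. (t, 0))) (at s)" by (auto intro!: derivative_eq_intros)
          from diff_chain_at[OF this d] have "((\<lambda>s. \<psi> (s, w)) has_derivative (\<lambda>t. t *\<^sub>R D1 (s, w))) (at s)"
            by (simp add: o_def)
          from bounded_linear.has_derivative[OF bounded_linear_Im this] show ?thesis
            by (simp add: has_field_derivative_def mult_commute_abs)
        qed
        from MVT2[OF uv der] obtain z where z: "u < z" "z < v" "Im (\<psi> (v, w)) - Im (\<psi> (u, w)) = (v - u) * Im (D1 (z, w))" by blast
        have "(z, w) \<in> closed_segment (u, w) (v, w)"
        proof -
          define r where "r = (z - u) / (v - u)"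
          have "0 \<le> r" "r \<le> 1" using z uv by (auto simp: r_def)
          moreover have "r * (v - u) = z - u" using uv by (simp add: r_def)
          then have "z = (1 - r) * u + r * v" by (simp add: algebra_simps)
          ultimately show ?thesis unfolding closed_segment_def by (auto intro!: exI[of _ r] simp: algebra_simps)
        qed
        moreover have "closed_segment (u, w) (v, w) \<subseteq> cball 0 \<epsilon>"
          using nu by (intro closed_segment_subset) auto
        ultimately have "norm (z, w) \<le> e2" using \<epsilon> by auto
        from e2(2)[OF this] have "\<bar>Im (D1 (z, w)) - Im (D1 0)\<bar> \<le> \<mu> / 2"
          using abs_Im_le_cmod[of "D1 (z, w) - D1 0"] by simp
        then have "\<mu> / 2 \<le> \<bar>Im (D1 (z, w))\<bar>" unfolding \<mu>_def by linarith
        then show ?thesis unfolding z(3) abs_mult using uv by (simp add: mult.commute mult_left_mono)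
      qed
      have xe: "(fst x, snd x) = x" "(fst y, snd x) = y" using s by (auto simp: prod_eq_iff)
      have "\<mu> / 2 * \<bar>fst x - fst y\<bar> \<le> \<bar>Im (\<psi> x) - Im (\<psi> y)\<bar>"
      proof (cases "fst x" "fst y" rule: linorder_cases)
        case less
        then show ?thesis using key[of "fst x" "fst y" "snd x", unfolded xe] x y by (simp add: abs_minus_commute)
      next
        case greater
        then show ?thesis using key[of "fst y" "fst x" "snd x", unfolded xe] x y by simp
      qed simp
      then have "\<bar>fst x - fst y\<bar> \<le> 8 / \<mu> * \<delta>" using A \<mu> by (simp add: field_simps)
      also have "\<dots> \<le> C * \<delta>" using Cs \<delta> by (intro mult_right_mono) auto
      finally show ?thesis .
    qed
    show ?thesis using 1 2 by blast
  qed
  with \<epsilon>(1) C that show thesis by blast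
qed


subsection \<open>Measure of level sets and integrals of the kernel\<close>

text \<open>Fubini over horizontal slices. An interval centred at an arbitrary point of a slice has
  length \<open>2 * d1\<close>, and the heights lie in one of length \<open>2 * d2\<close>; the
  product gives the factor 4.\<close>

lemma measure_thin_set_le:
  fixes S :: "(real \<times> real) set"
  assumes S: "S \<in> sets borel" and d: "0 \<le> d1" "0 \<le> d2"
    and h: "\<And>x y. x \<in> S \<Longrightarrow> y \<in> S \<Longrightarrow> snd x = snd y \<Longrightarrow> \<bar>fst x - fst y\<bar> \<le> d1"
    and v: "\<And>x y. x \<in> S \<Longrightarrow> y \<in> S \<Longrightarrow> \<bar>snd x - snd y\<bar> \<le> d2"
  shows "measure lebesgue S \<le> 4 * d1 * d2"
proof (cases "S = {}")
  case False
  then obtain a0 b0 where p: "(a0, b0) \<in> S" by auto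
  have SS: "S \<in> sets (lborel \<Otimes>\<^sub>M (lborel :: real measure))"
    using S by (simp only: lborel_prod sets_lborel)
  have "emeasure lborel S = (\<integral>\<^sup>+y. emeasure lborel ((\<lambda>x. (x, y)) -` S) \<partial>lborel)"
    using lborel_pair.emeasure_pair_measure_alt2[OF SS] by (simp add: lborel_prod)
  also have "\<dots> \<le> (\<integral>\<^sup>+y. ennreal (2 * d1) * indicator {b0 - d2..b0 + d2} y \<partial>lborel)"
  proof (rule nn_integral_mono)
    fix y :: real
    show "emeasure lborel ((\<lambda>x. (x, y)) -` S) \<le> ennreal (2 * d1) * indicator {b0 - d2..b0 + d2} y"
    proof (cases "(\<lambda>x. (x, y)) -` S = {}")
      case False
      then obtain x where x: "(x, y) \<in> S" by auto
      have y: "y \<in> {b0 - d2..b0 + d2}" using v[OF x p] by auto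
      have "(\<lambda>x. (x, y)) -` S \<subseteq> {x - d1..x + d1}" using h[OF x] by force
      then have "emeasure lborel ((\<lambda>x. (x, y)) -` S) \<le> emeasure lborel {x - d1..x + d1}"
        by (intro emeasure_mono) auto
      also have "\<dots> = ennreal (2 * d1)" using d by simp
      finally show ?thesis using y by simp
    qed simp
  qed
  also have "\<dots> = ennreal (2 * d1) * emeasure lborel {b0 - d2..b0 + d2}"
    by (rule nn_integral_cmult_indicator) simp
  also have "\<dots> = ennreal (4 * d1 * d2)" using d by (simp add: ennreal_mult[symmetric])
  finally have "emeasure lborel S \<le> ennreal (4 * d1 * d2)" .
  then have "measure lborel S \<le> 4 * d1 * d2"
    unfolding measure_def using d by (intro enn2real_leI) auto
  then show ?thesis using S by (simp add: measure_completion)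
qed (use d in simp)

lemma compact_tbox_sublevel:
  fixes G :: "real \<times> real \<Rightarrow> real"
  assumes "continuous_on UNIV G"
  shows "compact {\<theta> \<in> tbox. G \<theta> \<le> d}" "compact {\<theta> \<in> tbox. d \<le> G \<theta>}"
proof -
  have "compact (tbox \<inter> (tbox \<inter> G -` {..d}))" "compact (tbox \<inter> (tbox \<inter> G -` {d..}))"
    by (intro compact_Int_closed compact_cbox continuous_closed_preimage continuous_on_subset[OF assms] closed_cbox; simp)+
  moreover have "tbox \<inter> (tbox \<inter> G -` {..d}) = {\<theta> \<in> tbox. G \<theta> \<le> d}" "tbox \<inter> (tbox \<inter> G -` {d..}) = {\<theta> \<in> tbox. d \<le> G \<theta>}"
    by auto
  ultimately show "compact {\<theta> \<in> tbox. G \<theta> \<le> d}" "compact {\<theta> \<in> tbox. d \<le> G \<theta>}" by simp_all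
qed

lemma indicator_has_integral_tbox:
  assumes "compact A" "A \<subseteq> tbox"
  shows "(indicat_real A has_integral measure lebesgue A) tbox"
proof -
  have "(indicat_real A has_integral measure lebesgue A) UNIV"
    using lmeasurable_iff_indicator_has_integral[of A "measure lebesgue A"] lmeasurable_compact[OF assms(1)] by simp
  moreover have "(\<lambda>x. if x \<in> tbox then indicat_real A x else 0) = indicat_real A"
    using assms(2) by (auto simp: indicator_def fun_eq_iff)
  ultimately show ?thesis using has_integral_restrict_UNIV[of tbox "indicat_real A" "measure lebesgue A"] by simp
qed

text \<open>Translation moves \<alpha> to 0 and multiplication by \<open>cnj (F \<alpha>)\<close>
  normalises the value to 1. The rotation is absorbed into \<zeta>, which costs nothing because
  \<zeta> ranges over the full closed disc.\<close>

lemma level_set_thin_translated: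
  fixes F :: "real \<times> real \<Rightarrow> complex"
  assumes F: "Ck_open 2 UNIV F" and le1: "\<And>\<theta>. cmod (F \<theta>) \<le> 1" and \<alpha>: "cmod (F \<alpha>) = 1"
    and Q: "Q = (\<lambda>\<theta>. a * (fst \<theta>)\<^sup>2 + b * fst \<theta> * snd \<theta> + c * (snd \<theta>)\<^sup>2)"
    and Qpos: "\<And>\<theta>. \<theta> \<noteq> 0 \<Longrightarrow> 0 < Q \<theta>"
    and exp: "(\<lambda>\<theta>. Re (cnj (F \<alpha>) * F (\<alpha> + \<theta>)) - (1 - Q \<theta>)) \<in> o[at 0](\<lambda>\<theta>. (norm \<theta>)\<^sup>2)"
    and im: "Im (cnj (F \<alpha>) * frechet_derivative F (at \<alpha>) (1, 0)) \<noteq> 0"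
  obtains \<epsilon> C where "0 < \<epsilon>" "0 < C"
    "\<And>\<zeta> \<delta> x y. cmod \<zeta> \<le> 1 \<Longrightarrow> 0 < \<delta> \<Longrightarrow> dist \<alpha> x \<le> \<epsilon> \<Longrightarrow> dist \<alpha> y \<le> \<epsilon> \<Longrightarrow>
       cmod (1 - \<zeta> * F x) \<le> \<delta> \<Longrightarrow> cmod (1 - \<zeta> * F y) \<le> \<delta> \<Longrightarrow>
       (norm (x - y))\<^sup>2 \<le> C * \<delta> \<and> (snd x = snd y \<longrightarrow> \<bar>fst x - fst y\<bar> \<le> C * \<delta>)"
proof -
  define \<psi> where "\<psi> = (\<lambda>\<theta>. cnj (F \<alpha>) * F (\<alpha> + \<theta>))"
  have tr: "Ck_open n UNIV (\<lambda>\<theta>. f (\<alpha> + \<theta>))" if "Ck_open n UNIV f" for n and f :: "real \<times> real \<Rightarrow> complex"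
    using that
  proof (induction n arbitrary: f)
    case 0 then show ?case by (auto intro!: continuous_on_compose2[of UNIV f] continuous_intros)
  next
    case (Suc n)
    have "((\<lambda>\<theta>. \<alpha> + \<theta>) has_derivative (\<lambda>h. h)) (at x)" for x by (auto intro!: derivative_eq_intros)
    from diff_chain_at[OF this Ck_open_SucD(1)[OF Suc.prems]]
    have "((\<lambda>\<theta>. f (\<alpha> + \<theta>)) has_derivative frechet_derivative f (at (\<alpha> + x))) (at x)" for x by (simp add: o_def)
    then show ?case by (rule Ck_open_SucI[OF open_UNIV]) (rule Suc.IH[OF Ck_open_SucD(2)[OF Suc.prems]])
  qed
  have \<psi>: "Ck_open 2 UNIV \<psi>" unfolding \<psi>_def
    by (rule Ck_open_bounded_linear[OF open_UNIV bounded_linear_mult_right tr[OF F]])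
  have u: "F \<alpha> * cnj (F \<alpha>) = 1" using \<alpha> by (simp add: complex_norm_square[symmetric])
  have \<psi>0: "\<psi> 0 = 1" using u by (simp add: \<psi>_def mult.commute)
  have d: "(F has_derivative frechet_derivative F (at \<alpha>)) (at \<alpha>)"
    using Ck_open_SucD(1)[of 1 UNIV F \<alpha>] F by (simp add: numeral_2_eq_2)
  have "((\<lambda>\<theta>. \<alpha> + \<theta>) has_derivative (\<lambda>h. h)) (at 0)" by (auto intro!: derivative_eq_intros)
  from diff_chain_at[OF this] d have "((\<lambda>\<theta>. F (\<alpha> + \<theta>)) has_derivative frechet_derivative F (at \<alpha>)) (at 0)" by (simp add: o_def)
  from has_derivative_mult_right[OF this, of "cnj (F \<alpha>)"]
  have "frechet_derivative \<psi> (at 0) = (\<lambda>h. cnj (F \<alpha>) * frechet_derivative F (at \<alpha>) h)"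
    unfolding \<psi>_def by (rule frechet_derivative_at[symmetric])
  then have im': "Im (frechet_derivative \<psi> (at 0) (1, 0)) \<noteq> 0" using im by simp
  have le1': "cmod (\<psi> \<theta>) \<le> 1" for \<theta> unfolding \<psi>_def using le1[of "\<alpha> + \<theta>"] \<alpha> by (simp add: norm_mult)
  have exp': "(\<lambda>\<theta>. Re (\<psi> \<theta>) - (1 - Q \<theta>)) \<in> o[at 0](\<lambda>\<theta>. (norm \<theta>)\<^sup>2)" using exp by (simp only: \<psi>_def)
  obtain \<epsilon> C where \<epsilon>: "0 < \<epsilon>" and C: "0 < C" and key:
    "\<And>\<zeta> \<delta> x y. cmod \<zeta> \<le> 1 \<Longrightarrow> 0 < \<delta> \<Longrightarrow> norm x \<le> \<epsilon> \<Longrightarrow> norm y \<le> \<epsilon> \<Longrightarrow>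
       cmod (1 - \<zeta> * \<psi> x) \<le> \<delta> \<Longrightarrow> cmod (1 - \<zeta> * \<psi> y) \<le> \<delta> \<Longrightarrow>
       (norm (x - y))\<^sup>2 \<le> C * \<delta> \<and> (snd x = snd y \<longrightarrow> \<bar>fst x - fst y\<bar> \<le> C * \<delta>)"
    using level_set_thin[OF \<psi> \<psi>0 le1' Q Qpos exp' im'] by blast
  have "(norm (x - y))\<^sup>2 \<le> C * \<delta> \<and> (snd x = snd y \<longrightarrow> \<bar>fst x - fst y\<bar> \<le> C * \<delta>)"
    if "cmod \<zeta> \<le> 1" "0 < \<delta>" "dist \<alpha> x \<le> \<epsilon>" "dist \<alpha> y \<le> \<epsilon>" "cmod (1 - \<zeta> * F x) \<le> \<delta>" "cmod (1 - \<zeta> * F y) \<le> \<delta>" for \<zeta> \<delta> x y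
  proof -
    have "(\<zeta> * F \<alpha>) * \<psi> (z - \<alpha>) = \<zeta> * (F \<alpha> * cnj (F \<alpha>)) * F z" for z by (simp add: \<psi>_def mult_ac)
    then have e: "(\<zeta> * F \<alpha>) * \<psi> (z - \<alpha>) = \<zeta> * F z" for z using u by simp
    show ?thesis using key[of "\<zeta> * F \<alpha>" \<delta> "x - \<alpha>" "y - \<alpha>"] that \<alpha> unfolding e
      by (simp add: norm_mult dist_norm norm_minus_commute)
  qed
  with \<epsilon> C that show thesis by blast
qed

text \<open>Finitely many of the local estimates cover the compact contact set. On the rest of the
  box the modulus of \<open>F\<close> is at most \<open>1 - \<kappa>\<close>, so a level set with
  \<open>\<delta> < \<kappa>\<close> does not reach it.\<close>

lemma level_set_measure_le:
  fixes F :: "real \<times> real \<Rightarrow> complex"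
  assumes F: "continuous_on UNIV F" and le1: "\<And>\<theta>. cmod (F \<theta>) \<le> 1"
    and thin: "\<And>\<alpha>. \<alpha> \<in> tbox \<Longrightarrow> cmod (F \<alpha>) = 1 \<Longrightarrow> \<exists>\<epsilon> C. 0 < \<epsilon> \<and> 0 < C \<and>
      (\<forall>\<zeta> \<delta> x y. cmod \<zeta> \<le> 1 \<longrightarrow> 0 < \<delta> \<longrightarrow> dist \<alpha> x \<le> \<epsilon> \<longrightarrow> dist \<alpha> y \<le> \<epsilon> \<longrightarrow>
       cmod (1 - \<zeta> * F x) \<le> \<delta> \<longrightarrow> cmod (1 - \<zeta> * F y) \<le> \<delta> \<longrightarrow>
       (norm (x - y))\<^sup>2 \<le> C * \<delta> \<and> (snd x = snd y \<longrightarrow> \<bar>fst x - fst y\<bar> \<le> C * \<delta>))"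
  obtains K where "0 < K"
    "\<And>\<zeta> \<delta>. cmod \<zeta> \<le> 1 \<Longrightarrow> 0 < \<delta> \<Longrightarrow> measure lebesgue {\<theta> \<in> tbox. cmod (1 - \<zeta> * F \<theta>) \<le> \<delta>} \<le> K * (\<delta> * sqrt \<delta>)"
proof -
  define E where "E = {\<alpha> \<in> tbox. cmod (F \<alpha>) = 1}"
  have "E = {\<alpha> \<in> tbox. 1 \<le> cmod (F \<alpha>)}" using le1 by (auto simp: E_def intro: antisym)
  then have cE: "compact E" using compact_tbox_sublevel(2)[of "\<lambda>\<alpha>. cmod (F \<alpha>)" 1] F by (simp add: continuous_on_norm)
  have "\<forall>\<alpha>\<in>E. \<exists>p. 0 < fst p \<and> 0 < snd p \<and>
      (\<forall>\<zeta> \<delta> x y. cmod \<zeta> \<le> 1 \<longrightarrow> 0 < \<delta> \<longrightarrow> dist \<alpha> x \<le> fst p \<longrightarrow> dist \<alpha> y \<le> fst p \<longrightarrow>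
       cmod (1 - \<zeta> * F x) \<le> \<delta> \<longrightarrow> cmod (1 - \<zeta> * F y) \<le> \<delta> \<longrightarrow>
       (norm (x - y))\<^sup>2 \<le> snd p * \<delta> \<and> (snd x = snd y \<longrightarrow> \<bar>fst x - fst y\<bar> \<le> snd p * \<delta>))"
    using thin unfolding E_def by simp
  from bchoice[OF this] obtain P :: "real \<times> real \<Rightarrow> real \<times> real" where P: "\<And>\<alpha>. \<alpha> \<in> E \<Longrightarrow> 0 < fst (P \<alpha>)" "\<And>\<alpha>. \<alpha> \<in> E \<Longrightarrow> 0 < snd (P \<alpha>)"
    and key: "\<And>\<alpha> \<zeta> \<delta> x y. \<alpha> \<in> E \<Longrightarrow> cmod \<zeta> \<le> 1 \<Longrightarrow> 0 < \<delta> \<Longrightarrow> dist \<alpha> x \<le> fst (P \<alpha>) \<Longrightarrow> dist \<alpha> y \<le> fst (P \<alpha>) \<Longrightarrow>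
       cmod (1 - \<zeta> * F x) \<le> \<delta> \<Longrightarrow> cmod (1 - \<zeta> * F y) \<le> \<delta> \<Longrightarrow>
       (norm (x - y))\<^sup>2 \<le> snd (P \<alpha>) * \<delta> \<and> (snd x = snd y \<longrightarrow> \<bar>fst x - fst y\<bar> \<le> snd (P \<alpha>) * \<delta>)"
    by blast
  have cov: "E \<subseteq> (\<Union>\<alpha>\<in>E. ball \<alpha> (fst (P \<alpha>)))" using P by force
  obtain A where A: "A \<subseteq> E" "finite A" "E \<subseteq> (\<Union>\<alpha>\<in>A. ball \<alpha> (fst (P \<alpha>)))"
    by (rule compactE_image[OF cE _ cov]) auto
  define R where "R = tbox - (\<Union>\<alpha>\<in>A. ball \<alpha> (fst (P \<alpha>)))"
  have cR: "compact R" unfolding R_def by (intro compact_diff compact_cbox) auto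
  have R1: "cmod (F \<theta>) < 1" if "\<theta> \<in> R" for \<theta>
  proof -
    have "\<theta> \<notin> E" using that A(3) unfolding R_def by blast
    then show ?thesis using that le1[of \<theta>] unfolding R_def E_def by (auto simp: order.strict_iff_order)
  qed
  obtain \<kappa> where \<kappa>: "0 < \<kappa>" "\<And>\<theta>. \<theta> \<in> R \<Longrightarrow> cmod (F \<theta>) \<le> 1 - \<kappa>"
  proof (cases "R = {}")
    case True then show ?thesis by (intro that[of 1]) auto
  next
    case False
    have "continuous_on R (\<lambda>\<theta>. cmod (F \<theta>))" by (intro continuous_intros continuous_on_subset[OF F]) auto
    from continuous_attains_sup[OF cR False this] obtain t where t: "t \<in> R" "\<And>\<theta>. \<theta> \<in> R \<Longrightarrow> cmod (F \<theta>) \<le> cmod (F t)" by blast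
    then show ?thesis using R1[OF t(1)] by (intro that[of "1 - cmod (F t)"]) auto
  qed
  define K1 where "K1 = (\<Sum>\<alpha>\<in>A. 4 * (snd (P \<alpha>) * sqrt (snd (P \<alpha>))))"
  \<comment> \<open>The second summand covers \<open>\<delta> \<ge> \<kappa>\<close>, where the
    measure of the whole box is an admissible bound.\<close>
  define K where "K = K1 + 4 * pi\<^sup>2 / (\<kappa> * sqrt \<kappa>)"
  have K1: "0 \<le> K1" unfolding K1_def using P(2) A(1) by (intro sum_nonneg) (auto simp: less_imp_le subset_iff)
  have K: "0 < K" "K1 \<le> K" "4 * pi\<^sup>2 / (\<kappa> * sqrt \<kappa>) \<le> K" using K1 \<kappa> unfolding K_def by (auto intro!: add_nonneg_pos)
  have comp: "compact {\<theta> \<in> tbox \<inter> X. cmod (1 - \<zeta> * F \<theta>) \<le> \<delta>}" if "closed X" for X \<zeta> \<delta>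
  proof -
    have "compact ({\<theta> \<in> tbox. cmod (1 - \<zeta> * F \<theta>) \<le> \<delta>} \<inter> X)"
      by (intro compact_Int_closed compact_tbox_sublevel(1) continuous_intros F that)
    moreover have "{\<theta> \<in> tbox. cmod (1 - \<zeta> * F \<theta>) \<le> \<delta>} \<inter> X = {\<theta> \<in> tbox \<inter> X. cmod (1 - \<zeta> * F \<theta>) \<le> \<delta>}" by auto
    ultimately show ?thesis by simp
  qed
  have "measure lebesgue {\<theta> \<in> tbox. cmod (1 - \<zeta> * F \<theta>) \<le> \<delta>} \<le> K * (\<delta> * sqrt \<delta>)"
    if \<zeta>: "cmod \<zeta> \<le> 1" and \<delta>: "0 < \<delta>" for \<zeta> \<delta>
  proof (cases "\<kappa> \<le> \<delta>")
    case True
    have "measure lebesgue {\<theta> \<in> tbox. cmod (1 - \<zeta> * F \<theta>) \<le> \<delta>} \<le> measure lebesgue tbox"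
      using comp[of UNIV \<zeta> \<delta>] by (intro measure_mono_fmeasurable) (auto intro!: lmeasurable_compact fmeasurableD)
    also have "\<dots> = 4 * pi\<^sup>2 / (\<kappa> * sqrt \<kappa>) * (\<kappa> * sqrt \<kappa>)"
      using \<kappa> by (simp add: content_Pair power2_eq_square)
    also have "\<dots> \<le> K * (\<delta> * sqrt \<delta>)" using True \<kappa> K by (intro mult_mono) auto
    finally show ?thesis .
  next
    case False
    define S where "S = (\<lambda>\<alpha>. {\<theta> \<in> tbox \<inter> cball \<alpha> (fst (P \<alpha>)). cmod (1 - \<zeta> * F \<theta>) \<le> \<delta>})"
    have cS: "compact (S \<alpha>)" for \<alpha> unfolding S_def by (rule comp) simp
    have sub: "{\<theta> \<in> tbox. cmod (1 - \<zeta> * F \<theta>) \<le> \<delta>} \<subseteq> (\<Union>\<alpha>\<in>A. S \<alpha>)"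
    proof
      fix \<theta> assume t: "\<theta> \<in> {\<theta> \<in> tbox. cmod (1 - \<zeta> * F \<theta>) \<le> \<delta>}"
      have "1 - cmod (\<zeta> * F \<theta>) \<le> \<delta>" using t norm_triangle_ineq2[of 1 "\<zeta> * F \<theta>"] by simp
      moreover have "cmod (\<zeta> * F \<theta>) \<le> cmod (F \<theta>)" using \<zeta> by (simp add: norm_mult mult_left_le_one_le)
      ultimately have "\<not> cmod (F \<theta>) \<le> 1 - \<kappa>" using False by linarith
      then have "\<theta> \<notin> R" using \<kappa>(2) by blast
      then obtain \<alpha> where "\<alpha> \<in> A" "\<theta> \<in> ball \<alpha> (fst (P \<alpha>))" using t unfolding R_def by blast
      then show "\<theta> \<in> (\<Union>\<alpha>\<in>A. S \<alpha>)" using t unfolding S_def by force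
    qed
    have mS: "measure lebesgue (S \<alpha>) \<le> 4 * (snd (P \<alpha>) * sqrt (snd (P \<alpha>))) * (\<delta> * sqrt \<delta>)" if "\<alpha> \<in> A" for \<alpha>
    proof -
      have \<alpha>: "\<alpha> \<in> E" using that A by blast
      have nn: "(norm (x - y))\<^sup>2 \<le> snd (P \<alpha>) * \<delta>" "snd x = snd y \<longrightarrow> \<bar>fst x - fst y\<bar> \<le> snd (P \<alpha>) * \<delta>"
        if "x \<in> S \<alpha>" "y \<in> S \<alpha>" for x y
        using key[OF \<alpha> \<zeta> \<delta>, of x y] that unfolding S_def by auto
      \<comment> \<open>Width of order \<open>\<delta>\<close> along horizontal lines and height of
        order \<open>sqrt \<delta>\<close>: this is the origin of the exponent 3/2.\<close>
      have "measure lebesgue (S \<alpha>) \<le> 4 * (snd (P \<alpha>) * \<delta>) * sqrt (snd (P \<alpha>) * \<delta>)"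
      proof (rule measure_thin_set_le)
        show "S \<alpha> \<in> sets borel" using cS[of \<alpha>] by (simp add: borel_compact)
        show "0 \<le> snd (P \<alpha>) * \<delta>" "0 \<le> sqrt (snd (P \<alpha>) * \<delta>)" using P(2)[OF \<alpha>] \<delta> by auto
        fix x y assume xy: "x \<in> S \<alpha>" "y \<in> S \<alpha>"
        show "\<bar>fst x - fst y\<bar> \<le> snd (P \<alpha>) * \<delta>" if "snd x = snd y" using nn[OF xy] that by blast
        have "\<bar>snd x - snd y\<bar> \<le> norm (x - y)" using abs_snd_le_norm[of "x - y"] by simp
        also have "\<dots> \<le> sqrt (snd (P \<alpha>) * \<delta>)" using nn(1)[OF xy] by (rule real_le_rsqrt)
        finally show "\<bar>snd x - snd y\<bar> \<le> sqrt (snd (P \<alpha>) * \<delta>)" .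
      qed
      then show ?thesis by (simp add: real_sqrt_mult mult_ac)
    qed
    have "measure lebesgue {\<theta> \<in> tbox. cmod (1 - \<zeta> * F \<theta>) \<le> \<delta>} \<le> measure lebesgue (\<Union>\<alpha>\<in>A. S \<alpha>)"
    proof (rule measure_mono_fmeasurable[OF sub])
      show "{\<theta> \<in> tbox. cmod (1 - \<zeta> * F \<theta>) \<le> \<delta>} \<in> sets lebesgue"
        using comp[of UNIV \<zeta> \<delta>] by (auto intro!: lmeasurable_compact fmeasurableD)
      show "(\<Union>\<alpha>\<in>A. S \<alpha>) \<in> lmeasurable" using cS A(2) by (intro lmeasurable_compact compact_UN) auto
    qed
    also have "\<dots> \<le> (\<Sum>\<alpha>\<in>A. measure lebesgue (S \<alpha>))"
      using A(2) cS by (intro measure_UNION_le) (auto intro: lmeasurable_compact fmeasurableD)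
    also have "\<dots> \<le> (\<Sum>\<alpha>\<in>A. 4 * (snd (P \<alpha>) * sqrt (snd (P \<alpha>))) * (\<delta> * sqrt \<delta>))"
      by (intro sum_mono mS)
    also have "\<dots> = K1 * (\<delta> * sqrt \<delta>)" unfolding K1_def by (simp add: sum_distrib_right)
    also have "\<dots> \<le> K * (\<delta> * sqrt \<delta>)" using K \<delta> by (intro mult_right_mono) auto
    finally show ?thesis .
  qed
  with K(1) that show thesis by blast
qed

text \<open>A discrete layer-cake estimate: the highest level reached by \<open>k\<close>
  contributes a term that dominates \<open>k\<close>. Base 4 is chosen so that the square root in
  the measure bound becomes a power of 2.\<close>

lemma dyadic_majorant:
  fixes k T :: real
  assumes "0 < T" "k \<le> T * 4 ^ J"
  shows "k \<le> T + (\<Sum>j<J. T * 4 ^ Suc j * (if T * 4 ^ j \<le> k then 1 else 0))"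
  using assms(2)
proof (induction J)
  case (Suc J)
  have nn: "0 \<le> (\<Sum>j<J. T * 4 ^ Suc j * (if T * 4 ^ j \<le> k then 1 else 0))"
    using assms(1) by (intro sum_nonneg) auto
  show ?case
  proof (cases "k \<le> T * 4 ^ J")
    case True
    from Suc.IH[OF this] show ?thesis using assms(1) by (auto intro: order_trans)
  next
    case False
    then show ?thesis using Suc.prems nn assms(1) by simp
  qed
qed simp

text \<open>Cutting the kernel at height \<open>T\<close> leaves at most
  \<open>T * integral tbox v\<close>. The level \<open>T * 4 ^ j\<close> has measure at most
  \<open>K * (T * 4 ^ j) powr (-3/2)\<close>, so its dyadic term is at most
  \<open>4 * K / sqrt T * (1 / 2) ^ j\<close>, and the geometric series doubles the leading
  term.\<close>

lemma kernel_integral_le: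
  fixes F :: "real \<times> real \<Rightarrow> complex"
  assumes F: "continuous_on UNIV F" and le1: "\<And>\<theta>. cmod (F \<theta>) \<le> 1" and K0: "0 < K"
    and K: "\<And>\<zeta> \<delta>. cmod \<zeta> \<le> 1 \<Longrightarrow> 0 < \<delta> \<Longrightarrow> measure lebesgue {\<theta> \<in> tbox. cmod (1 - \<zeta> * F \<theta>) \<le> \<delta>} \<le> K * (\<delta> * sqrt \<delta>)"
    and v: "continuous_on tbox v" "\<And>\<theta>. \<theta> \<in> tbox \<Longrightarrow> 0 \<le> v \<theta>" "\<And>\<theta>. \<theta> \<in> tbox \<Longrightarrow> v \<theta> \<le> 1"
    and \<zeta>: "cmod \<zeta> < 1" and T: "0 < T"
  shows "integral tbox (\<lambda>\<theta>. v \<theta> / cmod (1 - \<zeta> * F \<theta>)) \<le> T * integral tbox v + 8 * K / sqrt T"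
proof -
  have ge: "1 - cmod \<zeta> \<le> cmod (1 - \<zeta> * F \<theta>)" for \<theta>
  proof -
    have "cmod (\<zeta> * F \<theta>) \<le> cmod \<zeta> * 1" unfolding norm_mult using le1 by (intro mult_left_mono) auto
    then show ?thesis using norm_triangle_ineq2[of 1 "\<zeta> * F \<theta>"] by simp
  qed
  then have pos: "0 < cmod (1 - \<zeta> * F \<theta>)" for \<theta> using \<zeta> by (meson diff_gt_0_iff_gt less_le_trans)
  have "\<exists>J. X < T * 4 ^ J" for X
    using real_arch_pow[of 4 "X / T"] T by (auto simp: pos_divide_less_eq mult.commute)
  \<comment> \<open>The number of levels depends on \<zeta>, but the series converges and the final
    bound does not see it.\<close>
  then obtain J where J: "1 / (1 - cmod \<zeta>) < T * 4 ^ J" by blast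
  define A where "A = (\<lambda>j::nat. {\<theta> \<in> tbox. cmod (1 - \<zeta> * F \<theta>) \<le> 1 / (T * 4 ^ j)})"
  have Tj: "0 < T * 4 ^ j" for j using T by simp
  have mA: "measure lebesgue (A j) \<le> K * (1 / (T * 4 ^ j) * sqrt (1 / (T * 4 ^ j)))" for j
    unfolding A_def using \<zeta> Tj by (intro K) auto
  have cA: "compact (A j)" for j
    unfolding A_def by (intro compact_tbox_sublevel(1) continuous_intros F)
  have iA: "(indicat_real (A j) has_integral measure lebesgue (A j)) tbox" for j
    by (rule indicator_has_integral_tbox[OF cA]) (auto simp: A_def)
  have vi: "(v has_integral integral tbox v) tbox"
    using integrable_continuous[OF v(1)] by (rule integrable_integral)
  have sumi: "((\<lambda>\<theta>. T * v \<theta> + (\<Sum>j<J. T * 4 ^ Suc j * indicat_real (A j) \<theta>)) has_integral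
     (T * integral tbox v + (\<Sum>j<J. T * 4 ^ Suc j * measure lebesgue (A j)))) tbox"
    by (intro has_integral_add has_integral_mult_right has_integral_sum vi iA) auto
  have "integral tbox (\<lambda>\<theta>. v \<theta> / cmod (1 - \<zeta> * F \<theta>)) \<le> T * integral tbox v + (\<Sum>j<J. T * 4 ^ Suc j * measure lebesgue (A j))"
  proof (rule has_integral_le[OF integrable_integral sumi])
    show "(\<lambda>\<theta>. v \<theta> / cmod (1 - \<zeta> * F \<theta>)) integrable_on tbox"
      using pos by (intro integrable_continuous continuous_intros v(1) continuous_on_subset[OF F]) (auto simp: less_le)
    fix \<theta> assume t: "\<theta> \<in> tbox"
    define k where "k = 1 / cmod (1 - \<zeta> * F \<theta>)"
    have "k \<le> 1 / (1 - cmod \<zeta>)" unfolding k_def using ge[of \<theta>] \<zeta> by (intro divide_left_mono) (auto intro!: mult_pos_pos pos)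
    also have "\<dots> \<le> T * 4 ^ J" using J by simp
    finally have "k \<le> T + (\<Sum>j<J. T * 4 ^ Suc j * (if T * 4 ^ j \<le> k then 1 else 0))"
      by (rule dyadic_majorant[OF T])
    also have "(\<Sum>j<J. T * 4 ^ Suc j * (if T * 4 ^ j \<le> k then 1 else 0)) = (\<Sum>j<J. T * 4 ^ Suc j * indicat_real (A j) \<theta>)"
    proof (intro sum.cong refl arg_cong2[of _ _ _ _ "(*)"])
      fix j
      have "T * 4 ^ j \<le> k \<longleftrightarrow> \<theta> \<in> A j" unfolding k_def A_def using t pos[of \<theta>] Tj[of j] by (simp add: field_simps)
      then show "(if T * 4 ^ j \<le> k then 1 else 0) = indicat_real (A j) \<theta>" by (simp add: indicator_def)
    qed
    finally have kb: "k \<le> T + (\<Sum>j<J. T * 4 ^ Suc j * indicat_real (A j) \<theta>)" .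
    have nn: "0 \<le> (\<Sum>j<J. T * 4 ^ Suc j * indicat_real (A j) \<theta>)" using T by (intro sum_nonneg) auto
    have "v \<theta> / cmod (1 - \<zeta> * F \<theta>) = v \<theta> * k" by (simp add: k_def)
    also have "\<dots> \<le> v \<theta> * (T + (\<Sum>j<J. T * 4 ^ Suc j * indicat_real (A j) \<theta>))"
      using kb v(2)[OF t] by (rule mult_left_mono)
    also have "\<dots> \<le> T * v \<theta> + (\<Sum>j<J. T * 4 ^ Suc j * indicat_real (A j) \<theta>)"
      using mult_right_mono[OF v(3)[OF t] nn] by (simp add: algebra_simps)
    finally show "v \<theta> / cmod (1 - \<zeta> * F \<theta>) \<le> T * v \<theta> + (\<Sum>j<J. T * 4 ^ Suc j * indicat_real (A j) \<theta>)" .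
  qed
  also have "(\<Sum>j<J. T * 4 ^ Suc j * measure lebesgue (A j)) \<le> (\<Sum>j<J. 4 * K / sqrt T * (1 / 2) ^ j)"
  proof (rule sum_mono)
    fix j
    have s: "sqrt (4 ^ j) = 2 ^ j" by (simp add: real_sqrt_power)
    have "T * 4 ^ Suc j * measure lebesgue (A j) \<le> T * 4 ^ Suc j * (K * (1 / (T * 4 ^ j) * sqrt (1 / (T * 4 ^ j))))"
      using mA T by (intro mult_left_mono) auto
    also have "\<dots> = 4 * K / sqrt T * (1 / 2) ^ j"
      using T by (simp add: real_sqrt_divide real_sqrt_mult s power_divide)
    finally show "T * 4 ^ Suc j * measure lebesgue (A j) \<le> 4 * K / sqrt T * (1 / 2) ^ j" .
  qed
  also have "\<dots> = 4 * K / sqrt T * (\<Sum>j<J. (1 / 2) ^ j)" by (simp add: sum_distrib_left)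
  also have "\<dots> \<le> 4 * K / sqrt T * 2"
  proof (rule mult_left_mono)
    have "(\<Sum>j<J. (1 / 2 :: real) ^ j) = (1 - (1 / 2) ^ J) / (1 - 1 / 2)" by (subst sum_gp_strict) simp
    also have "\<dots> \<le> 2" by simp
    finally show "(\<Sum>j<J. (1 / 2 :: real) ^ j) \<le> 2" .
  qed (use K0 T in auto)
  finally show ?thesis by simp
qed

text \<open>A set close to the circle in modulus is split according to the argument into about
  \<open>1 / \<tau>\<close> level sets, each of measure of order
  \<open>\<tau> * sqrt \<tau>\<close>; the total is still small.\<close>

lemma near_contact_measure_le:
  fixes F :: "real \<times> real \<Rightarrow> complex"
  assumes F: "continuous_on UNIV F" and le1: "\<And>\<theta>. cmod (F \<theta>) \<le> 1" and K0: "0 < K"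
    and K: "\<And>\<zeta> \<delta>. cmod \<zeta> \<le> 1 \<Longrightarrow> 0 < \<delta> \<Longrightarrow> measure lebesgue {\<theta> \<in> tbox. cmod (1 - \<zeta> * F \<theta>) \<le> \<delta>} \<le> K * (\<delta> * sqrt \<delta>)"
    and \<tau>: "0 < \<tau>" "\<tau> \<le> 1"
  shows "measure lebesgue {\<theta> \<in> tbox. 1 - \<tau> \<le> cmod (F \<theta>)} \<le> 40 * K * sqrt \<tau>"
proof -
  define N where "N = nat \<lceil>2 * pi / \<tau>\<rceil>"
  have N: "2 * pi / \<tau> \<le> real N" "real N \<le> 2 * pi / \<tau> + 1"
  proof -
    define X where "X = 2 * pi / \<tau>"
    have "0 < X" using \<tau> by (simp add: X_def)
    then have "real (nat \<lceil>X\<rceil>) = of_int \<lceil>X\<rceil>" by (intro of_nat_nat) linarith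
    then show "2 * pi / \<tau> \<le> real N" "real N \<le> 2 * pi / \<tau> + 1"
      unfolding N_def X_def[symmetric] by linarith+
  qed
  then have Npos: "0 < real N" using \<tau> by (meson divide_pos_pos less_le_trans mult_pos_pos pi_gt_zero zero_less_numeral)
  \<comment> \<open>A value of modulus at least \<open>1 - \<tau>\<close> has its argument within
    \<open>\<tau>\<close> of a multiple of \<open>2 * pi / N\<close>, so one of these rotations
    brings it to within \<open>2 * \<tau>\<close> of 1.\<close>
  define z where "z = (\<lambda>k::nat. cis (- (2 * pi * real k / real N)))"
  define S where "S = (\<lambda>k. {\<theta> \<in> tbox. cmod (1 - z k * F \<theta>) \<le> 2 * \<tau>})"
  have cS: "compact (S k)" for k unfolding S_def by (intro compact_tbox_sublevel(1) continuous_intros F)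
  have cL: "compact {\<theta> \<in> tbox. 1 - \<tau> \<le> cmod (F \<theta>)}"
    by (intro compact_tbox_sublevel(2) continuous_intros F)
  have sub: "{\<theta> \<in> tbox. 1 - \<tau> \<le> cmod (F \<theta>)} \<subseteq> (\<Union>k<N. S k)"
  proof
    fix \<theta> assume t: "\<theta> \<in> {\<theta> \<in> tbox. 1 - \<tau> \<le> cmod (F \<theta>)}"
    define \<beta> where "\<beta> = Arg2pi (F \<theta>)"
    have \<beta>: "0 \<le> \<beta>" "\<beta> < 2 * pi" using Arg2pi unfolding \<beta>_def by auto
    have Feq: "F \<theta> = of_real (cmod (F \<theta>)) * cis \<beta>" unfolding \<beta>_def cis_conv_exp using Arg2pi_eq[of "F \<theta>"] by simp
    define x where "x = \<beta> * real N / (2 * pi)"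
    define k where "k = nat \<lfloor>x\<rfloor>"
    have x0: "0 \<le> x" using \<beta> by (simp add: x_def)
    have "real k = of_int \<lfloor>x\<rfloor>" unfolding k_def using x0 by (intro of_nat_nat) simp
    then have k: "real k \<le> x" "x < real k + 1" by linarith+
    have "x < real N" using \<beta> Npos unfolding x_def by (simp add: field_simps)
    then have kN: "k < N" using k by linarith
    have be: "\<beta> = 2 * pi * x / real N" using Npos by (simp add: x_def)
    have "\<bar>\<beta> - 2 * pi * real k / real N\<bar> = 2 * pi / real N * (x - real k)"
      unfolding be using k Npos by (simp add: field_simps abs_if)
    also have "\<dots> \<le> 2 * pi / real N * 1" using k Npos by (intro mult_left_mono) auto
    also have "\<dots> \<le> \<tau>" using N(1) Npos \<tau> by (simp add: field_simps)
    finally have ang: "\<bar>\<beta> - 2 * pi * real k / real N\<bar> \<le> \<tau>" .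
    have c: "z k * F \<theta> = of_real (cmod (F \<theta>)) * cis (\<beta> - 2 * pi * real k / real N)"
      by (subst Feq) (simp add: z_def cis_mult)
    have "cmod (1 - cis s) \<le> \<bar>s\<bar>" for s
    proof -
      have "cmod (cis s - 1) \<le> \<bar>s\<bar>"
        using dist_exp_i_1[of s] abs_sin_x_le_abs_x[of "s / 2"] by (simp add: cis_conv_exp)
      then show ?thesis by (simp add: norm_minus_commute)
    qed
    then have 1: "cmod (1 - cis (\<beta> - 2 * pi * real k / real N)) \<le> \<tau>" using ang order_trans by blast
    have "cmod (cis (\<beta> - 2 * pi * real k / real N) - z k * F \<theta>) = \<bar>1 - cmod (F \<theta>)\<bar>"
    proof -
      have "cis (\<beta> - 2 * pi * real k / real N) - z k * F \<theta> = of_real (1 - cmod (F \<theta>)) * cis (\<beta> - 2 * pi * real k / real N)"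
        unfolding c by (simp add: algebra_simps)
      then show ?thesis by (simp only: norm_mult norm_of_real norm_cis) simp
    qed
    also have "\<dots> \<le> \<tau>" using t le1[of \<theta>] by simp
    finally have "cmod (1 - z k * F \<theta>) \<le> 2 * \<tau>"
      using norm_triangle_ineq[of "1 - cis (\<beta> - 2 * pi * real k / real N)" "cis (\<beta> - 2 * pi * real k / real N) - z k * F \<theta>"] 1 by simp
    then show "\<theta> \<in> (\<Union>k<N. S k)" using t kN unfolding S_def by auto
  qed
  have "measure lebesgue {\<theta> \<in> tbox. 1 - \<tau> \<le> cmod (F \<theta>)} \<le> measure lebesgue (\<Union>k<N. S k)"
    using cS cL by (intro measure_mono_fmeasurable[OF sub] fmeasurableD lmeasurable_compact compact_UN) auto
  also have "\<dots> \<le> (\<Sum>k<N. measure lebesgue (S k))"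
    using cS by (intro measure_UNION_le) (auto intro: lmeasurable_compact fmeasurableD)
  also have "\<dots> \<le> (\<Sum>k<N. K * (2 * \<tau> * sqrt (2 * \<tau>)))"
    unfolding S_def z_def using \<tau> by (intro sum_mono K) auto
  also have "\<dots> = real N * (K * (2 * \<tau> * sqrt (2 * \<tau>)))" by simp
  \<comment> \<open>The mesh requires at most \<open>2 * pi / \<tau> + 1\<close> rotations;
    \<open>2 * pi\<close> is below 7, and 1 is at most \<open>1 / \<tau>\<close>.\<close>
  also have "\<dots> \<le> (8 / \<tau>) * (K * (2 * \<tau> * sqrt (2 * \<tau>)))"
  proof (rule mult_right_mono)
    have "2 * pi / \<tau> + 1 \<le> 7 / \<tau> + 1 / \<tau>"
      using \<tau> pi_less_4 pi_approx(2) by (intro add_mono divide_right_mono) (auto simp: field_simps)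
    then show "real N \<le> 8 / \<tau>" using N(2) by (simp add: add_divide_distrib[symmetric])
  qed (use K0 \<tau> in auto)
  also have "\<dots> = 16 * K * sqrt 2 * sqrt \<tau>" using \<tau> by (simp add: real_sqrt_mult)
  also have "\<dots> \<le> 40 * K * sqrt \<tau>"
  proof (rule mult_right_mono)
    have "sqrt 2 \<le> 2" by (rule real_le_lsqrt) auto
    then have "16 * sqrt 2 \<le> 40" by simp
    then show "16 * K * sqrt 2 \<le> 40 * K" using mult_right_mono[of "16 * sqrt 2" 40 K] K0 by (simp add: mult_ac)
  qed (use \<tau> in auto)
  finally show ?thesis .
qed


subsection \<open>Boundary calculus of smooth symbols\<close>

text \<open>Needed since \<open>dz1\<close> and \<open>dz2\<close> take derivatives within the
  closed bidisc at a boundary point. Convexity makes every segment from \<open>z\<close> to a point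
  of the bidisc admissible, and the directions so obtained span the whole space.\<close>

lemma has_derivative_unique_within_cbidisc:
  fixes f :: "complex \<times> complex \<Rightarrow> complex"
  assumes D: "(f has_derivative D) (at z within cbidisc)" and E: "(f has_derivative E) (at z within cbidisc)"
    and z: "z \<in> cbidisc"
  shows "D = E"
proof -
  have lD: "linear D" "linear E" using D E has_derivative_linear by auto
  have conv: "convex cbidisc" unfolding cbidisc_def by (intro convex_Times) auto
  have dir: "D (w - z) = E (w - z)" if w: "w \<in> cbidisc" for w
  proof -
    let ?c = "\<lambda>t::real. z + t *\<^sub>R (w - z)"
    have sub: "?c ` {0..1} \<subseteq> cbidisc"
    proof
      fix x assume "x \<in> ?c ` {0..1}"
      then obtain t where t: "t \<in> {0..1}" "x = ?c t" by auto
      have "x = (1 - t) *\<^sub>R z + t *\<^sub>R w" unfolding t(2) by (simp add: algebra_simps)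
      then show "x \<in> cbidisc" using convexD[OF conv z w, of "1 - t" t] t by simp
    qed
    have c: "(?c has_derivative (\<lambda>t. t *\<^sub>R (w - z))) (at 0 within {0..1})" by (auto intro!: derivative_eq_intros)
    have vd: "((f \<circ> ?c) has_vector_derivative X (w - z)) (at 0 within {0..1})"
      if X: "(f has_derivative X) (at z within cbidisc)" for X
    proof -
      have "(f has_derivative X) (at (?c 0) within ?c ` {0..1})"
        using has_derivative_subset[OF X sub] by simp
      from diff_chain_within[OF c this] have "((f \<circ> ?c) has_derivative (\<lambda>t. X (t *\<^sub>R (w - z)))) (at 0 within {0..1})"
        by (simp add: o_def)
      then show ?thesis unfolding has_vector_derivative_def
        using linear_scale[OF has_derivative_linear[OF X]] by simp
    qed
    have z1: "(0::real) < 1" "(0::real) \<in> cbox 0 1" by auto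
    show ?thesis
      by (rule vector_derivative_unique_within_closed_interval[OF z1]) (use vd[OF D] vd[OF E] in \<open>auto simp: cbox_interval\<close>)
  qed
  have d0: "D z = E z"
    using dir[of 0] linear_diff[OF lD(1), of 0 z] linear_diff[OF lD(2), of 0 z] linear_0[OF lD(1)] linear_0[OF lD(2)]
    by (simp add: cbidisc_def zero_prod_def)
  have dw: "D w = E w" if "w \<in> cbidisc" for w
    using dir[OF that] d0 linear_diff[OF lD(1), of w z] linear_diff[OF lD(2), of w z] by simp
  show ?thesis
  proof
    fix v :: "complex \<times> complex"
    \<comment> \<open>Every vector becomes a point of the closed bidisc after multiplication by this
      positive factor, so agreement on the bidisc is agreement everywhere.\<close>
    define r where "r = 1 / (1 + norm v)"
    have np: "0 < 1 + norm v" by (simp add: add_pos_nonneg)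
    have r: "0 < r" using np by (simp add: r_def)
    have "norm (fst v) \<le> norm v" "norm (snd v) \<le> norm v"
      by (metis norm_fst_le prod.collapse) (metis norm_snd_le prod.collapse)
    then have "r *\<^sub>R v \<in> cbidisc"
      using np by (cases v) (auto simp: cbidisc_def r_def field_simps)
    from dw[OF this] have "r *\<^sub>R D v = r *\<^sub>R E v" using lD by (simp add: linear_scale)
    then show "D v = E v" using r by simp
  qed
qed

text \<open>\<open>p\<close> is the \<open>C\<^sup>3\<close> extension of \<open>f\<close> to a neighbourhood \<open>U\<close> of the closed bidisc.\<close>

locale smooth_symbol =
  fixes f p :: "complex \<times> complex \<Rightarrow> complex" and U :: "(complex \<times> complex) set"
  assumes openU: "open U" and subU: "cbidisc \<subseteq> U" and Ckp: "Ck_open 3 U p"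
    and pf: "\<And>z. z \<in> cbidisc \<Longrightarrow> p z = f z"
    and holo: "holo2_on bidisc f" and lt1: "\<And>z. z \<in> bidisc \<Longrightarrow> cmod (f z) < 1"
begin

abbreviation "Dp z \<equiv> frechet_derivative p (at z)"

abbreviation "F \<equiv> \<lambda>\<theta>. f (tor \<theta>)"

lemma Ck1: "Ck_open (Suc 0) U p"
  using Ck_open_le[OF _ Ckp, of "Suc 0"] by simp

lemma deriv_p: "z \<in> U \<Longrightarrow> (p has_derivative Dp z) (at z)"
  using Ck_open_SucD(1)[OF Ck1] .

lemma linear_Dp: "z \<in> U \<Longrightarrow> linear (Dp z)"
  using deriv_p has_derivative_linear by blast

lemma cont_Dp: "continuous_on U (\<lambda>z. Dp z v)"
  using Ck_open_SucD(2)[OF Ck1] by simp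

lemma cont_f: "continuous_on cbidisc f"
  using continuous_on_subset[OF Ck_open_imp_continuous_on[OF Ckp] subU] pf continuous_on_cong[of cbidisc cbidisc p f] by simp

lemma dilation_tendsto:
  "(\<lambda>n. (1 - 1 / (real n + 2)) *\<^sub>R (z :: complex \<times> complex)) \<longlonglongrightarrow> z"
proof -
  have "(\<lambda>n. 1 - 1 / (real n + 2)) \<longlonglongrightarrow> 1" by real_asymp
  from tendsto_scaleR[OF this tendsto_const[of z]] show ?thesis by simp
qed

lemma dilation_in_bidisc: "z \<in> cbidisc \<Longrightarrow> (1 - 1 / (real n + 2)) *\<^sub>R z \<in> bidisc"
  by (rule scaleR_in_bidisc) (auto simp: field_simps)

lemma le1: assumes z: "z \<in> cbidisc" shows "cmod (f z) \<le> 1"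
proof -
  have "(\<lambda>n. f ((1 - 1 / (real n + 2)) *\<^sub>R z)) \<longlonglongrightarrow> f z"
    by (rule continuous_on_tendsto_compose[OF cont_f dilation_tendsto z])
      (intro always_eventually allI subsetD[OF bidisc_subset_cbidisc dilation_in_bidisc[OF z]])
  from tendsto_norm[OF this] show ?thesis
    by (rule tendsto_upperbound[OF _ always_eventually trivial_limit_sequentially])
      (intro allI less_imp_le[OF lt1[OF dilation_in_bidisc[OF z]]])
qed

text \<open>The Cauchy-Riemann equations hold inside, where \<open>p\<close> agrees with
  \<open>f\<close>, and extend to the boundary by continuity of the derivative of
  \<open>p\<close>.\<close>

lemma complex_linear_Dp:
  assumes z: "z \<in> cbidisc" shows "Dp z (\<i> * a, \<i> * b) = \<i> * Dp z (a, b)"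
proof -
  have inside: "Dp w (\<i> * a, \<i> * b) = \<i> * Dp w (a, b)" if w: "w \<in> bidisc" for w
  proof -
    obtain c d where "(f has_derivative (\<lambda>h. c * fst h + d * snd h)) (at w)"
      using holo w unfolding holo2_on_def by blast
    then have "(p has_derivative (\<lambda>h. c * fst h + d * snd h)) (at w)"
      by (rule has_derivative_transform_within_open[OF _ open_bidisc w]) (use pf bidisc_subset_cbidisc in auto)
    from frechet_derivative_at[OF this] have "Dp w = (\<lambda>h. c * fst h + d * snd h)" by simp
    then show ?thesis by (simp add: algebra_simps)
  qed
  let ?r = "\<lambda>n. (1 - 1 / (real n + 2)) *\<^sub>R z"
  have zU: "z \<in> U" using z subU by blast
  have ev: "eventually (\<lambda>n. ?r n \<in> U) sequentially"
    by (intro always_eventually allI subsetD[OF subU subsetD[OF bidisc_subset_cbidisc dilation_in_bidisc[OF z]]])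
  have 1: "(\<lambda>n. Dp (?r n) (\<i> * a, \<i> * b)) \<longlonglongrightarrow> Dp z (\<i> * a, \<i> * b)"
    by (rule continuous_on_tendsto_compose[OF cont_Dp dilation_tendsto zU ev])
  have "(\<lambda>n. \<i> * Dp (?r n) (a, b)) \<longlonglongrightarrow> \<i> * Dp z (a, b)"
    by (intro tendsto_mult_left continuous_on_tendsto_compose[OF cont_Dp dilation_tendsto zU ev])
  then have "(\<lambda>n. Dp (?r n) (\<i> * a, \<i> * b)) \<longlonglongrightarrow> \<i> * Dp z (a, b)"
    by (simp only: inside[OF dilation_in_bidisc[OF z]])
  from LIMSEQ_unique[OF 1 this] show ?thesis .
qed

lemma complex_linear_Dp':
  assumes z: "z \<in> cbidisc" shows "Dp z (c * a, c * b) = c * Dp z (a, b)"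
proof -
  have l: "linear (Dp z)" using linear_Dp z subU by blast
  have "(c * a, c * b) = Re c *\<^sub>R (a, b) + Im c *\<^sub>R (\<i> * a, \<i> * b)"
    by (auto simp: complex_eq_iff)
  then have "Dp z (c * a, c * b) = Re c *\<^sub>R Dp z (a, b) + Im c *\<^sub>R (\<i> * Dp z (a, b))"
    using l by (simp only: linear_add linear_scale complex_linear_Dp[OF z])
  also have "\<dots> = c * Dp z (a, b)" by (auto simp: complex_eq_iff)
  finally show ?thesis .
qed

lemma torus2_rotate: "\<xi> \<in> torus2 \<Longrightarrow> z \<in> cbidisc \<Longrightarrow> (fst \<xi> * fst z, snd \<xi> * snd z) \<in> cbidisc"
  by (auto simp: torus2_def cbidisc_def norm_mult)

lemma phi_tilde_derivative:
  assumes \<xi>: "\<xi> \<in> torus2" and z: "z \<in> cbidisc"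
  shows "(phi_tilde f \<xi> has_derivative (\<lambda>h. cnj (f \<xi>) * Dp (fst \<xi> * fst z, snd \<xi> * snd z) (fst \<xi> * fst h, snd \<xi> * snd h))) (at z within cbidisc)"
proof -
  let ?R = "\<lambda>z. (fst \<xi> * fst z, snd \<xi> * snd z)"
  have R: "(?R has_derivative ?R) (at z)" by (auto intro!: derivative_eq_intros)
  have "?R z \<in> U" using torus2_rotate[OF \<xi> z] subU by blast
  from diff_chain_at[OF R deriv_p[OF this]]
  have "((\<lambda>z. p (?R z)) has_derivative (\<lambda>h. Dp (?R z) (?R h))) (at z)" by (simp add: o_def)
  from has_derivative_at_withinI[OF has_derivative_mult_right[OF this, of "cnj (f \<xi>)"], of cbidisc]
  show ?thesis
    by (rule has_derivative_transform[OF z, rotated]) (simp add: phi_tilde_def pf[OF torus2_rotate[OF \<xi>]])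
qed

lemma one_one_in_cbidisc: "(1, 1) \<in> cbidisc" by (simp add: cbidisc_def)

lemma frechet_phi_tilde:
  assumes \<xi>: "\<xi> \<in> torus2"
  shows "frechet_derivative (phi_tilde f \<xi>) (at (1, 1) within cbidisc) h = cnj (f \<xi>) * Dp \<xi> (fst \<xi> * fst h, snd \<xi> * snd h)"
proof -
  note d = phi_tilde_derivative[OF \<xi> one_one_in_cbidisc]
  then have "(phi_tilde f \<xi> has_derivative frechet_derivative (phi_tilde f \<xi>) (at (1, 1) within cbidisc)) (at (1, 1) within cbidisc)"
    using frechet_derivative_works differentiable_def by blast
  from has_derivative_unique_within_cbidisc[OF this d one_one_in_cbidisc] show ?thesis by simp
qed

text \<open>Complex linearity makes the two terms of the Wirtinger derivative equal, so their
  average is the complex partial derivative of the extension.\<close>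

lemma dz1_phi_tilde:
  assumes \<xi>: "\<xi> \<in> torus2"
  shows "dz1 (phi_tilde f \<xi>) (1, 1) = cnj (f \<xi>) * Dp \<xi> (fst \<xi>, 0)"
proof -
  have "\<xi> \<in> cbidisc" using \<xi> torus2_subset_cbidisc by blast
  from complex_linear_Dp[OF this, of "fst \<xi>" 0] have "Dp \<xi> (fst \<xi> * \<i>, 0) = \<i> * Dp \<xi> (fst \<xi>, 0)" by (simp add: mult.commute)
  then show ?thesis unfolding dz1_def frechet_phi_tilde[OF \<xi>] by (simp add: mult.left_commute)
qed

lemma dz2_phi_tilde:
  assumes \<xi>: "\<xi> \<in> torus2"
  shows "dz2 (phi_tilde f \<xi>) (1, 1) = cnj (f \<xi>) * Dp \<xi> (0, snd \<xi>)"
proof -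
  have "\<xi> \<in> cbidisc" using \<xi> torus2_subset_cbidisc by blast
  from complex_linear_Dp[OF this, of 0 "snd \<xi>"] have "Dp \<xi> (0, snd \<xi> * \<i>) = \<i> * Dp \<xi> (0, snd \<xi>)" by (simp add: mult.commute)
  then show ?thesis unfolding dz2_def frechet_phi_tilde[OF \<xi>] by (simp add: mult.left_commute)
qed

lemma psi_map_tor: "psi_map f (tor \<alpha>) \<theta> = cnj (F \<alpha>) * F (\<alpha> + \<theta>)"
  by (simp add: psi_map_def phi_tilde_def tor_def cis_mult)

lemma Ck_F: "Ck_open 3 UNIV F"
proof -
  have "Ck_open 3 UNIV (\<lambda>\<theta>. p (tor \<theta>))"
    by (rule Ck_open_comp_tor[OF subsetD[OF subU tor_in_cbidisc] Ckp])
  then show ?thesis by (rule Ck_open_cong[OF open_UNIV, rotated]) (simp add: pf tor_in_cbidisc)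
qed

lemma Ck2_F: "Ck_open 2 UNIV F"
  by (rule Ck_open_le[OF _ Ck_F]) simp

lemma cont_F: "continuous_on S F"
  using continuous_on_subset[OF Ck_open_imp_continuous_on[OF Ck_F]] by blast

lemma le1_F: "cmod (F \<theta>) \<le> 1"
  by (rule le1[OF tor_in_cbidisc])

lemma F_has_derivative:
  "(F has_derivative (\<lambda>h. \<i> * (fst h *\<^sub>R Dp (tor \<theta>) (fst (tor \<theta>), 0) + snd h *\<^sub>R Dp (tor \<theta>) (0, snd (tor \<theta>))))) (at \<theta>)"
proof -
  have t: "tor \<theta> \<in> U" "tor \<theta> \<in> cbidisc" by (rule subsetD[OF subU tor_in_cbidisc] tor_in_cbidisc)+
  have "((\<lambda>\<theta>. p (tor \<theta>)) has_derivative (\<lambda>h. Dp (tor \<theta>) (fst h *\<^sub>R (\<i> * cis (fst \<theta>)), snd h *\<^sub>R (\<i> * cis (snd \<theta>))))) (at \<theta>)"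
    using diff_chain_at[OF tor_has_derivative deriv_p[OF t(1)]] by (simp add: o_def)
  moreover have "Dp (tor \<theta>) (fst h *\<^sub>R (\<i> * cis (fst \<theta>)), snd h *\<^sub>R (\<i> * cis (snd \<theta>)))
     = \<i> * (fst h *\<^sub>R Dp (tor \<theta>) (fst (tor \<theta>), 0) + snd h *\<^sub>R Dp (tor \<theta>) (0, snd (tor \<theta>)))" for h
  proof -
    have e: "(fst h *\<^sub>R (\<i> * cis (fst \<theta>)), snd h *\<^sub>R (\<i> * cis (snd \<theta>))) =
       (\<i> * (fst h *\<^sub>R fst (tor \<theta>)), \<i> * (snd h *\<^sub>R snd (tor \<theta>)))" by (simp add: tor_def)
    have e2: "(fst h *\<^sub>R fst (tor \<theta>), snd h *\<^sub>R snd (tor \<theta>)) = fst h *\<^sub>R (fst (tor \<theta>), 0) + snd h *\<^sub>R (0, snd (tor \<theta>))" by simp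
    show ?thesis unfolding e complex_linear_Dp[OF t(2)] e2
      using linear_Dp[OF t(1)] by (simp only: linear_add linear_scale)
  qed
  ultimately show ?thesis by (simp add: pf tor_in_cbidisc)
qed

text \<open>At a contact point \<open>Re (cnj (F \<alpha>) * F _)\<close> attains its maximum 1, so
  it has no first-order term. The derivative of the normalised symbol is therefore purely imaginary,
  and nonvanishing complex partials become nonvanishing partials of
  \<open>Im \<psi>\<close>.\<close>

lemma Re_mult_F_derivative_zero:
  assumes \<alpha>: "cmod (F \<alpha>) = 1"
  shows "Re (cnj (F \<alpha>) * frechet_derivative F (at \<alpha>) h) = 0"
proof -
  note d = F_has_derivative[of \<alpha>]
  then have dF: "(F has_derivative frechet_derivative F (at \<alpha>)) (at \<alpha>)"
    using frechet_derivative_works differentiable_def by blast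
  have "((\<lambda>t::real. \<alpha> + t *\<^sub>R h) has_derivative (\<lambda>t. t *\<^sub>R h)) (at 0)" by (auto intro!: derivative_eq_intros)
  from diff_chain_at[OF this] dF have "((\<lambda>t. F (\<alpha> + t *\<^sub>R h)) has_derivative (\<lambda>t. frechet_derivative F (at \<alpha>) (t *\<^sub>R h))) (at 0)"
    by (simp add: o_def)
  from bounded_linear.has_derivative[OF bounded_linear_Re has_derivative_mult_right[OF this, of "cnj (F \<alpha>)"]]
  have "((\<lambda>t. Re (cnj (F \<alpha>) * F (\<alpha> + t *\<^sub>R h))) has_real_derivative Re (cnj (F \<alpha>) * frechet_derivative F (at \<alpha>) h)) (at 0)"
    unfolding has_field_derivative_def
    by (rule has_derivative_eq_rhs)
      (use linear_scale[OF has_derivative_linear[OF dF]] in \<open>simp add: fun_eq_iff algebra_simps\<close>)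
  then show ?thesis
  proof (rule DERIV_local_max[of _ _ _ 1])
    have u: "cnj (F \<alpha>) * F \<alpha> = 1" using \<alpha> complex_norm_square[of "F \<alpha>"] by (simp add: mult.commute)
    have "Re (cnj (F \<alpha>) * F y) \<le> 1" for y
    proof -
      have "cmod (cnj (F \<alpha>) * F y) \<le> 1" using \<alpha> le1_F[of y] by (simp add: norm_mult)
      then show ?thesis using complex_Re_le_cmod order_trans by blast
    qed
    then show "\<forall>y. \<bar>0 - y\<bar> < 1 \<longrightarrow> Re (cnj (F \<alpha>) * F (\<alpha> + y *\<^sub>R h)) \<le> Re (cnj (F \<alpha>) * F (\<alpha> + 0 *\<^sub>R h))"
      using u by simp
  qed simp
qed

lemma F_derivative_dz:
  "cnj (F \<alpha>) * frechet_derivative F (at \<alpha>) (1, 0) = \<i> * dz1 (phi_tilde f (tor \<alpha>)) (1, 1)"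
  "cnj (F \<alpha>) * frechet_derivative F (at \<alpha>) (0, 1) = \<i> * dz2 (phi_tilde f (tor \<alpha>)) (1, 1)"
  unfolding dz1_phi_tilde[OF tor_in_torus2] dz2_phi_tilde[OF tor_in_torus2] frechet_derivative_at[OF F_has_derivative, symmetric]
  by simp_all

lemma Im_F_derivative_nonzero:
  assumes \<alpha>: "cmod (F \<alpha>) = 1"
  shows "dz1 (phi_tilde f (tor \<alpha>)) (1, 1) \<noteq> 0 \<Longrightarrow> Im (cnj (F \<alpha>) * frechet_derivative F (at \<alpha>) (1, 0)) \<noteq> 0"
    and "dz2 (phi_tilde f (tor \<alpha>)) (1, 1) \<noteq> 0 \<Longrightarrow> Im (cnj (F \<alpha>) * frechet_derivative F (at \<alpha>) (0, 1)) \<noteq> 0"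
  using Re_mult_F_derivative_zero[OF \<alpha>, of "(1,0)"] Re_mult_F_derivative_zero[OF \<alpha>, of "(0,1)"]
  unfolding F_derivative_dz complex_eq_iff by auto

end


subsection \<open>Sufficiency\<close>

lemma holo2_on_compose:
  assumes f: "holo2_on T f" and g: "holo2_on S (\<lambda>z. fst (\<phi> z))" "holo2_on S (\<lambda>z. snd (\<phi> z))"
    and m: "\<And>z. z \<in> S \<Longrightarrow> \<phi> z \<in> T"
  shows "holo2_on S (\<lambda>z. f (\<phi> z))"
  unfolding holo2_on_def
proof
  fix z assume z: "z \<in> S"
  obtain a b where 1: "((\<lambda>z. fst (\<phi> z)) has_derivative (\<lambda>h. a * fst h + b * snd h)) (at z)"
    using g(1) z unfolding holo2_on_def by blast
  obtain c d where 2: "((\<lambda>z. snd (\<phi> z)) has_derivative (\<lambda>h. c * fst h + d * snd h)) (at z)"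
    using g(2) z unfolding holo2_on_def by blast
  obtain k l where 3: "(f has_derivative (\<lambda>h. k * fst h + l * snd h)) (at (\<phi> z))"
    using f m[OF z] unfolding holo2_on_def by blast
  have "(\<phi> has_derivative (\<lambda>h. (a * fst h + b * snd h, c * fst h + d * snd h))) (at z)"
    using has_derivative_Pair[OF 1 2] by simp
  from diff_chain_at[OF this 3]
  have "((\<lambda>z. f (\<phi> z)) has_derivative (\<lambda>h. (k * a + l * c) * fst h + (k * b + l * d) * snd h)) (at z)"
    by (simp add: o_def algebra_simps)
  then show "\<exists>a b. ((\<lambda>z. f (\<phi> z)) has_derivative (\<lambda>h. a * fst h + b * snd h)) (at z)" by blast
qed

lemma holo2_on_cmult: "holo2_on S f \<Longrightarrow> holo2_on S (\<lambda>z. c * f z)"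
  unfolding holo2_on_def
proof
  fix z assume "\<forall>z\<in>S. \<exists>a b. (f has_derivative (\<lambda>h. a * fst h + b * snd h)) (at z)" "z \<in> S"
  then obtain a b where "(f has_derivative (\<lambda>h. a * fst h + b * snd h)) (at z)" by meson
  from has_derivative_mult_right[OF this, of c]
  have "((\<lambda>z. c * f z) has_derivative (\<lambda>h. (c * a) * fst h + (c * b) * snd h)) (at z)"
    by (simp add: algebra_simps)
  then show "\<exists>a b. ((\<lambda>z. c * f z) has_derivative (\<lambda>h. a * fst h + b * snd h)) (at z)" by blast
qed

section \<open>Boundary limits of square means\<close>

lemma tbox_mean_tendsto:
  fixes h :: "real \<Rightarrow> real \<times> real \<Rightarrow> complex"
  assumes h: "continuous_on ({0..1} \<times> tbox) (\<lambda>p. h (fst p) (snd p))"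
  shows "(\<lambda>n. integral tbox (\<lambda>\<theta>. (cmod (h (1 - 1 / (real n + 2)) \<theta>))\<^sup>2)) \<longlonglongrightarrow> integral tbox (\<lambda>\<theta>. (cmod (h 1 \<theta>))\<^sup>2)"
proof -
  have "continuous_on ({0..1} \<times> tbox) (\<lambda>p. (\<lambda>s \<theta>. (cmod (h s \<theta>))\<^sup>2) (fst p) (snd p))"
    by (intro continuous_intros h)
  from continuous_on_integral_right[OF this]
  have c: "continuous_on {0..1} (\<lambda>s. integral tbox (\<lambda>\<theta>. (cmod (h s \<theta>))\<^sup>2))" .
  have "(\<lambda>n. 1 - 1 / (real n + 2)) \<longlonglongrightarrow> 1" by real_asymp
  from continuous_on_tendsto_compose[OF c this] show ?thesis by (auto simp: field_simps)
qed

lemma tbox_mean_ge: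
  fixes h :: "real \<Rightarrow> real \<times> real \<Rightarrow> complex"
  assumes h: "continuous_on ({0..1} \<times> tbox) (\<lambda>p. h (fst p) (snd p))"
    and C: "\<And>s. 0 < s \<Longrightarrow> s < 1 \<Longrightarrow> C \<le> integral tbox (\<lambda>\<theta>. (cmod (h s \<theta>))\<^sup>2)"
  shows "C \<le> integral tbox (\<lambda>\<theta>. (cmod (h 1 \<theta>))\<^sup>2)"
  by (rule tendsto_lowerbound[OF tbox_mean_tendsto[OF h] always_eventually trivial_limit_sequentially])
    (intro allI C; simp add: field_simps)

lemma tbox_mean_le:
  fixes h :: "real \<Rightarrow> real \<times> real \<Rightarrow> complex"
  assumes h: "continuous_on ({0..1} \<times> tbox) (\<lambda>p. h (fst p) (snd p))"
    and C: "\<And>s. 0 < s \<Longrightarrow> s < 1 \<Longrightarrow> integral tbox (\<lambda>\<theta>. (cmod (h s \<theta>))\<^sup>2) \<le> C"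
  shows "integral tbox (\<lambda>\<theta>. (cmod (h 1 \<theta>))\<^sup>2) \<le> C"
  by (rule tendsto_upperbound[OF tbox_mean_tendsto[OF h] always_eventually trivial_limit_sequentially])
    (intro allI C; simp add: field_simps)

lemma H2mean_le_boundary:
  assumes h: "holo2_on bidisc h" and c: "continuous_on cbidisc h" and r: "0 < r" "r < 1"
  shows "H2mean r h \<le> integral tbox (\<lambda>\<theta>. (cmod (h (tor \<theta>)))\<^sup>2) / (4 * pi\<^sup>2)"
proof -
  \<comment> \<open>The truncation \<open>max s r\<close> lets the parameter run over all of
    \<open>{0..1}\<close> while the radius stays in \<open>{r..1}\<close>, where monotonicity makes
    the mean at radius \<open>r\<close> a lower bound.\<close>
  have hc: "continuous_on ({0..1} \<times> tbox) (\<lambda>p. (\<lambda>s \<theta>. h (max s r *\<^sub>R tor \<theta>)) (fst p) (snd p))"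
    by (intro continuous_on_compose2[OF c] continuous_intros)
      (use r in \<open>auto intro!: scaleR_in_cbidisc tor_in_cbidisc simp del: scaleR_Pair\<close>)
  have "H2mean r h * (4 * pi\<^sup>2) \<le> integral tbox (\<lambda>\<theta>. (cmod (h (max 1 r *\<^sub>R tor \<theta>)))\<^sup>2)"
  proof (rule tbox_mean_ge[OF hc])
    fix s :: real assume s: "0 < s" "s < 1"
    have "H2mean r h \<le> H2mean (max s r) h" by (rule H2mean_mono[OF h]) (use s r in auto)
    then have "H2mean r h * (4 * pi\<^sup>2) \<le> H2mean (max s r) h * (4 * pi\<^sup>2)" by (rule mult_right_mono) auto
    then show "H2mean r h * (4 * pi\<^sup>2) \<le> integral tbox (\<lambda>\<theta>. (cmod (h (max s r *\<^sub>R tor \<theta>)))\<^sup>2)"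
      unfolding H2mean_eq[of "max s r"] by simp
  qed
  moreover have "max 1 r = 1" using r by simp
  ultimately show ?thesis by (simp add: field_simps)
qed

context smooth_symbol
begin

lemma level_measure:
  assumes T: "\<And>\<xi>. \<xi> \<in> torus2 \<Longrightarrow> cmod (f \<xi>) = 1 \<Longrightarrow> truly_2d_ord2 f \<xi>"
  obtains K where "0 < K"
    "\<And>\<zeta> \<delta>. cmod \<zeta> \<le> 1 \<Longrightarrow> 0 < \<delta> \<Longrightarrow> measure lebesgue {\<theta> \<in> tbox. cmod (1 - \<zeta> * F \<theta>) \<le> \<delta>} \<le> K * (\<delta> * sqrt \<delta>)"
proof (rule level_set_measure_le[OF cont_F le1_F])
  fix \<alpha> assume "\<alpha> \<in> tbox" and \<alpha>: "cmod (F \<alpha>) = 1"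
  have t: "truly_2d_ord2 f (tor \<alpha>)" by (rule T[OF tor_in_torus2 \<alpha>])
  then have dz: "dz1 (phi_tilde f (tor \<alpha>)) (1, 1) \<noteq> 0"
    by (simp add: truly_2d_ord2_def truly_2d_def)
  obtain a b c where
    e: "(\<lambda>\<theta>. Re (psi_map f (tor \<alpha>) \<theta>) - (1 - (a * (fst \<theta>)\<^sup>2 + b * fst \<theta> * snd \<theta> + c * (snd \<theta>)\<^sup>2))) \<in> o[at 0](\<lambda>\<theta>. (norm \<theta>)\<^sup>2)"
    and pos: "\<And>\<theta>. \<theta> \<noteq> 0 \<Longrightarrow> 0 < a * (fst \<theta>)\<^sup>2 + b * fst \<theta> * snd \<theta> + c * (snd \<theta>)\<^sup>2"
    using t unfolding truly_2d_ord2_def Let_def by blast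
  from level_set_thin_translated[OF Ck2_F le1_F \<alpha> refl pos e[unfolded psi_map_tor] Im_F_derivative_nonzero(1)[OF \<alpha> dz]]
  show "\<exists>\<epsilon> C. 0 < \<epsilon> \<and> 0 < C \<and>
      (\<forall>\<zeta> \<delta> x y. cmod \<zeta> \<le> 1 \<longrightarrow> 0 < \<delta> \<longrightarrow> dist \<alpha> x \<le> \<epsilon> \<longrightarrow> dist \<alpha> y \<le> \<epsilon> \<longrightarrow>
       cmod (1 - \<zeta> * F x) \<le> \<delta> \<longrightarrow> cmod (1 - \<zeta> * F y) \<le> \<delta> \<longrightarrow>
       (norm (x - y))\<^sup>2 \<le> C * \<delta> \<and> (snd x = snd y \<longrightarrow> \<bar>fst x - fst y\<bar> \<le> C * \<delta>))"
    by metis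
qed (rule that)

end

section \<open>Norm estimates for composition with the self-map\<close>

locale smooth_self_map =
  f1: smooth_symbol "\<lambda>z. fst (\<phi> z)" p1 U + f2: smooth_symbol "\<lambda>z. snd (\<phi> z)" p2 U
  for \<phi> :: "complex \<times> complex \<Rightarrow> complex \<times> complex" and p1 p2 U
begin

lemma maps_bidisc: "z \<in> bidisc \<Longrightarrow> \<phi> z \<in> bidisc"
  using f1.lt1 f2.lt1 by (simp add: bidisc_def mem_Times_iff)

lemma maps_cbidisc: "z \<in> cbidisc \<Longrightarrow> \<phi> z \<in> cbidisc"
  using f1.le1 f2.le1 by (simp add: cbidisc_def mem_Times_iff)

lemma cont_\<phi>: "continuous_on cbidisc \<phi>"
  using continuous_on_Pair[OF f1.cont_f f2.cont_f] by simp

lemma cont_\<phi>_tor: "continuous_on S (\<lambda>\<theta>. \<phi> (tor \<theta>))"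
  by (intro continuous_on_compose2[OF cont_\<phi>] continuous_intros) (auto simp: tor_in_cbidisc)

lemma maps_tor: "\<phi> (tor \<theta>) \<in> cbidisc"
  by (rule maps_cbidisc[OF tor_in_cbidisc])

lemma holo2_on_comp: "holo2_on bidisc f \<Longrightarrow> holo2_on bidisc (\<lambda>z. f (\<phi> z))"
  by (rule holo2_on_compose[OF _ f1.holo f2.holo maps_bidisc])

lemma holo2_on_comp_dilated:
  assumes f: "holo2_on bidisc f" and s: "0 \<le> s" "s < 1"
  shows "holo2_on bidisc (\<lambda>z. f (s *\<^sub>R \<phi> z))"
  by (rule holo2_on_compose[OF f])
    (use holo2_on_cmult[OF f1.holo, of "of_real s"] holo2_on_cmult[OF f2.holo, of "of_real s"]
      scaleR_in_bidisc[OF subsetD[OF bidisc_subset_cbidisc maps_bidisc] s]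
      in \<open>simp_all add: scaleR_conv_of_real\<close>)

text \<open>The dilation is split into two factors. The factor \<open>r\<close> gives
  \<open>f\<close> values on the torus for Cauchy's formula; the factor \<open>q\<close> puts the
  symbol values inside the bidisc, where the reproducing identity turns the Gram kernel into the
  Szego kernel at pairs of such values.\<close>

lemma Schur_bound:
  assumes f: "holo2_on bidisc f" and r: "0 \<le> r" "r < 1" and q: "0 \<le> q" "q < 1"
    and v: "continuous_on tbox v" "\<And>\<theta>. \<theta> \<in> tbox \<Longrightarrow> 0 \<le> v \<theta>" and M: "0 < M"
    and Mb: "\<And>\<theta>. \<theta> \<in> tbox \<Longrightarrow> integral tbox (\<lambda>\<theta>'. v \<theta>' * cmod (szego (q *\<^sub>R \<phi> (tor \<theta>)) (q *\<^sub>R \<phi> (tor \<theta>')))) \<le> M"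
  shows "integral tbox (\<lambda>\<theta>. v \<theta> * (cmod (f ((r * q) *\<^sub>R \<phi> (tor \<theta>))))\<^sup>2) \<le> M * H2mean r f"
proof -
  have qin: "q *\<^sub>R \<phi> (tor \<theta>) \<in> bidisc" for \<theta> by (rule scaleR_in_bidisc[OF maps_tor q])
  have k: "continuous_on (tbox \<times> tbox) (\<lambda>p. szego (q *\<^sub>R \<phi> (tor (fst p))) (tor (snd p)))"
    by (intro continuous_on_szego continuous_intros continuous_on_compose2[OF cont_\<phi>_tor[of UNIV]])
      (simp_all add: qin tor_in_cbidisc)
  have G: "continuous_on (tbox \<times> tbox) (\<lambda>p. szego (q *\<^sub>R \<phi> (tor (fst p))) (q *\<^sub>R \<phi> (tor (snd p))))"
    by (intro continuous_on_szego continuous_intros continuous_on_compose2[OF cont_\<phi>_tor[of UNIV]])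
      (simp_all add: qin subsetD[OF bidisc_subset_cbidisc qin])
  have g: "continuous_on tbox (\<lambda>t. f (r *\<^sub>R tor t))" by (rule continuous_on_tbox_tor_dilated[OF f r])
  have u: "continuous_on tbox (\<lambda>\<theta>. f (r *\<^sub>R (q *\<^sub>R \<phi> (tor \<theta>))))"
    by (rule continuous_on_dilated[OF f r]) (auto intro!: continuous_intros cont_\<phi>_tor subsetD[OF bidisc_subset_cbidisc qin])
  have ueq: "f (r *\<^sub>R (q *\<^sub>R \<phi> (tor \<theta>))) = of_real (1 / (4 * pi\<^sup>2)) * integral tbox (\<lambda>t. f (r *\<^sub>R tor t) * szego (q *\<^sub>R \<phi> (tor \<theta>)) (tor t))" for \<theta>
    by (subst bidisc_Cauchy_formula[OF f r qin]) simp
  have Geq: "of_real (1 / (4 * pi\<^sup>2)) * integral tbox (\<lambda>t. szego (q *\<^sub>R \<phi> (tor x)) (tor t) * cnj (szego (q *\<^sub>R \<phi> (tor y)) (tor t)))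
     = szego (q *\<^sub>R \<phi> (tor x)) (q *\<^sub>R \<phi> (tor y))" for x y
    by (subst szego_reproducing[OF qin qin]) simp
  have c: "0 < 1 / (4 * pi\<^sup>2)" by simp
  have "integral tbox (\<lambda>\<theta>. v \<theta> * (cmod (f (r *\<^sub>R (q *\<^sub>R \<phi> (tor \<theta>)))))\<^sup>2)
    \<le> M * (1 / (4 * pi\<^sup>2) * integral tbox (\<lambda>t. (cmod (f (r *\<^sub>R tor t)))\<^sup>2))"
    by (rule Schur_embedding[OF k G u g v(1) v(2) c M ueq Geq Mb])
  then show ?thesis by (simp add: H2mean_eq)
qed

text \<open>For \<open>s < 1\<close> the function \<open>f (s *\<^sub>R \<phi> z)\<close> is
  continuous up to the torus, so its means are bounded by the boundary mean. At a fixed radius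
  \<open>r < 1\<close> the factor \<open>s\<close> may then tend to 1, since \<phi> maps the smaller
  torus into the open bidisc.\<close>

lemma H2mean_comp_le:
  assumes f: "holo2_on bidisc f" and r: "0 < r" "r < 1"
    and C: "\<And>s. 0 < s \<Longrightarrow> s < 1 \<Longrightarrow> integral tbox (\<lambda>\<theta>. (cmod (f (s *\<^sub>R \<phi> (tor \<theta>))))\<^sup>2) \<le> C"
  shows "H2mean r (\<lambda>z. f (\<phi> z)) \<le> C / (4 * pi\<^sup>2)"
proof -
  have rin: "r *\<^sub>R tor \<theta> \<in> bidisc" for \<theta> by (rule scaleR_in_bidisc[OF tor_in_cbidisc]) (use r in auto)
  have sin': "s *\<^sub>R \<phi> (r *\<^sub>R tor \<theta>) \<in> bidisc" if "s \<in> {0..1}" for s \<theta>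
  proof (cases "s = 1")
    case False
    then show ?thesis using that by (intro scaleR_in_bidisc subsetD[OF bidisc_subset_cbidisc maps_bidisc[OF rin]]) auto
  qed (simp add: maps_bidisc[OF rin])
  have hc: "continuous_on ({0..1} \<times> tbox) (\<lambda>p. (\<lambda>s \<theta>. f (s *\<^sub>R \<phi> (r *\<^sub>R tor \<theta>))) (fst p) (snd p))"
    by (intro continuous_on_compose2[OF holo2_on_imp_continuous_on[OF f]] continuous_intros continuous_on_compose2[OF cont_\<phi>])
       (simp_all add: image_subset_iff mem_Times_iff sin' subsetD[OF bidisc_subset_cbidisc rin])
  have "integral tbox (\<lambda>\<theta>. (cmod (f (1 *\<^sub>R \<phi> (r *\<^sub>R tor \<theta>))))\<^sup>2) \<le> C"
  proof (rule tbox_mean_le[OF hc])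
    fix s :: real assume s: "0 < s" "s < 1"
    have cs: "continuous_on cbidisc (\<lambda>z. f (s *\<^sub>R \<phi> z))"
      using s by (intro continuous_on_dilated[OF f] cont_\<phi> maps_cbidisc) auto
    have "H2mean r (\<lambda>z. f (s *\<^sub>R \<phi> z)) \<le> integral tbox (\<lambda>\<theta>. (cmod (f (s *\<^sub>R \<phi> (tor \<theta>))))\<^sup>2) / (4 * pi\<^sup>2)"
      using s by (intro H2mean_le_boundary r cs holo2_on_comp_dilated f) auto
    also have "\<dots> \<le> C / (4 * pi\<^sup>2)" by (intro divide_right_mono C s) auto
    finally have "H2mean r (\<lambda>z. f (s *\<^sub>R \<phi> z)) \<le> C / (4 * pi\<^sup>2)" .
    then show "integral tbox (\<lambda>\<theta>. (cmod (f (s *\<^sub>R \<phi> (r *\<^sub>R tor \<theta>))))\<^sup>2) \<le> C"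
      unfolding H2mean_eq by (simp add: field_simps)
  qed
  then show ?thesis unfolding H2mean_eq by (simp add: divide_right_mono)
qed

end


section \<open>Uniform integrability of the kernels and compactness\<close>

context smooth_self_map
begin

text \<open>The smaller of the two moduli is a continuous function on the compact torus and never
  reaches 1, so it is bounded away from 1.\<close>

lemma contact_sets_separated:
  assumes disj: "\<phi> ` torus2 \<inter> torus2 = {}"
  obtains \<epsilon> where "0 < \<epsilon>" "\<epsilon> \<le> 1" "\<And>\<theta>. min (cmod (fst (\<phi> (tor \<theta>)))) (cmod (snd (\<phi> (tor \<theta>)))) \<le> 1 - \<epsilon>"
proof -
  have c: "continuous_on torus2 (\<lambda>z. min (cmod (fst (\<phi> z))) (cmod (snd (\<phi> z))))"
    by (intro continuous_intros continuous_on_subset[OF f1.cont_f] continuous_on_subset[OF f2.cont_f] torus2_subset_cbidisc)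
  have k: "compact torus2" unfolding torus2_def by (intro compact_Times) auto
  have ne: "torus2 \<noteq> {}" using tor_in_torus2 by blast
  from continuous_attains_sup[OF k ne c] obtain z where z: "z \<in> torus2"
    and max: "\<And>w. w \<in> torus2 \<Longrightarrow> min (cmod (fst (\<phi> w))) (cmod (snd (\<phi> w))) \<le> min (cmod (fst (\<phi> z))) (cmod (snd (\<phi> z)))" by blast
  have zc: "z \<in> cbidisc" using z torus2_subset_cbidisc by blast
  have "\<phi> z \<notin> torus2" using disj z by blast
  then have "cmod (fst (\<phi> z)) \<noteq> 1 \<or> cmod (snd (\<phi> z)) \<noteq> 1" by (auto simp: torus2_def mem_Times_iff)
  then have "min (cmod (fst (\<phi> z))) (cmod (snd (\<phi> z))) < 1" using f1.le1[OF zc] f2.le1[OF zc] by linarith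
  then show thesis
    using max[OF tor_in_torus2]
    by (intro that[of "1 - min (cmod (fst (\<phi> z))) (cmod (snd (\<phi> z)))"]) auto
qed

text \<open>For given \<theta> one coordinate of the symbol has modulus at most
  \<open>1 - \<epsilon>\<close>, which bounds the corresponding factor below by
  \<open>\<epsilon>\<close> for every \<open>\<theta>'\<close>. Adding both one-variable kernels
  makes the estimate independent of which coordinate this is.\<close>

lemma szego_symbol_bound:
  assumes \<epsilon>: "0 < \<epsilon>" "\<epsilon> \<le> 1" and sep: "\<And>\<theta>. min (cmod (fst (\<phi> (tor \<theta>)))) (cmod (snd (\<phi> (tor \<theta>)))) \<le> 1 - \<epsilon>"
    and q: "0 \<le> q" "q < 1"
  shows "cmod (szego (q *\<^sub>R \<phi> (tor \<theta>)) (q *\<^sub>R \<phi> (tor \<theta>')))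
    \<le> 1 / \<epsilon> * (1 / cmod (1 - of_real (q\<^sup>2) * cnj (fst (\<phi> (tor \<theta>))) * fst (\<phi> (tor \<theta>')))
          + 1 / cmod (1 - of_real (q\<^sup>2) * cnj (snd (\<phi> (tor \<theta>))) * snd (\<phi> (tor \<theta>'))))"
proof -
  define A where "A = cmod (1 - of_real (q\<^sup>2) * cnj (fst (\<phi> (tor \<theta>))) * fst (\<phi> (tor \<theta>')))"
  define B where "B = cmod (1 - of_real (q\<^sup>2) * cnj (snd (\<phi> (tor \<theta>))) * snd (\<phi> (tor \<theta>')))"
  have q2: "0 \<le> q\<^sup>2" "q\<^sup>2 < 1" using q by (auto simp: power_less_one_iff abs_square_less_1)
  have low: "1 - cmod z \<le> cmod (1 - of_real (q\<^sup>2) * cnj z * w)" "0 < cmod (1 - of_real (q\<^sup>2) * cnj z * w)"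
    if "cmod z \<le> 1" "cmod w \<le> 1" for z w
  proof -
    have 1: "cmod (of_real (q\<^sup>2) * cnj z * w) = q\<^sup>2 * (cmod z * cmod w)" using q2 by (simp add: norm_mult del: of_real_power)
    have zw: "cmod z * cmod w \<le> cmod z" using that by (simp add: mult_left_le)
    have "q\<^sup>2 * (cmod z * cmod w) \<le> 1 * (cmod z * cmod w)" using q2 by (intro mult_right_mono) auto
    with zw have 2: "q\<^sup>2 * (cmod z * cmod w) \<le> cmod z" by simp
    have "q\<^sup>2 * (cmod z * cmod w) \<le> q\<^sup>2 * 1" using q2 that by (intro mult_left_mono mult_le_one) auto
    with q2 have 3: "q\<^sup>2 * (cmod z * cmod w) < 1" by simp
    show "1 - cmod z \<le> cmod (1 - of_real (q\<^sup>2) * cnj z * w)" "0 < cmod (1 - of_real (q\<^sup>2) * cnj z * w)"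
      using norm_triangle_ineq2[of 1 "of_real (q\<^sup>2) * cnj z * w"] 1 2 3 unfolding norm_one by linarith+
  qed
  have A: "1 - cmod (fst (\<phi> (tor \<theta>))) \<le> A" "0 < A" unfolding A_def by (rule low[OF f1.le1_F f1.le1_F])+
  have B: "1 - cmod (snd (\<phi> (tor \<theta>))) \<le> B" "0 < B" unfolding B_def by (rule low[OF f2.le1_F f2.le1_F])+
  have "\<epsilon> \<le> A \<or> \<epsilon> \<le> B" using sep[of \<theta>] A(1) B(1) by linarith
  then have "1 / (A * B) \<le> 1 / \<epsilon> * (1 / A + 1 / B)"
  proof
    assume "\<epsilon> \<le> A"
    then have "1 / A * (1 / B) \<le> 1 / \<epsilon> * (1 / B)" using \<epsilon> B by (intro mult_right_mono frac_le) auto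
    also have "\<dots> \<le> 1 / \<epsilon> * (1 / A + 1 / B)" using \<epsilon> A by (intro mult_left_mono) auto
    finally show ?thesis by simp
  next
    assume "\<epsilon> \<le> B"
    then have "1 / A * (1 / B) \<le> 1 / A * (1 / \<epsilon>)" using \<epsilon> A by (intro mult_left_mono frac_le) auto
    also have "\<dots> = 1 / \<epsilon> * (1 / A)" by simp
    also have "\<dots> \<le> 1 / \<epsilon> * (1 / A + 1 / B)" using \<epsilon> B by (intro mult_left_mono) auto
    finally show ?thesis by simp
  qed
  moreover have "cmod (szego (q *\<^sub>R \<phi> (tor \<theta>)) (q *\<^sub>R \<phi> (tor \<theta>'))) = 1 / (A * B)"
  proof -
    \<comment> \<open>Conjugation leaves the modulus unchanged and puts the conjugate on the fixed
      variable, so that the kernel has the form \<open>1 - \<zeta> * F \<theta>'\<close> of the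
      level set estimates.\<close>
    have e: "cmod (1 - of_real q * z * cnj (of_real q * w)) = cmod (1 - of_real (q\<^sup>2) * cnj z * w)" for z w :: complex
    proof -
      have "cmod (1 - of_real q * z * cnj (of_real q * w)) = cmod (cnj (1 - of_real q * z * cnj (of_real q * w)))"
        by (simp only: complex_mod_cnj)
      also have "cnj (1 - of_real q * z * cnj (of_real q * w)) = 1 - of_real (q\<^sup>2) * cnj z * w"
        by (simp add: power2_eq_square mult_ac)
      finally show ?thesis .
    qed
    show ?thesis unfolding szego_def A_def B_def e[symmetric] by (simp add: norm_mult norm_divide scaleR_conv_of_real)
  qed
  ultimately show ?thesis unfolding A_def B_def by simp
qed

text \<open>The values \<open>z1\<close> and \<open>z2\<close> play the role of \<zeta>. Since
  \<open>kernel_integral_le\<close> is uniform in \<zeta>, the result depends neither on \<theta>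
  nor on \<open>q\<close>, as Schur's test requires.\<close>

lemma szego_integral_bound:
  assumes \<epsilon>: "0 < \<epsilon>" "\<epsilon> \<le> 1" and sep: "\<And>\<theta>. min (cmod (fst (\<phi> (tor \<theta>)))) (cmod (snd (\<phi> (tor \<theta>)))) \<le> 1 - \<epsilon>"
    and K0: "0 < K"
    and K1: "\<And>\<zeta> \<delta>. cmod \<zeta> \<le> 1 \<Longrightarrow> 0 < \<delta> \<Longrightarrow> measure lebesgue {\<theta> \<in> tbox. cmod (1 - \<zeta> * fst (\<phi> (tor \<theta>))) \<le> \<delta>} \<le> K * (\<delta> * sqrt \<delta>)"
    and K2: "\<And>\<zeta> \<delta>. cmod \<zeta> \<le> 1 \<Longrightarrow> 0 < \<delta> \<Longrightarrow> measure lebesgue {\<theta> \<in> tbox. cmod (1 - \<zeta> * snd (\<phi> (tor \<theta>))) \<le> \<delta>} \<le> K * (\<delta> * sqrt \<delta>)"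
    and v: "continuous_on tbox v" "\<And>\<theta>. \<theta> \<in> tbox \<Longrightarrow> 0 \<le> v \<theta>" "\<And>\<theta>. \<theta> \<in> tbox \<Longrightarrow> v \<theta> \<le> 1"
    and q: "0 \<le> q" "q < 1" and T: "0 < T"
  shows "integral tbox (\<lambda>\<theta>'. v \<theta>' * cmod (szego (q *\<^sub>R \<phi> (tor \<theta>)) (q *\<^sub>R \<phi> (tor \<theta>'))))
    \<le> 2 / \<epsilon> * (T * integral tbox v + 8 * K / sqrt T)"
proof -
  have q2: "0 \<le> q\<^sup>2" "q\<^sup>2 < 1" using q by (auto simp: power_less_one_iff abs_square_less_1)
  define z1 where "z1 = of_real (q\<^sup>2) * cnj (fst (\<phi> (tor \<theta>)))"
  define z2 where "z2 = of_real (q\<^sup>2) * cnj (snd (\<phi> (tor \<theta>)))"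
  have lt: "cmod (of_real (q\<^sup>2) * cnj z) < 1" if "cmod z \<le> 1" for z
  proof -
    have "cmod (of_real (q\<^sup>2) * cnj z) = q\<^sup>2 * cmod z" by (simp add: norm_mult del: of_real_power)
    also have "\<dots> \<le> q\<^sup>2 * 1" using q2 that by (intro mult_left_mono) auto
    finally show ?thesis using q2 by simp
  qed
  have z: "cmod z1 < 1" "cmod z2 < 1" unfolding z1_def z2_def by (intro lt f1.le1_F f2.le1_F)+
  have ne1: "1 - z1 * fst (\<phi> (tor t)) \<noteq> 0" for t using norm_mult_lt_one[OF z(1) f1.le1_F] .
  have ne2: "1 - z2 * snd (\<phi> (tor t)) \<noteq> 0" for t using norm_mult_lt_one[OF z(2) f2.le1_F] .
  have i1: "(\<lambda>t. v t / cmod (1 - z1 * fst (\<phi> (tor t)))) integrable_on tbox"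
    using ne1 by (intro integrable_continuous continuous_intros v(1) f1.cont_F) auto
  have i2: "(\<lambda>t. v t / cmod (1 - z2 * snd (\<phi> (tor t)))) integrable_on tbox"
    using ne2 by (intro integrable_continuous continuous_intros v(1) f2.cont_F) auto
  have qin: "q *\<^sub>R \<phi> (tor t) \<in> bidisc" for t by (rule scaleR_in_bidisc[OF maps_tor q])
  have "integral tbox (\<lambda>t. v t * cmod (szego (q *\<^sub>R \<phi> (tor \<theta>)) (q *\<^sub>R \<phi> (tor t))))
    \<le> integral tbox (\<lambda>t. 1 / \<epsilon> * (v t / cmod (1 - z1 * fst (\<phi> (tor t))) + v t / cmod (1 - z2 * snd (\<phi> (tor t)))))"
  proof (rule integral_le)
    show "(\<lambda>t. v t * cmod (szego (q *\<^sub>R \<phi> (tor \<theta>)) (q *\<^sub>R \<phi> (tor t)))) integrable_on tbox"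
      by (intro integrable_continuous continuous_intros v(1) continuous_on_szego cont_\<phi>_tor qin subsetD[OF bidisc_subset_cbidisc qin])
    show "(\<lambda>t. 1 / \<epsilon> * (v t / cmod (1 - z1 * fst (\<phi> (tor t))) + v t / cmod (1 - z2 * snd (\<phi> (tor t))))) integrable_on tbox"
      using integrable_add[OF i1 i2] by (rule integrable_on_mult_right)
    fix t assume t: "t \<in> tbox"
    from mult_left_mono[OF szego_symbol_bound[OF \<epsilon> sep q, of \<theta> t] v(2)[OF t]]
    show "v t * cmod (szego (q *\<^sub>R \<phi> (tor \<theta>)) (q *\<^sub>R \<phi> (tor t)))
      \<le> 1 / \<epsilon> * (v t / cmod (1 - z1 * fst (\<phi> (tor t))) + v t / cmod (1 - z2 * snd (\<phi> (tor t))))"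
      unfolding z1_def z2_def by (simp add: field_simps)
  qed
  also have "\<dots> = 1 / \<epsilon> * (integral tbox (\<lambda>t. v t / cmod (1 - z1 * fst (\<phi> (tor t)))) + integral tbox (\<lambda>t. v t / cmod (1 - z2 * snd (\<phi> (tor t)))))"
    by (subst integral_mult_right, subst integral_add[OF i1 i2]) simp
  also have "\<dots> \<le> 1 / \<epsilon> * ((T * integral tbox v + 8 * K / sqrt T) + (T * integral tbox v + 8 * K / sqrt T))"
    using \<epsilon> by (intro mult_left_mono add_mono kernel_integral_le[OF f1.cont_F f1.le1_F K0 K1 v z(1) T]
       kernel_integral_le[OF f2.cont_F f2.le1_F K0 K2 v z(2) T]) auto
  also have "\<dots> = 2 / \<epsilon> * (T * integral tbox v + 8 * K / sqrt T)" by simp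
  finally show ?thesis .
qed

text \<open>A continuous weight instead of an indicator, because the Schur estimate is stated for
  continuous weights. It is 1 where the larger modulus is at least \<open>1 - \<tau>\<close> and
  falls linearly to 0 at \<open>1 - \<sigma>\<close>.\<close>

lemma cutoff:
  fixes K e :: real
  assumes K0: "0 < K"
    and K1: "\<And>\<zeta> \<delta>. cmod \<zeta> \<le> 1 \<Longrightarrow> 0 < \<delta> \<Longrightarrow> measure lebesgue {\<theta> \<in> tbox. cmod (1 - \<zeta> * fst (\<phi> (tor \<theta>))) \<le> \<delta>} \<le> K * (\<delta> * sqrt \<delta>)"
    and K2: "\<And>\<zeta> \<delta>. cmod \<zeta> \<le> 1 \<Longrightarrow> 0 < \<delta> \<Longrightarrow> measure lebesgue {\<theta> \<in> tbox. cmod (1 - \<zeta> * snd (\<phi> (tor \<theta>))) \<le> \<delta>} \<le> K * (\<delta> * sqrt \<delta>)"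
    and e: "0 < e"
  obtains \<tau> v where "0 < \<tau>" "\<tau> < 1" "continuous_on tbox v" "\<And>\<theta>. 0 \<le> v \<theta>" "\<And>\<theta>. v \<theta> \<le> 1"
    "\<And>\<theta>. v \<theta> \<noteq> 1 \<Longrightarrow> cmod (fst (\<phi> (tor \<theta>))) \<le> 1 - \<tau> \<and> cmod (snd (\<phi> (tor \<theta>))) \<le> 1 - \<tau>"
    "integral tbox v \<le> e"
proof -
  \<comment> \<open>Each coordinate contributes at most \<open>40 * K * sqrt \<sigma>\<close> to the
    measure of the support, and \<open>80 * K * sqrt \<sigma> \<le> e\<close> is the
    requirement.\<close>
  define \<sigma> where "\<sigma> = min 1 ((e / (80 * K))\<^sup>2)"
  have \<sigma>: "0 < \<sigma>" "\<sigma> \<le> 1" using e K0 by (auto simp: \<sigma>_def)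
  have "sqrt \<sigma> \<le> sqrt ((e / (80 * K))\<^sup>2)" unfolding \<sigma>_def by (intro real_sqrt_le_mono min.cobounded2)
  also have "\<dots> = e / (80 * K)" using e K0 by (intro real_sqrt_unique) auto
  finally have s: "80 * K * sqrt \<sigma> \<le> e" using K0 by (simp add: field_simps)
  define \<tau> where "\<tau> = \<sigma> / 2"
  define m where "m = (\<lambda>\<theta>. max (cmod (fst (\<phi> (tor \<theta>)))) (cmod (snd (\<phi> (tor \<theta>)))))"
  define v where "v = (\<lambda>\<theta>. min 1 (max 0 ((m \<theta> - (1 - \<sigma>)) / \<tau>)))"
  have \<tau>: "0 < \<tau>" "\<tau> < 1" "\<sigma> = 2 * \<tau>" using \<sigma> by (auto simp: \<tau>_def)
  have mc: "continuous_on S m" for S unfolding m_def by (intro continuous_intros f1.cont_F f2.cont_F)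
  have vc: "continuous_on tbox v" unfolding v_def using \<tau> by (intro continuous_intros mc) auto
  have v01: "0 \<le> v \<theta>" "v \<theta> \<le> 1" for \<theta> by (auto simp: v_def)
  have v1: "cmod (fst (\<phi> (tor \<theta>))) \<le> 1 - \<tau> \<and> cmod (snd (\<phi> (tor \<theta>))) \<le> 1 - \<tau>" if "v \<theta> \<noteq> 1" for \<theta>
  proof -
    have "(m \<theta> - (1 - \<sigma>)) / \<tau> < 1" using that by (auto simp: v_def)
    then have "m \<theta> < 1 - \<tau>" using \<tau> by (simp add: field_simps)
    then show ?thesis by (simp add: m_def)
  qed
  define A1 where "A1 = {\<theta> \<in> tbox. 1 - \<sigma> \<le> cmod (fst (\<phi> (tor \<theta>)))}"
  define A2 where "A2 = {\<theta> \<in> tbox. 1 - \<sigma> \<le> cmod (snd (\<phi> (tor \<theta>)))}"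
  have cA: "compact A1" "compact A2" unfolding A1_def A2_def
    by (intro compact_tbox_sublevel(2) continuous_intros f1.cont_F f2.cont_F)+
  have sub: "A1 \<subseteq> tbox" "A2 \<subseteq> tbox" by (auto simp: A1_def A2_def)
  have "integral tbox v \<le> measure lebesgue A1 + measure lebesgue A2"
  proof (rule has_integral_le[OF integrable_integral[OF integrable_continuous[OF vc]]
        has_integral_add[OF indicator_has_integral_tbox[OF cA(1) sub(1)] indicator_has_integral_tbox[OF cA(2) sub(2)]]])
    fix \<theta> assume t: "\<theta> \<in> tbox"
    show "v \<theta> \<le> indicat_real A1 \<theta> + indicat_real A2 \<theta>"
    proof (cases "\<theta> \<in> A1 \<or> \<theta> \<in> A2")
      case True
      then have "1 \<le> indicat_real A1 \<theta> + indicat_real A2 \<theta>" by (auto simp: indicator_def)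
      then show ?thesis using v01(2)[of \<theta>] by linarith
    next
      case False
      then have "m \<theta> < 1 - \<sigma>" using t by (auto simp: A1_def A2_def m_def)
      then have "(m \<theta> - (1 - \<sigma>)) / \<tau> < 0" using \<tau> by (intro divide_neg_pos) auto
      then have "v \<theta> = 0" by (simp add: v_def)
      then show ?thesis by simp
    qed
  qed
  also have "\<dots> \<le> 40 * K * sqrt \<sigma> + 40 * K * sqrt \<sigma>"
    unfolding A1_def A2_def
    by (intro add_mono near_contact_measure_le[OF f1.cont_F f1.le1_F K0 K1 \<sigma>] near_contact_measure_le[OF f2.cont_F f2.le1_F K0 K2 \<sigma>])
  also have "\<dots> \<le> e" using s by simp
  finally show thesis using \<tau> vc v01 v1 that by blast
qed

theorem compact_comp_of_order2:
  assumes disj: "\<phi> ` torus2 \<inter> torus2 = {}"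
    and T1: "\<And>\<xi>. \<xi> \<in> torus2 \<Longrightarrow> cmod (fst (\<phi> \<xi>)) = 1 \<Longrightarrow> truly_2d_ord2 (\<lambda>z. fst (\<phi> z)) \<xi>"
    and T2: "\<And>\<xi>. \<xi> \<in> torus2 \<Longrightarrow> cmod (snd (\<phi> \<xi>)) = 1 \<Longrightarrow> truly_2d_ord2 (\<lambda>z. snd (\<phi> z)) \<xi>"
  shows "compact_comp_H2 \<phi>"
proof -
  obtain \<epsilon> where \<epsilon>: "0 < \<epsilon>" "\<epsilon> \<le> 1" and sep: "\<And>\<theta>. min (cmod (fst (\<phi> (tor \<theta>)))) (cmod (snd (\<phi> (tor \<theta>)))) \<le> 1 - \<epsilon>"
    using contact_sets_separated[OF disj] by blast
  obtain Ka where Ka: "0 < Ka" "\<And>\<zeta> \<delta>. cmod \<zeta> \<le> 1 \<Longrightarrow> 0 < \<delta> \<Longrightarrow> measure lebesgue {\<theta> \<in> tbox. cmod (1 - \<zeta> * fst (\<phi> (tor \<theta>))) \<le> \<delta>} \<le> Ka * (\<delta> * sqrt \<delta>)"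
    using f1.level_measure[OF T1] by blast
  obtain Kb where Kb: "0 < Kb" "\<And>\<zeta> \<delta>. cmod \<zeta> \<le> 1 \<Longrightarrow> 0 < \<delta> \<Longrightarrow> measure lebesgue {\<theta> \<in> tbox. cmod (1 - \<zeta> * snd (\<phi> (tor \<theta>))) \<le> \<delta>} \<le> Kb * (\<delta> * sqrt \<delta>)"
    using f2.level_measure[OF T2] by blast
  define K where "K = max Ka Kb"
  have K0: "0 < K" using Ka by (simp add: K_def)
  have K1: "measure lebesgue {\<theta> \<in> tbox. cmod (1 - \<zeta> * fst (\<phi> (tor \<theta>))) \<le> \<delta>} \<le> K * (\<delta> * sqrt \<delta>)" if "cmod \<zeta> \<le> 1" "0 < \<delta>" for \<zeta> \<delta>
    using that by (intro order_trans[OF Ka(2)[OF that]] mult_right_mono) (auto simp: K_def)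
  have K2: "measure lebesgue {\<theta> \<in> tbox. cmod (1 - \<zeta> * snd (\<phi> (tor \<theta>))) \<le> \<delta>} \<le> K * (\<delta> * sqrt \<delta>)" if "cmod \<zeta> \<le> 1" "0 < \<delta>" for \<zeta> \<delta>
    using that by (intro order_trans[OF Kb(2)[OF that]] mult_right_mono) (auto simp: K_def)
  have kern: "integral tbox (\<lambda>\<theta>'. v \<theta>' * cmod (szego (q *\<^sub>R \<phi> (tor \<theta>)) (q *\<^sub>R \<phi> (tor \<theta>'))))
      \<le> 2 / \<epsilon> * (T * integral tbox v + 8 * K / sqrt T)"
    if "continuous_on tbox v" "\<And>\<theta>. 0 \<le> v \<theta>" "\<And>\<theta>. v \<theta> \<le> 1" "0 \<le> q" "q < 1" "0 < T" for v q T \<theta>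
    by (rule szego_integral_bound[OF \<epsilon> sep K0]) (use that K1 K2 in auto)
  \<comment> \<open>The dilation \<open>s\<close> is shared equally between function and symbol, as
    \<open>sqrt s * sqrt s\<close>, to match the two factors of \<open>Schur_bound\<close>.\<close>
  have weighted: "integral tbox (\<lambda>\<theta>. v \<theta> * (cmod (f (s *\<^sub>R \<phi> (tor \<theta>))))\<^sup>2) \<le> M * N"
    if f: "holo2_on bidisc f" and N: "\<And>r. 0 < r \<Longrightarrow> r < 1 \<Longrightarrow> H2mean r f \<le> N" and s: "0 < s" "s < 1"
      and v: "continuous_on tbox v" "\<And>\<theta>. 0 \<le> v \<theta>" "\<And>\<theta>. v \<theta> \<le> 1" and T: "0 < T"
      and M: "2 / \<epsilon> * (T * integral tbox v + 8 * K / sqrt T) \<le> M" "0 < M" for f N s v M T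
  proof -
    have r: "0 < sqrt s" "sqrt s < 1" using s by auto
    have "integral tbox (\<lambda>\<theta>. v \<theta> * (cmod (f ((sqrt s * sqrt s) *\<^sub>R \<phi> (tor \<theta>))))\<^sup>2) \<le> M * H2mean (sqrt s) f"
      using r by (intro Schur_bound f v M(2) order_trans[OF kern[OF v _ _ T] M(1)]) auto
    also have "\<dots> \<le> M * N" using M(2) N[OF r] by simp
    finally show ?thesis using s by simp
  qed
  have fin: "2 / \<epsilon> * (1 * integral tbox (\<lambda>_. 1) + 8 * K / sqrt 1) > 0"
    using \<epsilon> K0 by (simp add: content_Pair add_pos_pos)
  \<comment> \<open>Boundedness is the case of the constant weight 1 with cut height
    \<open>T = 1\<close>.\<close>
  define M1 where "M1 = 2 / \<epsilon> * (1 * integral tbox (\<lambda>_. 1) + 8 * K / sqrt 1)"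
  have bounded: "H2mean r (\<lambda>z. f (\<phi> z)) \<le> M1 * N / (4 * pi\<^sup>2)"
    if f: "holo2_on bidisc f" and N: "\<And>r. 0 < r \<Longrightarrow> r < 1 \<Longrightarrow> H2mean r f \<le> N" and r: "0 < r" "r < 1" for f N r
  proof (rule H2mean_comp_le[OF f r])
    fix s :: real assume s: "0 < s" "s < 1"
    show "integral tbox (\<lambda>\<theta>. (cmod (f (s *\<^sub>R \<phi> (tor \<theta>))))\<^sup>2) \<le> M1 * N"
      using weighted[OF f N s, of "\<lambda>_. 1" 1 M1] fin by (simp add: M1_def)
  qed
  have memb: "(\<lambda>z. f (\<phi> z)) \<in> H2" if "f \<in> H2" for f
  proof -
    have f: "holo2_on bidisc f" using that by (simp add: H2_def)
    show ?thesis by (rule H2I(1)[OF holo2_on_comp[OF f] bounded[OF f H2mean_le_norm[OF that]]])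
  qed
  \<comment> \<open>Near the contact sets the weighted Schur constant \<open>M\<close> is small;
    away from them the symbol stays in a smaller closed bidisc, where the functions
    \<open>d n\<close> converge uniformly to 0.\<close>
  have small: "\<exists>n0. \<forall>n\<ge>n0. H2norm (\<lambda>z. d n (\<phi> z)) \<le> sqrt (2 * \<eta>)"
    if d: "\<And>n. holo2_on bidisc (d n)" and N: "\<And>n r. 0 < r \<Longrightarrow> r < 1 \<Longrightarrow> H2mean r (d n) \<le> N"
      and U: "\<And>r. 0 < r \<Longrightarrow> r < 1 \<Longrightarrow> uniform_limit cbidisc (\<lambda>n y. d n (r *\<^sub>R y)) (\<lambda>y. 0) sequentially"
      and \<eta>: "0 < \<eta>" for d :: "nat \<Rightarrow> complex \<times> complex \<Rightarrow> complex" and N \<eta>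
  proof -
    have N0: "0 \<le> N" using N[of "1/2" 0] H2mean_nonneg[of "1/2" "d 0"] by simp
    \<comment> \<open>The constants are fixed backwards. \<open>M\<close> makes the weighted part
      \<open>M * N\<close> at most \<open>\<eta>\<close>; \<open>T\<close> makes the tail term equal
      to \<open>M / 2\<close>; for this \<open>T\<close>, the bound \<open>e\<close> on the integral
      of the weight makes the remaining term at most \<open>M / 2\<close>.\<close>
    define M where "M = \<eta> / (N + 1)"
    have M: "0 < M" using \<eta> N0 by (simp add: M_def)
    define T where "T = (32 * K / (\<epsilon> * M))\<^sup>2"
    have T: "0 < T" using K0 \<epsilon> M by (simp add: T_def)
    have sT: "sqrt T = 32 * K / (\<epsilon> * M)" using K0 \<epsilon> M by (simp add: T_def)
    have T': "2 / \<epsilon> * (8 * K / sqrt T) = M / 2" unfolding sT using K0 \<epsilon> M by (simp add: field_simps)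
    define e where "e = M * \<epsilon> / (4 * T)"
    have e: "0 < e" using M \<epsilon> T by (simp add: e_def)
    obtain \<tau> v where \<tau>: "0 < \<tau>" "\<tau> < 1" and vc: "continuous_on tbox v" and v0: "\<And>\<theta>. 0 \<le> v \<theta>" and v1: "\<And>\<theta>. v \<theta> \<le> 1"
      and vt: "\<And>\<theta>. v \<theta> \<noteq> 1 \<Longrightarrow> cmod (fst (\<phi> (tor \<theta>))) \<le> 1 - \<tau> \<and> cmod (snd (\<phi> (tor \<theta>))) \<le> 1 - \<tau>"
      and vi: "integral tbox v \<le> e"
      using cutoff[OF K0 K1 K2 e] by blast
    have "2 / \<epsilon> * (T * integral tbox v) \<le> 2 / \<epsilon> * (T * e)" using vi T \<epsilon> by (intro mult_left_mono) auto
    also have "\<dots> = M / 2" using T \<epsilon> by (simp add: e_def)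
    finally have MM: "2 / \<epsilon> * (T * integral tbox v + 8 * K / sqrt T) \<le> M" using T' by (simp add: distrib_left)
    obtain n0 where n0: "\<And>n y. n \<ge> n0 \<Longrightarrow> y \<in> cbidisc \<Longrightarrow> cmod (d n ((1 - \<tau>) *\<^sub>R y)) < sqrt \<eta>"
    proof -
      have "uniform_limit cbidisc (\<lambda>n y. d n ((1 - \<tau>) *\<^sub>R y)) (\<lambda>y. 0) sequentially" using \<tau> by (intro U) auto
      moreover have "0 < sqrt \<eta>" using \<eta> by simp
      ultimately obtain n0 where "\<forall>n\<ge>n0. \<forall>y\<in>cbidisc. dist (d n ((1 - \<tau>) *\<^sub>R y)) 0 < sqrt \<eta>"
        unfolding uniform_limit_sequentially_iff by blast
      then show ?thesis by (intro that[of n0]) (simp del: scaleR_Pair)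
    qed
    have MN: "(4 * pi\<^sup>2 * \<eta> + M * N) / (4 * pi\<^sup>2) \<le> 2 * \<eta>"
    proof -
      have "M * N \<le> \<eta>" using \<eta> N0 by (simp add: M_def field_simps)
      also have "\<dots> \<le> 4 * pi\<^sup>2 * \<eta>"
        using \<eta> mult_mono[of 1 pi 1 pi] pi_ge_two by (simp add: power2_eq_square)
      finally show ?thesis by (simp add: field_simps)
    qed
    have "H2norm (\<lambda>z. d n (\<phi> z)) \<le> sqrt ((4 * pi\<^sup>2 * \<eta> + M * N) / (4 * pi\<^sup>2))"
      if n: "n \<ge> n0" for n
    proof (rule H2I(2)[OF holo2_on_comp[OF d] H2mean_comp_le[OF d]])
      fix s :: real assume s: "0 < s" "s < 1"
      have dc: "continuous_on tbox (\<lambda>\<theta>. d n (s *\<^sub>R \<phi> (tor \<theta>)))"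
        using s by (intro continuous_on_dilated[OF d] cont_\<phi>_tor maps_tor) auto
      have "integral tbox (\<lambda>\<theta>. (cmod (d n (s *\<^sub>R \<phi> (tor \<theta>))))\<^sup>2) \<le> integral tbox (\<lambda>\<theta>. \<eta> + v \<theta> * (cmod (d n (s *\<^sub>R \<phi> (tor \<theta>))))\<^sup>2)"
      proof (intro integral_le integrable_continuous continuous_intros dc vc)
        fix \<theta> assume "\<theta> \<in> tbox"
        show "(cmod (d n (s *\<^sub>R \<phi> (tor \<theta>))))\<^sup>2 \<le> \<eta> + v \<theta> * (cmod (d n (s *\<^sub>R \<phi> (tor \<theta>))))\<^sup>2"
        proof (cases "v \<theta> = 1")
          case False
          \<comment> \<open>Where the weight differs from 1 both coordinates of the symbol are at
            most \<open>1 - \<tau>\<close>, so this point lies in the closed bidisc for every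
            \<open>s < 1\<close> and the index \<open>n0\<close> serves all dilations at
            once.\<close>
          define y where "y = (s / (1 - \<tau>)) *\<^sub>R \<phi> (tor \<theta>)"
          have "s * cmod w \<le> 1 - \<tau>" if "cmod w \<le> 1 - \<tau>" for w
            using s that mult_left_le_one_le[of "cmod w" s] by auto
          then have "y \<in> cbidisc" using vt[OF False] s \<tau>
            by (simp add: y_def cbidisc_def mem_Times_iff field_simps)
          from n0[OF n this] have "cmod (d n (s *\<^sub>R \<phi> (tor \<theta>))) < sqrt \<eta>" using \<tau> by (simp add: y_def)
          then have "(cmod (d n (s *\<^sub>R \<phi> (tor \<theta>))))\<^sup>2 \<le> (sqrt \<eta>)\<^sup>2" by (intro power_mono) auto
          then have "(cmod (d n (s *\<^sub>R \<phi> (tor \<theta>))))\<^sup>2 \<le> \<eta>" using \<eta> by simp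
          moreover have "0 \<le> v \<theta> * (cmod (d n (s *\<^sub>R \<phi> (tor \<theta>))))\<^sup>2" using v0 by simp
          ultimately show ?thesis by linarith
        qed (use \<eta> in simp)
      qed
      also have "\<dots> = integral tbox (\<lambda>_. \<eta>) + integral tbox (\<lambda>\<theta>. v \<theta> * (cmod (d n (s *\<^sub>R \<phi> (tor \<theta>))))\<^sup>2)"
        by (intro integral_add integrable_continuous continuous_intros dc vc)
      also have "\<dots> \<le> 4 * pi\<^sup>2 * \<eta> + M * N"
        using weighted[OF d N s vc v0 v1 T MM M] by (simp add: content_Pair power2_eq_square)
      finally show "integral tbox (\<lambda>\<theta>. (cmod (d n (s *\<^sub>R \<phi> (tor \<theta>))))\<^sup>2) \<le> 4 * pi\<^sup>2 * \<eta> + M * N" .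
    qed
    then show ?thesis using MN by (meson order_trans real_sqrt_le_mono)
  qed
  have comp: "\<exists>s g. strict_mono s \<and> g \<in> H2 \<and> (\<lambda>k. H2norm (\<lambda>z. F (s k) (\<phi> z) - g z)) \<longlonglongrightarrow> 0"
    if F: "\<And>n. F n \<in> H2" and bd: "bounded (range (\<lambda>n. H2norm (F n)))"
    for F :: "nat \<Rightarrow> complex \<times> complex \<Rightarrow> complex"
  proof -
    obtain B where B: "\<And>n. \<bar>H2norm (F n)\<bar> \<le> B" using bd unfolding bounded_iff by auto
    have Fh: "holo2_on bidisc (F n)" for n using F[of n] by (simp add: H2_def)
    have FB: "H2mean r (F n) \<le> B\<^sup>2" if "0 < r" "r < 1" for n r
    proof -
      have "H2mean r (F n) \<le> (H2norm (F n))\<^sup>2" by (rule H2mean_le_norm[OF F that])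
      also have "\<dots> \<le> B\<^sup>2" using B[of n] by (simp add: abs_le_square_iff[symmetric])
      finally show ?thesis .
    qed
    obtain g k where k: "strict_mono (k :: nat \<Rightarrow> nat)" and g: "holo2_on bidisc g"
      and U: "\<And>r. 0 < r \<Longrightarrow> r < 1 \<Longrightarrow> uniform_limit cbidisc (\<lambda>n y. F (k n) (r *\<^sub>R y)) (\<lambda>y. g (r *\<^sub>R y)) sequentially"
    proof (rule H2_Montel[of F "B\<^sup>2"])
      show "holo2_on bidisc (F n)" for n by (rule Fh)
      show "H2mean r (F n) \<le> B\<^sup>2" if "0 < r" "r < 1" for n r by (rule FB[OF that])
    qed (rule that)
    \<comment> \<open>In place of Fatou's lemma: at a fixed radius some \<open>F (k n)\<close> is
      uniformly within 1 of \<open>g\<close>, and the means of all \<open>F (k n)\<close> have a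
      common bound. The index \<open>n\<close> may depend on the radius.\<close>
    have gB: "H2mean r g \<le> 2 * B\<^sup>2 + 2" if r: "0 < r" "r < 1" for r
    proof -
      obtain n where n: "\<And>y. y \<in> cbidisc \<Longrightarrow> cmod (F (k n) (r *\<^sub>R y) - g (r *\<^sub>R y)) < 1"
      proof -
        obtain n0 where "\<forall>n\<ge>n0. \<forall>y\<in>cbidisc. dist (F (k n) (r *\<^sub>R y)) (g (r *\<^sub>R y)) < 1"
          using U[OF r] zero_less_one unfolding uniform_limit_sequentially_iff by blast
        then show ?thesis by (intro that[of n0]) (auto simp: dist_norm simp del: scaleR_Pair)
      qed
      let ?d = "\<lambda>z. F (k n) z - g z"
      have dh: "holo2_on bidisc ?d" by (rule holo2_on_diff[OF Fh g])
      have "integral tbox (\<lambda>\<theta>. (cmod (?d (r *\<^sub>R tor \<theta>)))\<^sup>2) \<le> integral tbox (\<lambda>_. 1)"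
      proof (intro integral_le integrable_continuous continuous_intros)
        show "continuous_on tbox (\<lambda>\<theta>. F (k n) (r *\<^sub>R tor \<theta>))" "continuous_on tbox (\<lambda>\<theta>. g (r *\<^sub>R tor \<theta>))"
          using r by (intro continuous_on_tbox_tor_dilated Fh g; simp)+
        fix \<theta>
        show "(cmod (?d (r *\<^sub>R tor \<theta>)))\<^sup>2 \<le> 1"
          using n[OF tor_in_cbidisc[of \<theta>]] by (intro power_le_one) auto
      qed
      then have "H2mean r ?d \<le> 1" unfolding H2mean_eq by (simp add: content_Pair power2_eq_square)
      moreover have "H2mean r (\<lambda>z. F (k n) z - ?d z) \<le> 2 * H2mean r (F (k n)) + 2 * H2mean r ?d"
        using r by (intro H2mean_diff_le Fh dh) auto
      ultimately show ?thesis using FB[OF r, of "k n"] by simp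
    qed
    have gH: "g \<in> H2" by (rule H2I(1)[OF g gB])
    define d where "d = (\<lambda>n z. F (k n) z - g z)"
    have dh: "holo2_on bidisc (d n)" for n unfolding d_def by (rule holo2_on_diff[OF Fh g])
    have dB: "H2mean r (d n) \<le> 2 * B\<^sup>2 + 2 * (2 * B\<^sup>2 + 2)" if r: "0 < r" "r < 1" for n r
    proof -
      have "H2mean r (d n) \<le> 2 * H2mean r (F (k n)) + 2 * H2mean r g"
        unfolding d_def using r by (intro H2mean_diff_le Fh g) auto
      also have "\<dots> \<le> 2 * B\<^sup>2 + 2 * (2 * B\<^sup>2 + 2)"
        by (intro add_mono mult_left_mono FB[OF r] gB[OF r]) auto
      finally show ?thesis .
    qed
    have dU: "uniform_limit cbidisc (\<lambda>n y. d n (r *\<^sub>R y)) (\<lambda>y. 0) sequentially" if "0 < r" "r < 1" for r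
      using U[OF that] unfolding uniform_limit_sequentially_iff d_def dist_norm by simp
    have dH: "(\<lambda>z. d n (\<phi> z)) \<in> H2" for n
      unfolding d_def by (intro H2_diff memb F gH)
    have "(\<lambda>n. H2norm (\<lambda>z. d n (\<phi> z))) \<longlonglongrightarrow> 0"
    proof (rule LIMSEQ_I)
      fix e :: real assume e: "0 < e"
      have \<eta>: "0 < e\<^sup>2 / 8" using e by simp
      have "sqrt (2 * (e\<^sup>2 / 8)) = e / 2" using e by (intro real_sqrt_unique) (auto simp: power_divide)
      moreover have "\<exists>n0. \<forall>n\<ge>n0. H2norm (\<lambda>z. d n (\<phi> z)) \<le> sqrt (2 * (e\<^sup>2 / 8))"
        by (rule small[OF dh _ _ \<eta>]) (use dB dU in blast)+
      ultimately have "\<exists>n0. \<forall>n\<ge>n0. H2norm (\<lambda>z. d n (\<phi> z)) \<le> e / 2" by (simp only:)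
      then obtain n0 where n0: "\<And>n. n \<ge> n0 \<Longrightarrow> H2norm (\<lambda>z. d n (\<phi> z)) \<le> e / 2" by blast
      have "norm (H2norm (\<lambda>z. d n (\<phi> z)) - 0) < e" if "n \<ge> n0" for n
        using n0[OF that] H2norm_nonneg[OF dH[of n]] e by simp
      then show "\<exists>n0. \<forall>n\<ge>n0. norm (H2norm (\<lambda>z. d n (\<phi> z)) - 0) < e" by blast
    qed
    then have "(\<lambda>n. H2norm (\<lambda>z. F (k n) (\<phi> z) - g (\<phi> z))) \<longlonglongrightarrow> 0" by (simp add: d_def)
    moreover have "(\<lambda>z. g (\<phi> z)) \<in> H2" by (rule memb[OF gH])
    ultimately show ?thesis using k by (intro exI[of _ k] exI[of _ "\<lambda>z. g (\<phi> z)"]) auto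
  qed
  show ?thesis unfolding compact_comp_H2_def using memb comp by blast
qed

end


subsection \<open>Test functions for compactness\<close>

text \<open>The normalised reproducing kernel at \<open>w\<close>: the square of the norm of the
  Szego kernel at \<open>w\<close> is \<open>szego w w\<close>, whose reciprocal stands under the
  root.\<close>

definition unit_szego :: "complex \<times> complex \<Rightarrow> complex \<times> complex \<Rightarrow> complex" where
  "unit_szego w z = of_real (sqrt ((1 - (cmod (fst w))\<^sup>2) * (1 - (cmod (snd w))\<^sup>2))) * szego z w"

lemma one_minus_square_bounds:
  assumes "cmod z < 1" shows "0 < 1 - (cmod z)\<^sup>2" "1 - (cmod z)\<^sup>2 \<le> 1"
  using assms by (auto simp: power_less_one_iff abs_square_less_1)

lemma holo2_on_unit_szego:
  assumes "w \<in> bidisc" shows "holo2_on bidisc (unit_szego w)"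
proof -
  have "holo2_on bidisc (\<lambda>z. szego z w)"
    unfolding holo2_on_def
    by (intro ballI exI) (rule szego_has_derivative[OF _ subsetD[OF bidisc_subset_cbidisc assms]])
  from holo2_on_cmult[OF this] show ?thesis unfolding unit_szego_def[abs_def] .
qed

lemma continuous_on_unit_szego:
  assumes "w \<in> bidisc" shows "continuous_on cbidisc (unit_szego w)"
proof -
  have w: "cmod (cnj (fst w)) < 1" "cmod (cnj (snd w)) < 1" using assms by (simp_all add: bidisc_def mem_Times_iff)
  have ne: "1 - fst z * cnj (fst w) \<noteq> 0" "1 - snd z * cnj (snd w) \<noteq> 0" if z: "z \<in> cbidisc" for z
  proof -
    have "cmod (fst z) \<le> 1" "cmod (snd z) \<le> 1" using z by (simp_all add: cbidisc_def mem_Times_iff)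
    then show "1 - fst z * cnj (fst w) \<noteq> 0" "1 - snd z * cnj (snd w) \<noteq> 0"
      using norm_mult_lt_one[OF w(1), of "fst z"] norm_mult_lt_one[OF w(2), of "snd z"]
      by (simp_all only: mult.commute[of "cnj _"] not_False_eq_True simp_thms)
  qed
  have "(1 - fst z * cnj (fst w)) * (1 - snd z * cnj (snd w)) \<noteq> 0" if "z \<in> cbidisc" for z
    using ne[OF that] by (rule no_zero_divisors)
  then show ?thesis unfolding unit_szego_def[abs_def] szego_def
    by (intro continuous_on_mult continuous_on_divide continuous_on_const continuous_on_diff
      continuous_on_fst continuous_on_snd continuous_on_id ballI)
qed

text \<open>In modulus the dilation can be moved from the argument of the kernel to its parameter.
  The reproducing identity then evaluates the mean as
  \<open>szego (r *\<^sub>R w) (r *\<^sub>R w)\<close>, up to normalisation, and this does not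
  exceed \<open>szego w w\<close>.\<close>

lemma H2mean_unit_szego:
  assumes w: "w \<in> bidisc" and r: "0 \<le> r" "r < 1"
  shows "H2mean r (unit_szego w) \<le> 1"
proof -
  define A where "A = (1 - (cmod (fst w))\<^sup>2) * (1 - (cmod (snd w))\<^sup>2)"
  have w1: "cmod (fst w) < 1" "cmod (snd w) < 1" using w by (auto simp: bidisc_def)
  have A: "0 < A" unfolding A_def by (intro mult_pos_pos one_minus_square_bounds w1)
  have rw: "r *\<^sub>R w \<in> bidisc" using scaleR_in_bidisc[OF subsetD[OF bidisc_subset_cbidisc w] r] .
  have e: "cmod (1 - of_real r * u * cnj v) = cmod (1 - of_real r * v * cnj u)" for u v
  proof -
    have "cmod (1 - of_real r * u * cnj v) = cmod (cnj (1 - of_real r * u * cnj v))" by (simp only: complex_mod_cnj)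
    then show ?thesis by (simp add: mult_ac)
  qed
  have 1: "(cmod (unit_szego w (r *\<^sub>R tor \<theta>)))\<^sup>2 = A * (cmod (szego (r *\<^sub>R w) (tor \<theta>)))\<^sup>2" for \<theta>
  proof -
    have "cmod (szego (r *\<^sub>R tor \<theta>) w) = cmod (szego (r *\<^sub>R w) (tor \<theta>))"
      unfolding szego_def norm_divide norm_mult fst_scaleR snd_scaleR scaleR_conv_of_real
        e[of "fst (tor \<theta>)" "fst w"] e[of "snd (tor \<theta>)" "snd w"] by (rule refl)
    moreover have "(cmod (complex_of_real (sqrt A)))\<^sup>2 = A" using A by simp
    ultimately show ?thesis unfolding unit_szego_def A_def[symmetric] norm_mult power_mult_distrib by (simp only:)
  qed
  have c: "continuous_on tbox (\<lambda>\<theta>. szego (r *\<^sub>R w) (tor \<theta>))"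
    by (intro continuous_on_szego continuous_intros) (auto simp: rw tor_in_cbidisc)
  have "complex_of_real (integral tbox (\<lambda>\<theta>. (cmod (szego (r *\<^sub>R w) (tor \<theta>)))\<^sup>2)) = integral tbox (\<lambda>\<theta>. szego (r *\<^sub>R w) (tor \<theta>) * cnj (szego (r *\<^sub>R w) (tor \<theta>)))"
    unfolding complex_norm_square[symmetric]
    by (intro integral_complex_of_real'[symmetric] integrable_continuous continuous_intros c)
  also have "\<dots> = 4 * pi\<^sup>2 * szego (r *\<^sub>R w) (r *\<^sub>R w)" by (rule szego_reproducing[OF rw rw])
  also have "szego (r *\<^sub>R w) (r *\<^sub>R w) = of_real (1 / ((1 - (cmod (fst (r *\<^sub>R w)))\<^sup>2) * (1 - (cmod (snd (r *\<^sub>R w)))\<^sup>2)))"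
  proof -
    have "1 - u * cnj u = of_real (1 - (cmod u)\<^sup>2)" for u
      by (simp only: of_real_diff of_real_1 complex_norm_square)
    then show ?thesis unfolding szego_def by (simp only: of_real_mult of_real_divide of_real_1)
  qed
  finally have "complex_of_real (integral tbox (\<lambda>\<theta>. (cmod (szego (r *\<^sub>R w) (tor \<theta>)))\<^sup>2)) =
     of_real (4 * pi\<^sup>2 * (1 / ((1 - (cmod (fst (r *\<^sub>R w)))\<^sup>2) * (1 - (cmod (snd (r *\<^sub>R w)))\<^sup>2))))" by (simp only: of_real_mult)
  then have 2: "integral tbox (\<lambda>\<theta>. (cmod (szego (r *\<^sub>R w) (tor \<theta>)))\<^sup>2) =
     4 * pi\<^sup>2 * (1 / ((1 - (cmod (fst (r *\<^sub>R w)))\<^sup>2) * (1 - (cmod (snd (r *\<^sub>R w)))\<^sup>2)))" by (simp only: of_real_eq_iff)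
  have le: "1 - (cmod z)\<^sup>2 \<le> 1 - (cmod (r *\<^sub>R z))\<^sup>2" for z :: complex
  proof -
    have "cmod (r *\<^sub>R z) \<le> cmod z" using mult_left_le_one_le[of "cmod z" r] r by simp
    then have "(cmod (r *\<^sub>R z))\<^sup>2 \<le> (cmod z)\<^sup>2" by (rule power_mono) simp
    then show ?thesis by linarith
  qed
  define X where "X = (1 - (cmod (fst (r *\<^sub>R w)))\<^sup>2) * (1 - (cmod (snd (r *\<^sub>R w)))\<^sup>2)"
  have "A \<le> X"
    unfolding A_def X_def fst_scaleR snd_scaleR
    by (rule mult_mono[OF le le order_trans[OF less_imp_le[OF one_minus_square_bounds(1)[OF w1(1)]] le]
      less_imp_le[OF one_minus_square_bounds(1)[OF w1(2)]]])
  then have "A * (1 / X) \<le> 1" using A by (simp add: divide_le_eq_1)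
  then have "4 * pi\<^sup>2 * (A * (1 / X)) \<le> 4 * pi\<^sup>2 * 1" by (rule mult_left_mono) simp
  moreover have "A * integral tbox (\<lambda>\<theta>. (cmod (szego (r *\<^sub>R w) (tor \<theta>)))\<^sup>2) = 4 * pi\<^sup>2 * (A * (1 / X))"
    unfolding 2 X_def[symmetric] by (rule mult.left_commute)
  ultimately have "A * integral tbox (\<lambda>\<theta>. (cmod (szego (r *\<^sub>R w) (tor \<theta>)))\<^sup>2) \<le> 4 * pi\<^sup>2" by linarith
  then show ?thesis unfolding H2mean_eq 1 by simp
qed

lemma unit_szego_bound:
  assumes w: "w \<in> bidisc" and y: "y \<in> cbidisc" and r: "0 \<le> r" "r < 1"
    and s: "(1 - (cmod (fst w))\<^sup>2) * (1 - (cmod (snd w))\<^sup>2) \<le> s"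
  shows "cmod (unit_szego w (r *\<^sub>R y)) \<le> sqrt s / (1 - r)\<^sup>2"
proof -
  have w1: "cmod (fst w) < 1" "cmod (snd w) < 1" using w by (auto simp: bidisc_def)
  have p: "0 < (1 - (cmod (fst w))\<^sup>2) * (1 - (cmod (snd w))\<^sup>2)"
    by (intro mult_pos_pos one_minus_square_bounds w1)
  have "cmod (unit_szego w (r *\<^sub>R y)) = sqrt ((1 - (cmod (fst w))\<^sup>2) * (1 - (cmod (snd w))\<^sup>2)) * cmod (szego (r *\<^sub>R y) w)"
    unfolding unit_szego_def using p by (simp add: norm_mult del: real_sqrt_mult)
  also have "\<dots> \<le> sqrt s * (1 / (1 - r)\<^sup>2)"
    using s p order_trans[OF less_imp_le[OF p] s]
    by (intro mult_mono szego_dilated_bound[OF y subsetD[OF bidisc_subset_cbidisc w] r]) auto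
  finally show ?thesis by simp
qed

text \<open>The offset 2 keeps \<open>1 - rad n\<close> at most 1/2; an interval of this length
  around a point of a period fits inside the period on at least one side.\<close>

abbreviation "rad n \<equiv> 1 - 1 / (real n + 2)"

context smooth_self_map
begin

text \<open>Compactness provides a norm limit along a subsequence, and locally uniform convergence
  of the test functions to 0 forces that limit to be 0. Continuity of the test functions on the
  closed bidisc turns small means into a small integral over the torus.\<close>

lemma compact_test_functions:
  assumes C: "compact_comp_H2 \<phi>"
    and T: "\<And>n. holo2_on bidisc (T n)" "\<And>n. continuous_on cbidisc (T n)"
    and N: "\<And>n r. 0 < r \<Longrightarrow> r < 1 \<Longrightarrow> H2mean r (T n) \<le> 1"
    and U: "\<And>r. 0 < r \<Longrightarrow> r < 1 \<Longrightarrow> uniform_limit cbidisc (\<lambda>n y. T n (r *\<^sub>R y)) (\<lambda>y. 0) sequentially"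
    and c: "0 < c"
  shows "\<exists>n. integral tbox (\<lambda>\<theta>. (cmod (T n (\<phi> (tor \<theta>))))\<^sup>2) < c"
proof -
  have TH: "T n \<in> H2" "H2norm (T n) \<le> 1" for n
  proof -
    show "T n \<in> H2" by (rule H2I(1)[OF T(1), of _ 1]) (rule N)
    have "H2norm (T n) \<le> sqrt 1" by (rule H2I(2)[OF T(1)]) (rule N)
    then show "H2norm (T n) \<le> 1" by simp
  qed
  have "\<bar>H2norm (T n)\<bar> \<le> 1" for n using TH(2)[of n] H2norm_nonneg[OF TH(1)[of n]] by linarith
  then have "bounded (range (\<lambda>n. H2norm (T n)))"
    unfolding bounded_iff by (intro exI[of _ 1]) simp
  with TH(1) have ex: "(\<forall>n. T n \<in> H2) \<and> bounded (range (\<lambda>n. H2norm (T n)))" by simp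
  note C' = C[unfolded compact_comp_H2_def]
  from mp[OF spec[OF conjunct2[OF C']] ex] obtain s g where s: "strict_mono (s :: nat \<Rightarrow> nat)" and g: "g \<in> H2"
    and lim: "(\<lambda>k. H2norm (\<lambda>z. T (s k) (\<phi> z) - g z)) \<longlonglongrightarrow> 0" by (elim exE conjE)
  have memb: "(\<lambda>z. T n (\<phi> z)) \<in> H2" for n by (rule bspec[OF conjunct1[OF C'] TH(1)])
  have gh: "holo2_on bidisc g" using g by (simp add: H2_def)
  define D where "D = (\<lambda>k z. T (s k) (\<phi> z) - g z)"
  have DH: "D k \<in> H2" for k unfolding D_def by (rule H2_diff[OF memb g])
  have Dh: "holo2_on bidisc (D k)" for k using DH[of k] by (simp add: H2_def)
  have comph: "holo2_on bidisc (\<lambda>z. T n (\<phi> z))" for n by (rule holo2_on_comp[OF T(1)])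
  have lim2: "(\<lambda>k. (H2norm (D k))\<^sup>2) \<longlonglongrightarrow> 0"
    using tendsto_power[OF lim, of 2] by (simp add: D_def)
  \<comment> \<open>At a fixed radius the symbol takes values in a compact part of the open bidisc,
    so the composed test functions tend to 0 uniformly there, while their distance to
    \<open>g\<close> in mean also tends to 0.\<close>
  have g0: "H2mean r g \<le> 0" if r: "0 < r" "r < 1" for r
  proof (rule field_le_epsilon)
    fix e :: real assume e: "0 < e"
    have c': "continuous_on cbidisc (\<lambda>y. max (cmod (fst (\<phi> (r *\<^sub>R y)))) (cmod (snd (\<phi> (r *\<^sub>R y)))))"
      using r by (intro continuous_intros continuous_on_compose2[OF cont_\<phi>] image_subsetI scaleR_in_cbidisc) auto
    have ne: "cbidisc \<noteq> {}" using tor_in_cbidisc by blast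
    from continuous_attains_sup[OF compact_cbidisc ne c'] obtain y0 where y0: "y0 \<in> cbidisc"
      and ymax: "\<And>y. y \<in> cbidisc \<Longrightarrow> max (cmod (fst (\<phi> (r *\<^sub>R y)))) (cmod (snd (\<phi> (r *\<^sub>R y)))) \<le> max (cmod (fst (\<phi> (r *\<^sub>R y0)))) (cmod (snd (\<phi> (r *\<^sub>R y0))))"
      by blast
    define m where "m = max (cmod (fst (\<phi> (r *\<^sub>R y0)))) (cmod (snd (\<phi> (r *\<^sub>R y0))))"
    have m1: "m < 1" unfolding m_def
      using maps_bidisc[OF scaleR_in_bidisc[OF y0 _ r(2)]] r by (auto simp: bidisc_def mem_Times_iff)
    have m0: "0 \<le> m" unfolding m_def by (meson max.coboundedI1 norm_ge_zero)
    \<comment> \<open>Strictly between \<open>m\<close> and 1, and positive even when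
      \<open>m = 0\<close>, so that symbol values can be written as
      \<open>\<rho> *\<^sub>R y\<close> with \<open>y\<close> in the closed bidisc.\<close>
    define \<rho> where "\<rho> = (1 + m) / 2"
    have \<rho>: "0 < \<rho>" "\<rho> < 1" "m \<le> \<rho>" using m0 m1 by (auto simp: \<rho>_def)
    have "0 < sqrt (e / 4)" using e by simp
    with U[OF \<rho>(1,2)] obtain n0 where n0: "\<And>n y. n \<ge> n0 \<Longrightarrow> y \<in> cbidisc \<Longrightarrow> dist (T n (\<rho> *\<^sub>R y)) 0 < sqrt (e / 4)"
      unfolding uniform_limit_sequentially_iff by blast
    have "eventually (\<lambda>k. (H2norm (D k))\<^sup>2 < e / 4) sequentially"
      using e by (intro order_tendstoD(2)[OF lim2]) simp
    then obtain k0 where k0: "\<And>k. k \<ge> k0 \<Longrightarrow> (H2norm (D k))\<^sup>2 < e / 4" unfolding eventually_sequentially by blast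
    define k where "k = max n0 k0"
    have sk: "n0 \<le> s k" using seq_suble[OF s, of k] by (simp add: k_def)
    have "integral tbox (\<lambda>\<theta>. (cmod (T (s k) (\<phi> (r *\<^sub>R tor \<theta>))))\<^sup>2) \<le> integral tbox (\<lambda>_. e / 4)"
    proof (intro integral_le integrable_continuous continuous_intros)
      show "continuous_on tbox (\<lambda>\<theta>. T (s k) (\<phi> (r *\<^sub>R tor \<theta>)))"
        using r by (intro continuous_on_tbox_tor_dilated[OF comph]) auto
      fix \<theta>
      define y where "y = (1 / \<rho>) *\<^sub>R \<phi> (r *\<^sub>R tor \<theta>)"
      have "cmod (fst (\<phi> (r *\<^sub>R tor \<theta>))) \<le> \<rho>" "cmod (snd (\<phi> (r *\<^sub>R tor \<theta>))) \<le> \<rho>"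
        using ymax[OF tor_in_cbidisc[of \<theta>]] \<rho>(3) unfolding m_def by linarith+
      then have y: "y \<in> cbidisc" using \<rho> by (simp add: y_def cbidisc_def mem_Times_iff)
      have "\<phi> (r *\<^sub>R tor \<theta>) = \<rho> *\<^sub>R y" using \<rho> by (simp add: y_def)
      then have "cmod (T (s k) (\<phi> (r *\<^sub>R tor \<theta>))) \<le> sqrt (e / 4)" using n0[OF sk y] by (simp add: less_imp_le)
      then have "(cmod (T (s k) (\<phi> (r *\<^sub>R tor \<theta>))))\<^sup>2 \<le> (sqrt (e / 4))\<^sup>2" by (intro power_mono) auto
      then show "(cmod (T (s k) (\<phi> (r *\<^sub>R tor \<theta>))))\<^sup>2 \<le> e / 4" using e by simp
    qed
    then have 1: "H2mean r (\<lambda>z. T (s k) (\<phi> z)) \<le> e / 4"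
      unfolding H2mean_eq by (simp add: content_Pair power2_eq_square field_simps)
    have "H2mean r (\<lambda>z. T (s k) (\<phi> z) - D k z) \<le> 2 * H2mean r (\<lambda>z. T (s k) (\<phi> z)) + 2 * H2mean r (D k)"
      using r by (intro H2mean_diff_le comph Dh) auto
    also have "(\<lambda>z. T (s k) (\<phi> z) - D k z) = g" by (simp add: D_def)
    also have "2 * H2mean r (\<lambda>z. T (s k) (\<phi> z)) + 2 * H2mean r (D k) \<le> 2 * (e / 4) + 2 * (e / 4)"
      using 1 H2mean_le_norm[OF DH r, of k] k0[of k] by (intro add_mono mult_left_mono) (auto simp: k_def)
    finally show "H2mean r g \<le> 0 + e" by simp
  qed
  \<comment> \<open>The means of the composed test function are at most \<open>2 * e\<close>, which
    after multiplication by \<open>4 * pi\<^sup>2\<close> is half of \<open>c\<close>; the other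
    half gives strictness.\<close>
  define e where "e = c / (4 * pi\<^sup>2) / 4"
  have e: "0 < e" using c by (simp add: e_def)
  from order_tendstoD(2)[OF lim2 this] obtain k where k: "(H2norm (D k))\<^sup>2 < e" unfolding eventually_sequentially by blast
  have r: "H2mean r (\<lambda>z. T (s k) (\<phi> z)) \<le> 2 * e" if r: "0 < r" "r < 1" for r
  proof -
    have dh: "holo2_on bidisc (\<lambda>z. T (s k) (\<phi> z) - D k z)" by (simp add: D_def gh)
    have "H2mean r (\<lambda>z. D k z - (0 - g z)) \<le> 2 * H2mean r (D k) + 2 * H2mean r (\<lambda>z. 0 - g z)"
      using r holo2_on_cmult[OF gh, of "- 1"] by (intro H2mean_diff_le Dh) auto
    also have "(\<lambda>z. D k z - (0 - g z)) = (\<lambda>z. T (s k) (\<phi> z))" by (simp add: D_def)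
    also have "H2mean r (\<lambda>z. 0 - g z) = H2mean r g" by (simp add: H2mean_def)
    finally show ?thesis using g0[OF r] H2mean_le_norm[OF DH r, of k] k by linarith
  qed
  have hc: "continuous_on ({0..1} \<times> tbox) (\<lambda>p. (\<lambda>r \<theta>. T (s k) (\<phi> (r *\<^sub>R tor \<theta>))) (fst p) (snd p))"
    by (intro continuous_on_compose2[OF T(2)] continuous_on_compose2[OF cont_\<phi>] continuous_intros)
       (simp_all add: image_subset_iff mem_Times_iff maps_cbidisc scaleR_in_cbidisc[OF tor_in_cbidisc])
  have "integral tbox (\<lambda>\<theta>. (cmod (T (s k) (\<phi> (1 *\<^sub>R tor \<theta>))))\<^sup>2) \<le> 4 * pi\<^sup>2 * (2 * e)"
  proof (rule tbox_mean_le[OF hc])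
    fix t :: real assume "0 < t" "t < 1"
    from r[OF this] show "integral tbox (\<lambda>\<theta>. (cmod (T (s k) (\<phi> (t *\<^sub>R tor \<theta>))))\<^sup>2) \<le> 4 * pi\<^sup>2 * (2 * e)"
      unfolding H2mean_eq by (simp add: field_simps)
  qed
  also have "\<dots> < c" using c by (simp add: e_def)
  finally show ?thesis by auto
qed

text \<open>The parameter approaches the boundary point \<open>(\<eta>1, \<eta>2)\<close> radially.
  One unimodular coordinate suffices for the normalising factor to tend to 0, so the other may be 0,
  which isolates a single coordinate of the symbol.\<close>

lemma compact_unit_szego:
  assumes C: "compact_comp_H2 \<phi>" and \<eta>: "cmod \<eta>1 \<le> 1" "cmod \<eta>2 \<le> 1" "cmod \<eta>1 = 1 \<or> cmod \<eta>2 = 1" and c: "0 < c"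
  shows "\<exists>n. integral tbox (\<lambda>\<theta>. (cmod (unit_szego (rad n *\<^sub>R (\<eta>1, \<eta>2)) (\<phi> (tor \<theta>))))\<^sup>2) < c"
proof (rule compact_test_functions[OF C _ _ _ _ c])
  have rad: "0 \<le> rad n" "rad n < 1" for n by (auto simp: field_simps)
  have "(\<eta>1, \<eta>2) \<in> cbidisc" using \<eta> by (simp add: cbidisc_def)
  then have w: "rad n *\<^sub>R (\<eta>1, \<eta>2) \<in> bidisc" for n by (intro scaleR_in_bidisc rad)
  show "holo2_on bidisc (unit_szego (rad n *\<^sub>R (\<eta>1, \<eta>2)))" for n by (rule holo2_on_unit_szego[OF w])
  show "continuous_on cbidisc (unit_szego (rad n *\<^sub>R (\<eta>1, \<eta>2)))" for n by (rule continuous_on_unit_szego[OF w])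
  show "H2mean r (unit_szego (rad n *\<^sub>R (\<eta>1, \<eta>2))) \<le> 1" if "0 < r" "r < 1" for n r
    by (rule H2mean_unit_szego[OF w less_imp_le[OF that(1)] that(2)])
  \<comment> \<open>The unimodular coordinate contributes \<open>1 - (rad n)\<^sup>2\<close>, at
    most twice the distance \<open>1 - rad n\<close>; the other coordinate contributes at most
    1.\<close>
  have sb: "(1 - (cmod (fst (rad n *\<^sub>R (\<eta>1, \<eta>2))))\<^sup>2) * (1 - (cmod (snd (rad n *\<^sub>R (\<eta>1, \<eta>2))))\<^sup>2) \<le> 2 / (real n + 2)" for n
  proof -
    have w1: "cmod (fst (rad n *\<^sub>R (\<eta>1, \<eta>2))) < 1" "cmod (snd (rad n *\<^sub>R (\<eta>1, \<eta>2))) < 1" using w[of n] by (auto simp: bidisc_def)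
    note b1 = one_minus_square_bounds[OF w1(1)] and b2 = one_minus_square_bounds[OF w1(2)]
    have "1 - (1 - x)\<^sup>2 \<le> 2 * x" for x :: real by (simp add: power2_diff)
    from this[of "1 / (real n + 2)"] have r2: "1 - (rad n)\<^sup>2 \<le> 2 / (real n + 2)" by simp
    have sq: "(cmod (t *\<^sub>R \<eta>))\<^sup>2 = t\<^sup>2" if "cmod \<eta> = 1" for \<eta> :: complex and t using that by simp
    show ?thesis
    proof (cases "cmod \<eta>1 = 1")
      case True
      have "(1 - (cmod (fst (rad n *\<^sub>R (\<eta>1, \<eta>2))))\<^sup>2) * (1 - (cmod (snd (rad n *\<^sub>R (\<eta>1, \<eta>2))))\<^sup>2) \<le> (1 - (cmod (fst (rad n *\<^sub>R (\<eta>1, \<eta>2))))\<^sup>2) * 1"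
        using b1 b2 by (intro mult_left_mono) auto
      also have "\<dots> = 1 - (rad n)\<^sup>2" unfolding fst_scaleR fst_conv sq[OF True] mult_1_right ..
      finally show ?thesis using r2 by linarith
    next
      case False
      then have t: "cmod \<eta>2 = 1" using \<eta> by blast
      have "(1 - (cmod (fst (rad n *\<^sub>R (\<eta>1, \<eta>2))))\<^sup>2) * (1 - (cmod (snd (rad n *\<^sub>R (\<eta>1, \<eta>2))))\<^sup>2) \<le> 1 * (1 - (cmod (snd (rad n *\<^sub>R (\<eta>1, \<eta>2))))\<^sup>2)"
        using b1 b2 by (intro mult_right_mono) auto
      also have "\<dots> = 1 - (rad n)\<^sup>2" unfolding snd_scaleR snd_conv sq[OF t] mult_1_left ..
      finally show ?thesis using r2 by linarith
    qed
  qed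
  show "uniform_limit cbidisc (\<lambda>n y. unit_szego (rad n *\<^sub>R (\<eta>1, \<eta>2)) (r *\<^sub>R y)) (\<lambda>y. 0) sequentially"
    if r: "0 < r" "r < 1" for r
    unfolding uniform_limit_sequentially_iff
  proof (intro allI impI)
    fix e :: real assume e: "0 < e"
    have "(\<lambda>n. sqrt (2 / (real n + 2))) \<longlonglongrightarrow> 0" by real_asymp
    from tendsto_mult_left_zero[OF this, of "1 / (1 - r)\<^sup>2"]
    have "(\<lambda>n. sqrt (2 / (real n + 2)) / (1 - r)\<^sup>2) \<longlonglongrightarrow> 0" by simp
    from order_tendstoD(2)[OF this e] obtain n0 where n0: "\<And>n. n \<ge> n0 \<Longrightarrow> sqrt (2 / (real n + 2)) / (1 - r)\<^sup>2 < e" unfolding eventually_sequentially by blast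
    have "dist (unit_szego (rad n *\<^sub>R (\<eta>1, \<eta>2)) (r *\<^sub>R y)) 0 < e" if "n \<ge> n0" "y \<in> cbidisc" for n y
      using le_less_trans[OF unit_szego_bound[OF w[of n] that(2) less_imp_le[OF r(1)] r(2) sb[of n]] n0[OF that(1)]]
      by (simp only: dist_norm diff_0_right)
    then show "\<exists>N. \<forall>n\<ge>N. \<forall>y\<in>cbidisc. dist (unit_szego (rad n *\<^sub>R (\<eta>1, \<eta>2)) (r *\<^sub>R y)) 0 < e"
      by (intro exI[of _ n0] allI impI ballI)
  qed
qed

end


subsection \<open>Level sets of a symbol of a compact operator\<close>

text \<open>With \<open>\<delta> = 1 - rad n\<close>, the hypothesis says that \<open>z\<close> is
  within \<open>L * \<delta>\<close> of the contact value. The denominator is then at most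
  \<open>(\<delta> * (1 + L))\<^sup>2\<close> while the numerator is at least
  \<open>\<delta>\<close>, so the kernel has height of order \<open>1 / \<delta>\<close>.\<close>

lemma kernel_lower_bound:
  assumes z: "cmod z \<le> 1" and \<eta>: "cmod \<eta> = 1" and L: "0 \<le> L" "cmod (z - \<eta>) \<le> L * (1 / (real n + 2))"
  shows "(real n + 2) / (1 + L)\<^sup>2 \<le> (1 - (rad n)\<^sup>2) / (cmod (1 - of_real (rad n) * cnj \<eta> * z))\<^sup>2"
proof -
  define a where "a = rad n"
  define \<delta> where "\<delta> = 1 / (real n + 2)"
  have \<delta>: "0 < \<delta>" "\<delta> \<le> 1 / 2" "a = 1 - \<delta>" by (auto simp: \<delta>_def a_def field_simps)
  have a: "0 \<le> a" "a < 1" using \<delta> by auto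
  have a2: "\<delta> \<le> 1 - a\<^sup>2"
  proof -
    have "a\<^sup>2 \<le> a" using a by (simp add: power2_eq_square mult_left_le)
    then show ?thesis using \<delta> by linarith
  qed
  have u: "cnj \<eta> * \<eta> = 1" using \<eta> complex_norm_square[of \<eta>] by (simp add: mult.commute)
  have aeta: "cmod (of_real a * cnj \<eta>) < 1" using a \<eta> by (simp add: norm_mult)
  have ne: "1 - of_real a * cnj \<eta> * z \<noteq> 0" by (rule norm_mult_lt_one[OF aeta z])
  \<comment> \<open>Expansion at the contact value: since \<open>\<eta>\<close> is unimodular, the
    distance to 1 is \<open>\<delta>\<close> up to an error linear in
    \<open>z - \<eta>\<close>.\<close>
  have "of_real \<delta> - of_real a * cnj \<eta> * (z - \<eta>) = of_real \<delta> + of_real a * (cnj \<eta> * \<eta>) - of_real a * cnj \<eta> * z"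
    by (simp add: algebra_simps)
  then have "1 - of_real a * cnj \<eta> * z = of_real \<delta> - of_real a * cnj \<eta> * (z - \<eta>)"
    unfolding u using \<delta>(3) by simp
  then have "cmod (1 - of_real a * cnj \<eta> * z) \<le> cmod (of_real \<delta>) + cmod (of_real a * cnj \<eta> * (z - \<eta>))"
    by (simp only: norm_triangle_ineq4)
  also have "cmod (of_real a * cnj \<eta> * (z - \<eta>)) \<le> 1 * (L * \<delta>)"
    unfolding norm_mult[of "of_real a * cnj \<eta>"] using aeta L(2) by (intro mult_mono) (auto simp: \<delta>_def)
  finally have "cmod (1 - of_real a * cnj \<eta> * z) \<le> cmod (of_real \<delta>) + 1 * (L * \<delta>)" by simp
  moreover have "cmod (of_real \<delta>) + 1 * (L * \<delta>) = \<delta> * (1 + L)" using \<delta>(1) by (simp add: algebra_simps)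
  ultimately have "cmod (1 - of_real a * cnj \<eta> * z) \<le> \<delta> * (1 + L)" by (simp only:)
  then have le: "(cmod (1 - of_real a * cnj \<eta> * z))\<^sup>2 \<le> (\<delta> * (1 + L))\<^sup>2" by (intro power_mono) auto
  have "(real n + 2) / (1 + L)\<^sup>2 = 1 / (\<delta> * (1 + L)\<^sup>2)" by (simp add: \<delta>_def)
  also have "\<dots> = \<delta> / (\<delta> * (1 + L))\<^sup>2" using \<delta> by (simp add: power2_eq_square)
  also have "\<dots> \<le> (1 - a\<^sup>2) / (cmod (1 - of_real a * cnj \<eta> * z))\<^sup>2" using a2 le ne \<delta> by (intro frac_le) auto
  finally show ?thesis unfolding a_def .
qed

text \<open>A point near an end of the period has room on one side only, hence the choice of side
  according to its position relative to \<open>pi\<close>.\<close>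

lemma interval_in_period:
  assumes "x0 \<in> {0..2*pi}" "0 < \<delta>" "\<delta> \<le> (1/2 :: real)"
  obtains l where "0 \<le> l" "l + \<delta> \<le> 2 * pi" "\<And>x. x \<in> {l..l + \<delta>} \<Longrightarrow> \<bar>x - x0\<bar> \<le> \<delta>"
  by (rule that[of "if x0 \<le> pi then x0 else x0 - \<delta>"]) (use assms pi_gt3 in \<open>auto split: if_splits\<close>)

text \<open>An interval of length \<open>1 / (real n + 2)\<close> near the contact point carries a
  kernel of height at least \<open>(real n + 2) / (1 + K)\<^sup>2\<close>; the powers of
  \<open>n\<close> cancel.\<close>

lemma kernel_integral_lower_bound:
  fixes \<Phi> :: "real \<Rightarrow> complex"
  assumes c: "continuous_on {0..2*pi} \<Phi>" and le1: "\<And>x. cmod (\<Phi> x) \<le> 1" and \<eta>: "cmod \<eta> = 1"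
    and x0: "x0 \<in> {0..2*pi}" and K: "0 \<le> K" "\<And>x. x \<in> {0..2*pi} \<Longrightarrow> cmod (\<Phi> x - \<eta>) \<le> K * \<bar>x - x0\<bar>"
  shows "1 / (1 + K)\<^sup>2 \<le> integral {0..2*pi} (\<lambda>x. (1 - (rad n)\<^sup>2) / (cmod (1 - of_real (rad n) * cnj \<eta> * \<Phi> x))\<^sup>2)"
proof -
  define \<delta> where "\<delta> = 1 / (real n + 2)"
  have \<delta>: "0 < \<delta>" "\<delta> \<le> 1 / 2" by (auto simp: \<delta>_def field_simps)
  have r: "0 \<le> rad n" "rad n < 1" by (auto simp: field_simps)
  then have "cmod (of_real (rad n) * cnj \<eta>) < 1" unfolding norm_mult norm_of_real complex_mod_cnj \<eta> by simp
  from norm_mult_lt_one[OF this le1] have ne: "(cmod (1 - of_real (rad n) * cnj \<eta> * \<Phi> x))\<^sup>2 \<noteq> 0" for x by simp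
  have a2: "0 \<le> 1 - (rad n)\<^sup>2" using power_le_one[OF r(1), of 2] r by simp
  obtain l where l: "0 \<le> l" "l + \<delta> \<le> 2 * pi" and lx: "\<And>x. x \<in> {l..l + \<delta>} \<Longrightarrow> \<bar>x - x0\<bar> \<le> \<delta>"
    using interval_in_period[OF x0 \<delta>] by blast
  let ?f = "\<lambda>x. (1 - (rad n)\<^sup>2) / (cmod (1 - of_real (rad n) * cnj \<eta> * \<Phi> x))\<^sup>2"
  have fc: "continuous_on {0..2*pi} ?f" using ne by (intro continuous_intros c ballI)
  have sub: "{l..l + \<delta>} \<subseteq> {0..2*pi}" using l by auto
  have f0: "0 \<le> ?f x" for x using a2 by (intro divide_nonneg_nonneg) auto
  have "1 / (1 + K)\<^sup>2 = integral {l..l + \<delta>} (\<lambda>x. (real n + 2) / (1 + K)\<^sup>2)" using \<delta> by (simp add: \<delta>_def)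
  also have "\<dots> \<le> integral {l..l + \<delta>} ?f"
  proof (rule integral_le)
    show "?f integrable_on {l..l + \<delta>}" by (rule integrable_continuous_real[OF continuous_on_subset[OF fc sub]])
    show "(\<lambda>x. (real n + 2) / (1 + K)\<^sup>2) integrable_on {l..l + \<delta>}" by (rule integrable_const_ivl)
    fix x assume x: "x \<in> {l..l + \<delta>}"
    have "cmod (\<Phi> x - \<eta>) \<le> K * \<delta>" using K(2)[of x] lx[OF x] K(1) x sub by (meson mult_left_mono order_trans subsetD)
    then show "(real n + 2) / (1 + K)\<^sup>2 \<le> ?f x" unfolding \<delta>_def by (rule kernel_lower_bound[OF le1 \<eta> K(1)])
  qed
  also have "\<dots> \<le> integral {0..2*pi} ?f"
    using f0 by (intro integral_subset_le sub integrable_continuous_real[OF continuous_on_subset[OF fc sub]] integrable_continuous_real[OF fc]) auto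
  finally show ?thesis .
qed

lemma cis_shift_into_period:
  obtains x' where "x' \<in> {0..<2*pi}" "cis x' = cis x"
proof -
  define x' where "x' = x - 2 * pi * of_int \<lfloor>x / (2 * pi)\<rfloor>"
  have "of_int \<lfloor>x / (2 * pi)\<rfloor> \<le> x / (2 * pi)" "x / (2 * pi) < of_int \<lfloor>x / (2 * pi)\<rfloor> + 1" by linarith+
  then have "of_int \<lfloor>x / (2 * pi)\<rfloor> * (2 * pi) \<le> x" "x < (of_int \<lfloor>x / (2 * pi)\<rfloor> + 1) * (2 * pi)"
    using iffD1[OF pos_le_divide_eq[of "2 * pi"]] iffD1[OF pos_divide_less_eq[of "2 * pi"]] by (metis mult_pos_pos pi_gt_zero zero_less_numeral)+
  then have 1: "x' \<in> {0..<2*pi}" by (auto simp: x'_def algebra_simps)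
  have "cis x = cis x' * cis (2 * pi * of_int \<lfloor>x / (2 * pi)\<rfloor>)" unfolding cis_mult x'_def by simp
  also have "cis (2 * pi * of_int \<lfloor>x / (2 * pi)\<rfloor>) = 1" by (simp add: cis_multiple_2pi)
  finally show thesis using 1 that by simp
qed

context smooth_symbol
begin

text \<open>With \<open>w = rad n * \<eta>\<close> the integrand is the squared modulus on the torus of the composition of
  the symbol with the normalised Szego kernel of the disc at \<open>w\<close>; compactness forces these norms to
  become small, since the normalised kernels tend weakly to zero.\<close>

definition vanishing :: bool where
  "vanishing \<longleftrightarrow> (\<forall>\<eta> c. cmod \<eta> = 1 \<longrightarrow> 0 < c \<longrightarrow>
     (\<exists>n. integral tbox (\<lambda>\<theta>. (1 - (rad n)\<^sup>2) / (cmod (1 - of_real (rad n) * cnj \<eta> * F \<theta>))\<^sup>2) < c))"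

lemma F_Lipschitz:
  obtains K where "0 \<le> K" "\<And>x y. x \<in> tbox \<Longrightarrow> y \<in> tbox \<Longrightarrow> cmod (F x - F y) \<le> K * norm (x - y)"
proof -
  let ?A = "\<lambda>z. cmod (Dp z (fst z, 0)) + cmod (Dp z (0, snd z))"
  \<comment> \<open>Continuity of the derivative is available for fixed directions only; complex
    linearity extracts the varying factors \<open>fst z\<close> and \<open>snd z\<close>.\<close>
  have lin: "Dp z (fst z, 0) = fst z * Dp z (1, 0)" "Dp z (0, snd z) = snd z * Dp z (0, 1)" if "z \<in> cbidisc" for z
    using complex_linear_Dp'[OF that, of "fst z" 1 0] complex_linear_Dp'[OF that, of "snd z" 0 1] by simp_all
  have "continuous_on torus2 (\<lambda>z. cmod (fst z * Dp z (1, 0)) + cmod (snd z * Dp z (0, 1)))"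
    using torus2_subset_cbidisc subU by (intro continuous_intros continuous_on_subset[OF cont_Dp]) auto
  moreover have "compact torus2" unfolding torus2_def by (intro compact_Times) auto
  ultimately have "bounded ((\<lambda>z. cmod (fst z * Dp z (1, 0)) + cmod (snd z * Dp z (0, 1))) ` torus2)"
    by (intro compact_imp_bounded compact_continuous_image)
  then obtain K where K: "\<And>z. z \<in> torus2 \<Longrightarrow> \<bar>cmod (fst z * Dp z (1, 0)) + cmod (snd z * Dp z (0, 1))\<bar> \<le> K"
    unfolding bounded_iff by auto
  have K': "?A (tor \<theta>) \<le> K" for \<theta>
    using K[OF tor_in_torus2[of \<theta>]] lin[OF tor_in_cbidisc[of \<theta>]] by simp
  have K0: "0 \<le> K" using K'[of 0] by (smt (verit) norm_ge_zero)
  have "cmod (F x - F y) \<le> K * norm (x - y)" if "x \<in> tbox" "y \<in> tbox" for x y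
  proof (rule differentiable_bound[OF convex_box(1) has_derivative_at_withinI[OF F_has_derivative] _ that])
    fix \<theta>
    show "onorm (\<lambda>h. \<i> * (fst h *\<^sub>R Dp (tor \<theta>) (fst (tor \<theta>), 0) + snd h *\<^sub>R Dp (tor \<theta>) (0, snd (tor \<theta>)))) \<le> K"
    proof (rule onorm_le)
      fix h :: "real \<times> real"
      have "cmod (\<i> * (fst h *\<^sub>R Dp (tor \<theta>) (fst (tor \<theta>), 0) + snd h *\<^sub>R Dp (tor \<theta>) (0, snd (tor \<theta>))))
        \<le> \<bar>fst h\<bar> * cmod (Dp (tor \<theta>) (fst (tor \<theta>), 0)) + \<bar>snd h\<bar> * cmod (Dp (tor \<theta>) (0, snd (tor \<theta>)))"
        unfolding norm_mult norm_ii mult_1 by (rule norm_triangle_le) simp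
      also have "\<dots> \<le> norm h * cmod (Dp (tor \<theta>) (fst (tor \<theta>), 0)) + norm h * cmod (Dp (tor \<theta>) (0, snd (tor \<theta>)))"
        by (intro add_mono mult_right_mono abs_fst_le_norm abs_snd_le_norm) auto
      also have "\<dots> = ?A (tor \<theta>) * norm h" by (simp add: algebra_simps)
      also have "\<dots> \<le> K * norm h" by (intro mult_right_mono K') auto
      finally show "cmod (\<i> * (fst h *\<^sub>R Dp (tor \<theta>) (fst (tor \<theta>), 0) + snd h *\<^sub>R Dp (tor \<theta>) (0, snd (tor \<theta>)))) \<le> K * norm h" .
    qed
  qed
  with K0 that show thesis by blast
qed

lemma vanishing_kernel_continuous:
  assumes "cmod \<eta> = 1"
  shows "continuous_on S (\<lambda>\<theta>. (1 - (rad n)\<^sup>2) / (cmod (1 - of_real (rad n) * cnj \<eta> * F \<theta>))\<^sup>2)"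
    and "0 \<le> (1 - (rad n)\<^sup>2) / (cmod (1 - of_real (rad n) * cnj \<eta> * F \<theta>))\<^sup>2"
proof -
  have r: "0 \<le> rad n" "rad n < 1" by (auto simp: field_simps)
  then have "cmod (of_real (rad n) * cnj \<eta>) < 1" unfolding norm_mult norm_of_real complex_mod_cnj assms by simp
  from norm_mult_lt_one[OF this le1_F] have "1 - of_real (rad n) * cnj \<eta> * F \<theta> \<noteq> 0" for \<theta> .
  then have "(cmod (1 - of_real (rad n) * cnj \<eta> * F \<theta>))\<^sup>2 \<noteq> 0" for \<theta> by simp
  then show "continuous_on S (\<lambda>\<theta>. (1 - (rad n)\<^sup>2) / (cmod (1 - of_real (rad n) * cnj \<eta> * F \<theta>))\<^sup>2)"
    by (intro continuous_intros cont_F ballI)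
  have "(rad n)\<^sup>2 \<le> 1" using r by (intro power_le_one) auto
  then show "0 \<le> (1 - (rad n)\<^sup>2) / (cmod (1 - of_real (rad n) * cnj \<eta> * F \<theta>))\<^sup>2" by (intro divide_nonneg_nonneg) auto
qed

lemma outer_integral_lower_bound:
  fixes I :: "real \<Rightarrow> real"
  assumes I: "continuous_on {0..2*pi} I" "\<And>t. t \<in> {0..2*pi} \<Longrightarrow> 0 \<le> I t" "\<And>t. t \<in> {t0..t1} \<Longrightarrow> m \<le> I t"
    and t: "0 \<le> t0" "t0 < t1" "t1 \<le> 2 * pi"
  shows "m * (t1 - t0) \<le> integral {0..2*pi} I"
proof -
  have sub: "{t0..t1} \<subseteq> {0..2*pi}" using t by auto
  have "m * (t1 - t0) = integral {t0..t1} (\<lambda>_. m)" using t by simp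
  also have "\<dots> \<le> integral {t0..t1} I"
    by (intro integral_le integrable_const_ivl integrable_continuous_real[OF continuous_on_subset[OF I(1) sub]] I(3))
  also have "\<dots> \<le> integral {0..2*pi} I"
    by (intro integral_subset_le sub integrable_continuous_real[OF continuous_on_subset[OF I(1) sub]] integrable_continuous_real[OF I(1)] I(2) ballI)
  finally show ?thesis .
qed

text \<open>The level set \<open>F = \<eta>\<close> meets a family of coordinate lines of positive measure; on each such line
  the kernel integrates to a constant independent of \<open>n\<close>, because \<open>F\<close> is Lipschitz.\<close>

lemma vanishing_no_curve:
  fixes c :: "real \<Rightarrow> real \<Rightarrow> real \<times> real"
  assumes V: vanishing and \<eta>: "cmod \<eta> = 1" and t: "0 \<le> t0" "t0 < t1" "t1 \<le> 2 * pi"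
    and cc: "continuous_on UNIV (\<lambda>p. c (fst p) (snd p))" and iso: "\<And>t x y. norm (c t x - c t y) = \<bar>x - y\<bar>"
    and cin: "\<And>t x. t \<in> {0..2*pi} \<Longrightarrow> x \<in> {0..2*pi} \<Longrightarrow> c t x \<in> tbox"
    and per: "\<And>t x x'. cis x' = cis x \<Longrightarrow> F (c t x') = F (c t x)"
    and iter: "\<And>g :: real \<times> real \<Rightarrow> real. continuous_on tbox g \<Longrightarrow> integral tbox g = integral {0..2*pi} (\<lambda>t. integral {0..2*pi} (\<lambda>x. g (c t x)))"
    and Z: "\<And>t. t \<in> {t0..t1} \<Longrightarrow> \<exists>x. F (c t x) = \<eta>"
  shows False
proof -
  obtain K where K: "0 \<le> K" "\<And>x y. x \<in> tbox \<Longrightarrow> y \<in> tbox \<Longrightarrow> cmod (F x - F y) \<le> K * norm (x - y)"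
    using F_Lipschitz by blast
  define m where "m = 1 / (1 + K)\<^sup>2 * (t1 - t0)"
  have m: "0 < m" using K(1) t by (simp add: m_def)
  obtain n where n: "integral tbox (\<lambda>\<theta>. (1 - (rad n)\<^sup>2) / (cmod (1 - of_real (rad n) * cnj \<eta> * F \<theta>))\<^sup>2) < m"
    using V \<eta> m unfolding vanishing_def by blast
  let ?k = "\<lambda>\<theta>. (1 - (rad n)\<^sup>2) / (cmod (1 - of_real (rad n) * cnj \<eta> * F \<theta>))\<^sup>2"
  have kc: "continuous_on S ?k" for S by (rule vanishing_kernel_continuous[OF \<eta>])
  have ct: "continuous_on S (c t)" for S t
    using continuous_on_subset[OF continuous_on_section[of UNIV UNIV c t], of S] cc by (simp add: UNIV_Times_UNIV)
  have "m \<le> integral {0..2*pi} (\<lambda>t. integral {0..2*pi} (\<lambda>x. ?k (c t x)))"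
    unfolding m_def
  proof (rule outer_integral_lower_bound[OF _ _ _ t])
    have "continuous_on ({0..2*pi} \<times> cbox 0 (2*pi)) (\<lambda>p. (\<lambda>t x. ?k (c t x)) (fst p) (snd p))"
      by (rule continuous_on_compose2[OF kc[of UNIV] continuous_on_subset[OF cc]]) auto
    from continuous_on_integral_right[OF this] show "continuous_on {0..2*pi} (\<lambda>t. integral {0..2*pi} (\<lambda>x. ?k (c t x)))"
      by (simp only: cbox_interval)
    have "continuous_on {0..2*pi} (\<lambda>x. ?k (c t x))" for t
      by (rule continuous_on_compose2[OF kc[of UNIV] ct]) auto
    then show "0 \<le> integral {0..2*pi} (\<lambda>x. ?k (c t x))" for t
      by (intro integral_nonneg integrable_continuous_real vanishing_kernel_continuous(2)[OF \<eta>])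
    fix t assume tt: "t \<in> {t0..t1}"
    then obtain x where x: "F (c t x) = \<eta>" using Z by blast
    obtain x' where x': "x' \<in> {0..<2*pi}" "cis x' = cis x" by (rule cis_shift_into_period)
    have Fx: "F (c t x') = \<eta>" using x per[OF x'(2)] by simp
    have cF: "continuous_on {0..2*pi} (\<lambda>x. F (c t x))"
      by (rule continuous_on_compose2[OF cont_F[of UNIV] ct]) auto
    show "1 / (1 + K)\<^sup>2 \<le> integral {0..2*pi} (\<lambda>x. ?k (c t x))"
    proof (rule kernel_integral_lower_bound[OF cF le1_F \<eta> _ K(1)])
      show "x' \<in> {0..2*pi}" using x' by auto
      fix y assume y: "y \<in> {0..2*pi}"
      have "cmod (F (c t y) - F (c t x')) \<le> K * norm (c t y - c t x')"
        using y x' tt t by (intro K(2) cin) auto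
      then show "cmod (F (c t y) - \<eta>) \<le> K * \<bar>y - x'\<bar>" by (simp add: Fx iso)
    qed
  qed
  also have "\<dots> = integral tbox ?k" by (rule iter[OF kc, symmetric])
  finally show False using n by simp
qed

text \<open>The curves are the coordinate lines in either direction, so it suffices that one
  coordinate projection of the level set contains an interval; no regularity of the level set is
  involved.\<close>

lemma vanishing_no_graph:
  assumes V: vanishing and \<eta>: "cmod \<eta> = 1" and t: "0 \<le> t0" "t0 < t1" "t1 \<le> 2 * pi"
  shows "(\<And>t. t \<in> {t0..t1} \<Longrightarrow> \<exists>x. F (x, t) = \<eta>) \<Longrightarrow> False"
    and "(\<And>t. t \<in> {t0..t1} \<Longrightarrow> \<exists>x. F (t, x) = \<eta>) \<Longrightarrow> False"
proof -
  assume "\<And>t. t \<in> {t0..t1} \<Longrightarrow> \<exists>x. F (x, t) = \<eta>"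
  then show False
    by (intro vanishing_no_curve[OF V \<eta> t, where c = "\<lambda>t x. (x, t)"] continuous_intros tbox_integral_iterated')
      (auto simp: norm_Pair tor_def cbox_Pair_eq)
next
  assume "\<And>t. t \<in> {t0..t1} \<Longrightarrow> \<exists>x. F (t, x) = \<eta>"
  then show False
    by (intro vanishing_no_curve[OF V \<eta> t, where c = "\<lambda>t x. (t, x)"] continuous_intros tbox_integral_iterated)
      (auto simp: norm_Pair tor_def cbox_Pair_eq)
qed

end


subsection \<open>Necessity\<close>

text \<open>A form of the Hopf lemma: by Schwarz-Pick, a self-map \<open>P\<close> of the disc that is not a unimodular
  constant satisfies \<open>1 - r \<le> C * \<bar>P r - 1\<bar>\<close>, which is incompatible with a vanishing derivative at 1.\<close>

lemma boundary_rigidity: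
  assumes h: "P holomorphic_on ball 0 1" and c: "continuous_on (cball 0 1) P"
    and le1: "\<And>z. cmod z < 1 \<Longrightarrow> cmod (P z) \<le> 1" and P1: "P 1 = 1"
    and d: "(P has_field_derivative 0) (at 1)" and u: "cmod u \<le> 1"
  shows "P u = 1"
proof (cases "\<exists>z0. cmod z0 < 1 \<and> cmod (P z0) = 1")
  \<comment> \<open>A value of modulus 1 inside the disc makes \<open>P\<close> constant by the
    maximum principle, and continuity up to 1 identifies the constant.\<close>
  case True
  then obtain z0 where z0: "cmod z0 < 1" "cmod (P z0) = 1" by blast
  have "P constant_on ball 0 1"
    by (rule maximum_modulus_principle[OF h open_ball connected_ball open_ball subset_refl, of z0])
      (use z0 le1 in auto)
  then obtain k where k: "\<And>z. z \<in> ball 0 1 \<Longrightarrow> P z = k" unfolding constant_on_def by blast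
  have cl: "closure (ball (0::complex) 1) = cball 0 1" by simp
  have "P z = k" if "z \<in> cball 0 1" for z
    by (rule continuous_constant_on_closure[of "ball 0 1"]) (use c k that cl in auto)
  from this[of u] this[of 1] P1 u show ?thesis by simp
next
  case False
  then have lt: "cmod (P z) < 1" if "cmod z < 1" for z using le1[OF that] that by (metis order_le_imp_less_or_eq)
  define p where "p = P 0"
  have p: "cmod p < 1" using lt[of 0] by (simp add: p_def)
  \<comment> \<open>A disc automorphism moves \<open>P 0\<close> to 0 and so brings the function
    into the form required by Schwarz's lemma; \<open>id\<close> is the identity by which the
    automorphism preserves the disc.\<close>
  define q where "q = (\<lambda>z. (P z - p) / (1 - cnj p * P z))"
  have id: "(cmod (1 - cnj p * w))\<^sup>2 - (cmod (w - p))\<^sup>2 = (1 - (cmod p)\<^sup>2) * (1 - (cmod w)\<^sup>2)" for w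
    unfolding cmod_power2 by (simp add: power2_eq_square algebra_simps)
  have ne: "1 - cnj p * w \<noteq> 0" if "cmod w \<le> 1" for w using norm_mult_lt_one[of "cnj p" w] p that by simp
  have q1: "cmod (q z) < 1" if "cmod z < 1" for z
  proof -
    have "0 < (1 - (cmod p)\<^sup>2) * (1 - (cmod (P z))\<^sup>2)"
      by (intro mult_pos_pos one_minus_square_bounds p lt that)
    then have "(cmod (P z - p))\<^sup>2 < (cmod (1 - cnj p * P z))\<^sup>2" using id[of "P z"] by linarith
    then have "cmod (P z - p) < cmod (1 - cnj p * P z)" by (rule power_less_imp_less_base) simp
    then show ?thesis using ne[OF le1[OF that]] by (simp add: q_def norm_divide)
  qed
  have qh: "q holomorphic_on ball 0 1" unfolding q_def using ne le1 by (intro holomorphic_intros h) auto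
  have q0: "q 0 = 0" by (simp add: q_def p_def)
  define m where "m = (1 - cmod p)\<^sup>2"
  have m: "0 < m" using p by (simp add: m_def)
  \<comment> \<open>Schwarz's lemma on the radius, rewritten through \<open>id\<close>. The weight
    \<open>m\<close> is the least value that the squared denominator of the automorphism can
    take.\<close>
  have low: "(1 - r) * m \<le> 2 * cmod (P (of_real r) - 1)" if r: "0 < r" "r < 1" for r
  proof -
    let ?w = "P (of_real r)"
    have rz: "cmod (of_real r) < 1" using r by simp
    have w1: "cmod ?w \<le> 1" by (rule le1[OF rz])
    have "cmod (q (of_real r)) \<le> r" using Schwarz_Lemma(1)[OF qh q0 q1 rz] r by simp
    then have "cmod (?w - p) \<le> r * cmod (1 - cnj p * ?w)"
      using ne[OF w1] by (simp add: q_def norm_divide pos_divide_le_eq)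
    then have "(cmod (?w - p))\<^sup>2 \<le> r\<^sup>2 * (cmod (1 - cnj p * ?w))\<^sup>2"
      by (metis norm_ge_zero power_mono power_mult_distrib)
    then have 1: "(1 - r\<^sup>2) * (cmod (1 - cnj p * ?w))\<^sup>2 \<le> (1 - (cmod p)\<^sup>2) * (1 - (cmod ?w)\<^sup>2)"
      using id[of ?w] by (simp add: algebra_simps)
    have "cmod (cnj p * ?w) \<le> cmod p" using w1 by (simp add: norm_mult mult_left_le)
    then have "1 - cmod p \<le> cmod (1 - cnj p * ?w)" using norm_triangle_ineq2[of 1 "cnj p * ?w"] by simp
    then have 2: "m \<le> (cmod (1 - cnj p * ?w))\<^sup>2" unfolding m_def using p by (intro power_mono) auto
    have "r\<^sup>2 \<le> r" using r by (simp add: power2_eq_square mult_left_le)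
    then have "(1 - r) * m \<le> (1 - r\<^sup>2) * (cmod (1 - cnj p * ?w))\<^sup>2" using 2 m r by (intro mult_mono) auto
    also note 1
    also have "(1 - (cmod p)\<^sup>2) * (1 - (cmod ?w)\<^sup>2) \<le> 1 * (1 - (cmod ?w)\<^sup>2)"
      using one_minus_square_bounds[OF p] power_le_one[OF norm_ge_zero w1, of 2] by (intro mult_right_mono) auto
    also have "\<dots> \<le> 2 * (1 - cmod ?w)"
    proof -
      have "2 * cmod ?w \<le> 1 + (cmod ?w)\<^sup>2" using sum_squares_bound[of 1 "cmod ?w"] by simp
      then show ?thesis by simp
    qed
    also have "\<dots> \<le> 2 * cmod (?w - 1)" using norm_triangle_ineq2[of 1 ?w] by (simp add: norm_minus_commute)
    finally show ?thesis .
  qed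
  \<comment> \<open>The estimate \<open>low\<close> carries a factor 2, so an error rate of
    \<open>m / 4\<close> contradicts it with a factor 2 to spare.\<close>
  have "0 < m / 4" using m by simp
  then obtain e where e: "0 < e" and small: "\<And>y. norm (y - 1) < e \<Longrightarrow> norm (P y - P 1 - 0 * (y - 1)) \<le> m / 4 * norm (y - 1)"
    using d unfolding has_field_derivative_def has_derivative_at_alt by blast
  define r where "r = max (1 / 2) (1 - e / 2)"
  have r: "0 < r" "r < 1" "1 - r < e" using e by (auto simp: r_def)
  have nr: "norm (complex_of_real r - 1) = 1 - r"
  proof -
    have "complex_of_real r - 1 = of_real (r - 1)" by simp
    then show ?thesis using r by (simp only: norm_of_real)
  qed
  have "cmod (P (of_real r) - 1) \<le> m / 4 * (1 - r)" using small[of "of_real r"] r nr P1 by simp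
  with low[OF r(1,2)] have "(1 - r) * m \<le> (1 - r) * m / 2" by (simp add: algebra_simps)
  moreover have "0 < (1 - r) * m" using r m by simp
  ultimately have False by linarith
  then show ?thesis ..
qed

text \<open>The derivative of the map is triangular with second row (0, 1), so it is invertible
  exactly where \<open>A\<close> is nonzero. The explicit inverse \<open>E\<close> also shows that
  the derivative of the inverse map is continuous.\<close>

lemma inverse_function_first_coordinate:
  fixes G :: "real \<times> real \<Rightarrow> real"
  assumes d: "\<And>x. (G has_derivative (\<lambda>h. fst h * A x + snd h * B x)) (at x)"
    and A: "continuous_on UNIV A" and B: "continuous_on UNIV B" and A0: "A 0 \<noteq> 0"
  obtains V W g where "open V" "open W" "0 \<in> V" "(G 0, 0) \<in> W" "homeomorphism V W (\<lambda>\<theta>. (G \<theta>, snd \<theta>)) g"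
    "Ck_open 1 V (\<lambda>\<theta>. (G \<theta>, snd \<theta>))" "Ck_open 1 W g"
proof -
  \<comment> \<open>The map is restricted to points where \<open>A\<close> does not vanish, because
    division by \<open>A\<close> must remain continuous along the inverse.\<close>
  define U where "U = {x. A x \<noteq> 0}"
  have "open (A -` (- {0}))" by (intro open_vimage A) auto
  moreover have "A -` (- {0}) = U" by (auto simp: U_def)
  ultimately have U: "open U" by simp
  let ?f = "\<lambda>\<theta>. (G \<theta>, snd \<theta>)"
  define D where "D = (\<lambda>x (h :: real \<times> real). (fst h * A x + snd h * B x, snd h))"
  have bl: "bounded_linear (D x)" for x unfolding D_def
    by (intro bounded_linear_Pair bounded_linear_add bounded_linear_mult_const bounded_linear_fst bounded_linear_snd)
  define f' where "f' = (\<lambda>x. Blinfun (D x))"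
  have f': "blinfun_apply (f' x) = D x" for x unfolding f'_def by (rule bounded_linear_Blinfun_apply[OF bl])
  have derf: "(?f has_derivative D x) (at x)" for x unfolding D_def
    by (intro has_derivative_Pair d has_derivative_snd has_derivative_ident)
  have cD: "continuous_on S (\<lambda>x. D x v)" for S v unfolding D_def
    by (intro continuous_intros continuous_on_subset[OF A] continuous_on_subset[OF B]) auto
  have contf: "continuous_on U f'"
    by (rule continuous_on_blinfun_componentwise) (simp add: f' cD)
  define E where "E = (\<lambda>x (h :: real \<times> real). ((fst h - snd h * B x) / A x, snd h))"
  have blE: "bounded_linear (E x)" for x unfolding E_def
    by (intro bounded_linear_Pair bounded_linear_divide bounded_linear_compose[OF bounded_linear_divide]
      bounded_linear_sub bounded_linear_mult_const bounded_linear_fst bounded_linear_snd)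
  have ED: "E x (D x h) = h" "D x (E x h) = h" if "A x \<noteq> 0" for x h using that by (auto simp: E_def D_def)
  have inv0: "Blinfun (E 0) o\<^sub>L f' 0 = id_blinfun"
    by (rule blinfun_eqI) (simp add: f' bounded_linear_Blinfun_apply[OF blE] ED(1)[OF A0])
  have x0: "0 \<in> U" using A0 by (simp add: U_def)
  obtain V W g g' where V: "open V" "V \<subseteq> U" "0 \<in> V" and W: "open W" "?f 0 \<in> W"
    and hom: "homeomorphism V W ?f g"
    and dg: "\<And>y. y \<in> W \<Longrightarrow> (g has_derivative (g' y)) (at y)"
    and g': "\<And>y. y \<in> W \<Longrightarrow> g' y = inv (blinfun_apply (f' (g y)))"
    and bij: "\<And>y. y \<in> W \<Longrightarrow> bij (blinfun_apply (f' (g y)))"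
    by (rule inverse_function_theorem[OF U _ contf x0 inv0, of ?f]) (use derf f' in auto)
  have gV: "g y \<in> V" if "y \<in> W" for y using hom that unfolding homeomorphism_def by blast
  have g'E: "g' y v = E (g y) v" if y: "y \<in> W" for y v
  proof -
    have "A (g y) \<noteq> 0" using gV[OF y] V(2) unfolding U_def by blast
    from ED(2)[OF this] have "blinfun_apply (f' (g y)) (E (g y) v) = v" by (simp add: f')
    then show ?thesis unfolding g'[OF y] using bij[OF y] by (intro inv_f_eq bij_is_inj)
  qed
  have cg: "continuous_on W g" using hom by (simp add: homeomorphism_def)
  have CV: "Ck_open 1 V ?f" unfolding One_nat_def
    by (rule Ck_open_SucI[OF V(1) derf]) (simp add: cD)
  have CW: "Ck_open 1 W g" unfolding One_nat_def
  proof (rule Ck_open_SucI[OF W(1) dg])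
    fix v
    have "continuous_on W (\<lambda>y. E (g y) v)" unfolding E_def
      using gV V(2) by (intro continuous_intros continuous_on_compose2[OF A cg] continuous_on_compose2[OF B cg]) (auto simp: U_def)
    then have "continuous_on W (\<lambda>y. g' y v)" by (rule continuous_on_cong[THEN iffD1, OF refl, rotated]) (simp add: g'E)
    then show "Ck_open 0 W (\<lambda>y. g' y v)" by simp
  qed
  have "(G 0, 0) \<in> W" using W(2) by simp
  from that[OF V(1) W(1) V(3) this hom CV CW] show thesis .
qed

text \<open>The half-open ranges leave a nondegenerate interval to the right of each coordinate
  inside the period.\<close>

lemma torus2_cases:
  assumes "\<xi> \<in> torus2"
  obtains a b where "a \<in> {0..<2*pi}" "b \<in> {0..<2*pi}" "\<xi> = tor (a, b)"
proof -
  have u: "\<exists>x. cis x = z" if "cmod z = 1" for z 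
  proof -
    have "z \<noteq> 0" using that by auto
    then have "cis (Arg z) = z" using cis_Arg[of z] that by (simp add: sgn_eq)
    then show ?thesis by blast
  qed
  obtain x y where xy: "cis x = fst \<xi>" "cis y = snd \<xi>" using u[of "fst \<xi>"] u[of "snd \<xi>"] assms by (auto simp: torus2_def)
  obtain a where "a \<in> {0..<2*pi}" "cis a = cis x" by (rule cis_shift_into_period)
  moreover obtain b where "b \<in> {0..<2*pi}" "cis b = cis y" by (rule cis_shift_into_period)
  ultimately show thesis using xy by (intro that[of a b]) (auto simp: tor_def prod_eq_iff)
qed

context smooth_symbol
begin

text \<open>The analytic disc through the closed bidisc touches the contact point at
  \<open>u = 1\<close> with derivative \<open>Dp \<xi> (a, b)\<close>, so boundary rigidity applies.
  Using the extension \<open>p\<close> provides a complex derivative at the boundary point in the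
  full, not one-sided, sense.\<close>

lemma slice_constant:
  assumes \<xi>: "\<xi> \<in> cbidisc" "cmod (f \<xi>) = 1"
    and line: "\<And>u. cmod u \<le> 1 \<Longrightarrow> (fst \<xi> + (u - 1) * a, snd \<xi> + (u - 1) * b) \<in> cbidisc"
    and D0: "Dp \<xi> (a, b) = 0" and u: "cmod u \<le> 1"
  shows "f (fst \<xi> + (u - 1) * a, snd \<xi> + (u - 1) * b) = f \<xi>"
proof -
  define c where "c = (\<lambda>u. (fst \<xi> + (u - 1) * a, snd \<xi> + (u - 1) * b))"
  define P where "P = (\<lambda>u. cnj (f \<xi>) * p (c u))"
  have cin: "c u \<in> cbidisc" if "cmod u \<le> 1" for u using line[OF that] by (simp add: c_def)
  have c1: "c 1 = \<xi>" by (simp add: c_def)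
  have uu: "cnj (f \<xi>) * f \<xi> = 1" using \<xi> complex_norm_square[of "f \<xi>"] by (simp add: mult.commute)
  have d: "(P has_field_derivative cnj (f \<xi>) * Dp (c u) (a, b)) (at u)" if u: "cmod u \<le> 1" for u
  proof -
    have "(c has_derivative (\<lambda>h. (h * a, h * b))) (at u)" unfolding c_def by (auto intro!: derivative_eq_intros)
    from diff_chain_at[OF this deriv_p[OF subsetD[OF subU cin[OF u]]]]
    have "((\<lambda>u. p (c u)) has_derivative (\<lambda>h. Dp (c u) (h * a, h * b))) (at u)" by (simp add: o_def)
    from has_derivative_mult_right[OF this, of "cnj (f \<xi>)"]
    have "(P has_derivative (\<lambda>h. cnj (f \<xi>) * (h * Dp (c u) (a, b)))) (at u)"
      by (simp only: P_def complex_linear_Dp'[OF cin[OF u]])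
    then show ?thesis unfolding has_field_derivative_def by (rule has_derivative_eq_rhs) (simp add: fun_eq_iff)
  qed
  have "P u = 1"
  proof (rule boundary_rigidity[OF _ _ _ _ _ u])
    show "P holomorphic_on ball 0 1"
      unfolding holomorphic_on_open[OF open_ball] using d by (intro ballI exI) (auto intro: less_imp_le)
    show "continuous_on (cball 0 1) P"
      by (intro continuous_at_imp_continuous_on ballI DERIV_isCont[OF d]) simp
    show "cmod (P z) \<le> 1" if "cmod z < 1" for z
      using cin[of z] le1[of "c z"] pf[of "c z"] \<xi> that by (simp add: P_def norm_mult)
    show "P 1 = 1" by (simp add: P_def c1 pf[OF \<xi>(1)] uu)
    show "(P has_field_derivative 0) (at 1)" using d[of 1] D0 by (simp add: c1)
  qed
  then have "cnj (f \<xi>) * f (c u) = cnj (f \<xi>) * f \<xi>" by (simp add: P_def pf[OF cin[OF u]] uu)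
  moreover have "f \<xi> \<noteq> 0" using \<xi>(2) by auto
  ultimately show ?thesis by (simp add: c_def)
qed

lemma truly_2d_of_vanishing:
  assumes V: vanishing and \<alpha>: "fst \<alpha> \<in> {0..<2*pi}" "snd \<alpha> \<in> {0..<2*pi}" "cmod (F \<alpha>) = 1"
  shows "truly_2d f (tor \<alpha>)"
proof -
  let ?\<xi> = "tor \<alpha>"
  note \<xi> = tor_in_torus2[of \<alpha>] tor_in_cbidisc[of \<alpha>]
  have f0: "cnj (f ?\<xi>) \<noteq> 0" using \<alpha>(3) by auto
  have le2: "cmod (z + (u - 1) * z) \<le> 1" if "cmod z = 1" "cmod u \<le> 1" for z u
  proof -
    have "z + (u - 1) * z = u * z" by (simp add: algebra_simps)
    then show ?thesis using that by (simp add: norm_mult)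
  qed
  have dz1: "dz1 (phi_tilde f ?\<xi>) (1, 1) \<noteq> 0"
  proof
    assume "dz1 (phi_tilde f ?\<xi>) (1, 1) = 0"
    then have D0: "Dp ?\<xi> (fst ?\<xi>, 0) = 0" using f0 by (simp add: dz1_phi_tilde[OF \<xi>(1)])
    \<comment> \<open>Taking \<open>(a, b)\<close> to be the first coordinate direction at the
      contact point, the disc is a full coordinate slice, and its boundary circle is a level line
      over the whole first axis.\<close>
    have "F (t, snd \<alpha>) = F \<alpha>" for t
    proof -
      let ?u = "cis (t - fst \<alpha>)"
      have "f (fst ?\<xi> + (?u - 1) * fst ?\<xi>, snd ?\<xi> + (?u - 1) * 0) = f ?\<xi>"
        by (rule slice_constant[OF \<xi>(2) \<alpha>(3) _ D0]) (use le2 in \<open>auto simp: cbidisc_def tor_def\<close>)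
      moreover have "fst ?\<xi> + (?u - 1) * fst ?\<xi> = cis t"
        by (simp add: tor_def algebra_simps cis_mult)
      ultimately show ?thesis by (simp add: tor_def)
    qed
    then show False
      by (intro vanishing_no_graph(2)[OF V \<alpha>(3), of 0 "2 * pi"]) auto
  qed
  have dz2: "dz2 (phi_tilde f ?\<xi>) (1, 1) \<noteq> 0"
  proof
    assume "dz2 (phi_tilde f ?\<xi>) (1, 1) = 0"
    then have D0: "Dp ?\<xi> (0, snd ?\<xi>) = 0" using f0 by (simp add: dz2_phi_tilde[OF \<xi>(1)])
    have "F (fst \<alpha>, t) = F \<alpha>" for t
    proof -
      let ?u = "cis (t - snd \<alpha>)"
      have "f (fst ?\<xi> + (?u - 1) * 0, snd ?\<xi> + (?u - 1) * snd ?\<xi>) = f ?\<xi>"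
        by (rule slice_constant[OF \<xi>(2) \<alpha>(3) _ D0]) (use le2 in \<open>auto simp: cbidisc_def tor_def\<close>)
      moreover have "snd ?\<xi> + (?u - 1) * snd ?\<xi> = cis t"
        by (simp add: tor_def algebra_simps cis_mult)
      ultimately show ?thesis by (simp add: tor_def)
    qed
    then show False
      by (intro vanishing_no_graph(1)[OF V \<alpha>(3), of 0 "2 * pi"]) auto
  qed
  define \<psi> where "\<psi> = psi_map f ?\<xi>"
  have \<psi>: "\<psi> \<theta> = cnj (F \<alpha>) * F (\<alpha> + \<theta>)" for \<theta> unfolding \<psi>_def by (rule psi_map_tor)
  have uu: "F \<alpha> * cnj (F \<alpha>) = 1" using \<alpha>(3) complex_norm_square[of "F \<alpha>"] by simp
  obtain D1 D2 D11 D12 D21 D22 where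
    dF: "\<And>x. (F has_derivative (\<lambda>h. fst h *\<^sub>R D1 x + snd h *\<^sub>R D2 x)) (at x)"
    and c: "continuous_on UNIV D1" "continuous_on UNIV D2"
    by (rule Ck_open_2_partials[OF Ck2_F]) (rule that; assumption)
  define A where "A = (\<lambda>\<theta>. Im (cnj (F \<alpha>) * D1 (\<alpha> + \<theta>)))"
  define B where "B = (\<lambda>\<theta>. Im (cnj (F \<alpha>) * D2 (\<alpha> + \<theta>)))"
  have dG: "((\<lambda>\<theta>. Im (\<psi> \<theta>)) has_derivative (\<lambda>h. fst h * A x + snd h * B x)) (at x)" for x
  proof -
    have "((\<lambda>\<theta>. \<alpha> + \<theta>) has_derivative (\<lambda>h. h)) (at x)" by (auto intro!: derivative_eq_intros)
    from diff_chain_at[OF this dF] have "((\<lambda>\<theta>. F (\<alpha> + \<theta>)) has_derivative (\<lambda>h. fst h *\<^sub>R D1 (\<alpha> + x) + snd h *\<^sub>R D2 (\<alpha> + x))) (at x)"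
      by (simp add: o_def)
    from bounded_linear.has_derivative[OF bounded_linear_Im has_derivative_mult_right[OF this, of "cnj (F \<alpha>)"]]
    show ?thesis unfolding \<psi> by (rule has_derivative_eq_rhs) (simp add: fun_eq_iff A_def B_def algebra_simps)
  qed
  have cA: "continuous_on UNIV A" unfolding A_def
    by (intro continuous_intros continuous_on_compose2[OF c(1)]) auto
  have cB: "continuous_on UNIV B" unfolding B_def
    by (intro continuous_intros continuous_on_compose2[OF c(2)]) auto
  have "frechet_derivative F (at \<alpha>) (1, 0) = D1 \<alpha>"
    unfolding frechet_derivative_at[OF dF, symmetric] by simp
  then have A0: "A 0 \<noteq> 0" using Im_F_derivative_nonzero(1)[OF \<alpha>(3) dz1] by (simp add: A_def)
  have G0: "Im (\<psi> 0) = 0" "Re (\<psi> 0) = 1" unfolding \<psi> using uu by (simp_all add: mult.commute)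
  obtain V' W g where V': "open V'" "0 \<in> V'" and W: "open W" "(Im (\<psi> 0), 0) \<in> W"
    and hom: "homeomorphism V' W (\<lambda>\<theta>. (Im (\<psi> \<theta>), snd \<theta>)) g"
    and Ck: "Ck_open 1 V' (\<lambda>\<theta>. (Im (\<psi> \<theta>), snd \<theta>))" "Ck_open 1 W g"
    by (rule inverse_function_first_coordinate[OF dG cA cB A0]) (rule that; assumption)
  have W0: "0 \<in> W" using W(2) G0 by (simp add: zero_prod_def)
  have "\<not> (\<exists>h :: real \<Rightarrow> real. \<forall>\<^sub>F u in nhds 0. Re (\<psi> (g u)) - 1 = h (fst u))"
  proof
    assume "\<exists>h :: real \<Rightarrow> real. \<forall>\<^sub>F u in nhds 0. Re (\<psi> (g u)) - 1 = h (fst u)"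
    then obtain h :: "real \<Rightarrow> real" where "\<forall>\<^sub>F u in nhds 0. Re (\<psi> (g u)) - 1 = h (fst u)" by blast
    then obtain S where S: "open S" "0 \<in> S" and hS: "\<And>u. u \<in> S \<Longrightarrow> Re (\<psi> (g u)) - 1 = h (fst u)"
      unfolding eventually_nhds by blast
    have "open (S \<inter> W)" "0 \<in> S \<inter> W" using S W W0 by auto
    then obtain e where e: "0 < e" "ball 0 e \<subseteq> S \<inter> W" unfolding open_contains_ball by blast
    have gf: "g (Im (\<psi> \<theta>), snd \<theta>) = \<theta>" if "\<theta> \<in> V'" for \<theta> using hom that unfolding homeomorphism_def by blast
    have fg: "(Im (\<psi> (g u)), snd (g u)) = u" if "u \<in> W" for u using hom that unfolding homeomorphism_def by auto
    have g0: "g 0 = 0" using gf[OF V'(2)] G0 by (simp add: zero_prod_def)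
    have h0: "h 0 = 0" using hS[OF S(2)] g0 G0 by simp
    \<comment> \<open>The change of variables keeps the second coordinate, so the preimage of the
      axis \<open>u\<^sub>1 = 0\<close> has second coordinate exactly \<open>t\<close>. The constant
      \<open>h 0\<close> is determined by the contact point itself.\<close>
    have zero: "F (\<alpha> + g (0, t)) = F \<alpha> \<and> snd (g (0, t)) = t" if t: "\<bar>t\<bar> < e" for t
    proof -
      have "(0::real, t) \<in> ball 0 e" using t by (simp add: dist_norm norm_Pair)
      then have in': "(0, t) \<in> S" "(0, t) \<in> W" using e(2) by auto
      have "Im (\<psi> (g (0, t))) = 0" "snd (g (0, t)) = t" using fg[OF in'(2)] by auto
      moreover have "Re (\<psi> (g (0, t))) = 1" using hS[OF in'(1)] h0 by simp
      ultimately have "\<psi> (g (0, t)) = 1" by (simp add: complex_eq_iff)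
      then have "F \<alpha> * (cnj (F \<alpha>) * F (\<alpha> + g (0, t))) = F \<alpha>" unfolding \<psi> by simp
      then have "(F \<alpha> * cnj (F \<alpha>)) * F (\<alpha> + g (0, t)) = F \<alpha>" by (simp only: mult.assoc)
      then show ?thesis using uu \<open>snd (g (0, t)) = t\<close> by simp
    qed
    \<comment> \<open>An interval to the right of \<open>snd \<alpha>\<close> inside the period; it
      is nondegenerate because \<open>snd \<alpha> < 2 * pi\<close>.\<close>
    define t1 where "t1 = min (snd \<alpha> + e / 2) (2 * pi)"
    show False
    proof (rule vanishing_no_graph(1)[OF V \<alpha>(3), of "snd \<alpha>" t1])
      show "0 \<le> snd \<alpha>" "snd \<alpha> < t1" "t1 \<le> 2 * pi" using \<alpha> e by (auto simp: t1_def)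
      fix t assume "t \<in> {snd \<alpha>..t1}"
      then have "\<bar>t - snd \<alpha>\<bar> < e" using e by (auto simp: t1_def)
      from zero[OF this] have z: "F (\<alpha> + g (0, t - snd \<alpha>)) = F \<alpha>" "snd (\<alpha> + g (0, t - snd \<alpha>)) = t" by auto
      then have "(fst (\<alpha> + g (0, t - snd \<alpha>)), t) = \<alpha> + g (0, t - snd \<alpha>)" by (simp add: prod_eq_iff)
      with z(1) show "\<exists>x. F (x, t) = F \<alpha>" by metis
    qed
  qed
  then show ?thesis unfolding truly_2d_def \<psi>_def[symmetric]
    by (intro conjI exI[of _ V'] exI[of _ W] exI[of _ g] dz1 dz2 V' W(1) W0 hom Ck)
qed

lemma truly_2d_of_vanishing_torus:
  assumes V: vanishing and \<xi>: "\<xi> \<in> torus2" "cmod (f \<xi>) = 1"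
  shows "truly_2d f \<xi>"
proof -
  obtain a b where "a \<in> {0..<2*pi}" "b \<in> {0..<2*pi}" "\<xi> = tor (a, b)" using \<xi>(1) by (rule torus2_cases)
  then show ?thesis using truly_2d_of_vanishing[OF V, of "(a, b)"] \<xi>(2) by simp
qed

end

lemma norm_unit_szego_square:
  assumes "w \<in> bidisc"
  shows "(cmod (unit_szego w z))\<^sup>2 = ((1 - (cmod (fst w))\<^sup>2) / (cmod (1 - cnj (fst w) * fst z))\<^sup>2) *
    ((1 - (cmod (snd w))\<^sup>2) / (cmod (1 - cnj (snd w) * snd z))\<^sup>2)"
proof -
  have w1: "cmod (fst w) < 1" "cmod (snd w) < 1" using assms by (auto simp: bidisc_def)
  define X where "X = (1 - (cmod (fst w))\<^sup>2) * (1 - (cmod (snd w))\<^sup>2)"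
  have "0 < X" unfolding X_def by (intro mult_pos_pos one_minus_square_bounds w1)
  then have 1: "(cmod (complex_of_real (sqrt X)))\<^sup>2 = X" by simp
  have 2: "(cmod (szego z w))\<^sup>2 = 1 / ((cmod (1 - cnj (fst w) * fst z))\<^sup>2 * (cmod (1 - cnj (snd w) * snd z))\<^sup>2)"
    unfolding szego_def norm_divide norm_mult power_divide power_mult_distrib norm_one power_one
      mult.commute[of "fst z"] mult.commute[of "snd z"] by (rule refl)
  show ?thesis unfolding unit_szego_def X_def[symmetric] norm_mult power_mult_distrib 1 2 by (simp add: X_def)
qed

lemma norm_unit_szego_dilated_square:
  assumes "0 \<le> t" "t < 1" "cmod \<eta>1 \<le> 1" "cmod \<eta>2 \<le> 1"
  shows "(cmod (unit_szego (t *\<^sub>R (\<eta>1, \<eta>2)) z))\<^sup>2 =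
    ((1 - (t * cmod \<eta>1)\<^sup>2) / (cmod (1 - of_real t * cnj \<eta>1 * fst z))\<^sup>2) *
    ((1 - (t * cmod \<eta>2)\<^sup>2) / (cmod (1 - of_real t * cnj \<eta>2 * snd z))\<^sup>2)"
proof -
  have w: "t *\<^sub>R (\<eta>1, \<eta>2) \<in> bidisc" using assms by (intro scaleR_in_bidisc) (auto simp: cbidisc_def)
  show ?thesis unfolding norm_unit_szego_square[OF w] using assms(1)
    by (simp add: scaleR_conv_of_real norm_mult)
qed

lemma rad_bounds: "0 \<le> rad n" "rad n < 1"
  by (auto simp: field_simps)

context smooth_self_map
begin

text \<open>Setting the other coordinate of the kernel parameter to 0 makes its factor equal to 1,
  so the norm of the composed kernel becomes the one-variable integral.\<close>

lemma vanishing_of_compact: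
  assumes C: "compact_comp_H2 \<phi>"
  shows f1.vanishing and f2.vanishing
proof -
  show f1.vanishing unfolding f1.vanishing_def
  proof (intro allI impI)
    fix \<eta> :: complex and c :: real assume \<eta>: "cmod \<eta> = 1" and c: "0 < c"
    have eq: "(cmod (unit_szego (rad n *\<^sub>R (\<eta>, 0)) z))\<^sup>2 = (1 - (rad n)\<^sup>2) / (cmod (1 - of_real (rad n) * cnj \<eta> * fst z))\<^sup>2" for n :: nat and z
      using norm_unit_szego_dilated_square[OF rad_bounds, of \<eta> 0 n z] \<eta> by (simp del: of_real_diff of_real_divide)
    obtain n where "integral tbox (\<lambda>\<theta>. (cmod (unit_szego (rad n *\<^sub>R (\<eta>, 0)) (\<phi> (tor \<theta>))))\<^sup>2) < c"
      using compact_unit_szego[OF C _ _ _ c, of \<eta> 0] \<eta> by auto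
    then show "\<exists>n. integral tbox (\<lambda>\<theta>. (1 - (rad n)\<^sup>2) / (cmod (1 - of_real (rad n) * cnj \<eta> * fst (\<phi> (tor \<theta>))))\<^sup>2) < c"
      unfolding eq by blast
  qed
  show f2.vanishing unfolding f2.vanishing_def
  proof (intro allI impI)
    fix \<eta> :: complex and c :: real assume \<eta>: "cmod \<eta> = 1" and c: "0 < c"
    have eq: "(cmod (unit_szego (rad n *\<^sub>R (0, \<eta>)) z))\<^sup>2 = (1 - (rad n)\<^sup>2) / (cmod (1 - of_real (rad n) * cnj \<eta> * snd z))\<^sup>2" for n :: nat and z
      using norm_unit_szego_dilated_square[OF rad_bounds, of 0 \<eta> n z] \<eta> by (simp del: of_real_diff of_real_divide)
    obtain n where "integral tbox (\<lambda>\<theta>. (cmod (unit_szego (rad n *\<^sub>R (0, \<eta>)) (\<phi> (tor \<theta>))))\<^sup>2) < c"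
      using compact_unit_szego[OF C _ _ _ c, of 0 \<eta>] \<eta> by auto
    then show "\<exists>n. integral tbox (\<lambda>\<theta>. (1 - (rad n)\<^sup>2) / (cmod (1 - of_real (rad n) * cnj \<eta> * snd (\<phi> (tor \<theta>))))\<^sup>2) < c"
      unfolding eq by blast
  qed
qed

text \<open>At a common contact point both factors of the kernel are of order
  \<open>real n + 2\<close> on a square of side \<open>1 / (real n + 2)\<close>. Area and height
  cancel, so the norms of the composed kernels stay bounded below.\<close>

lemma disjoint_of_compact:
  assumes C: "compact_comp_H2 \<phi>"
  shows "\<phi> ` torus2 \<inter> torus2 = {}"
proof (rule ccontr)
  assume "\<phi> ` torus2 \<inter> torus2 \<noteq> {}"
  then obtain \<xi> where \<xi>: "\<xi> \<in> torus2" "\<phi> \<xi> \<in> torus2" by blast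
  obtain a b where ab: "a \<in> {0..<2*pi}" "b \<in> {0..<2*pi}" "\<xi> = tor (a, b)" using \<xi>(1) by (rule torus2_cases)
  define \<eta>1 where "\<eta>1 = fst (\<phi> \<xi>)"
  define \<eta>2 where "\<eta>2 = snd (\<phi> \<xi>)"
  have \<eta>: "cmod \<eta>1 = 1" "cmod \<eta>2 = 1" using \<xi>(2) by (auto simp: \<eta>1_def \<eta>2_def torus2_def mem_Times_iff)
  obtain K1 where K1: "0 \<le> K1" "\<And>x y. x \<in> tbox \<Longrightarrow> y \<in> tbox \<Longrightarrow> cmod (fst (\<phi> (tor x)) - fst (\<phi> (tor y))) \<le> K1 * norm (x - y)"
    using f1.F_Lipschitz by blast
  obtain K2 where K2: "0 \<le> K2" "\<And>x y. x \<in> tbox \<Longrightarrow> y \<in> tbox \<Longrightarrow> cmod (snd (\<phi> (tor x)) - snd (\<phi> (tor y))) \<le> K2 * norm (x - y)"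
    using f2.F_Lipschitz by blast
  \<comment> \<open>Points of the square are within \<open>2 * \<delta>\<close> of the contact point
    in norm, which doubles the Lipschitz constants.\<close>
  define c where "c = 1 / (1 + 2 * K1)\<^sup>2 * (1 / (1 + 2 * K2)\<^sup>2)"
  have c: "0 < c" using K1 K2 by (simp add: c_def)
  obtain n where n: "integral tbox (\<lambda>\<theta>. (cmod (unit_szego (rad n *\<^sub>R (\<eta>1, \<eta>2)) (\<phi> (tor \<theta>))))\<^sup>2) < c"
    using compact_unit_szego[OF C _ _ _ c, of \<eta>1 \<eta>2] \<eta> by auto
  define \<delta> where "\<delta> = 1 / (real n + 2)"
  have \<delta>: "0 < \<delta>" "\<delta> \<le> 1 / 2" by (auto simp: \<delta>_def field_simps)
  obtain l where l: "0 \<le> l" "l + \<delta> \<le> 2 * pi" and lx: "\<And>x. x \<in> {l..l + \<delta>} \<Longrightarrow> \<bar>x - a\<bar> \<le> \<delta>"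
    using interval_in_period[of a \<delta>] ab \<delta> by auto
  obtain k where k: "0 \<le> k" "k + \<delta> \<le> 2 * pi" and kx: "\<And>x. x \<in> {k..k + \<delta>} \<Longrightarrow> \<bar>x - b\<bar> \<le> \<delta>"
    using interval_in_period[of b \<delta>] ab \<delta> by auto
  define S where "S = cbox (l, k) (l + \<delta>, k + \<delta>)"
  have sub: "S \<subseteq> tbox" using l k unfolding S_def by (auto simp: cbox_Pair_eq)
  define g where "g = (\<lambda>\<theta>. (cmod (unit_szego (rad n *\<^sub>R (\<eta>1, \<eta>2)) (\<phi> (tor \<theta>))))\<^sup>2)"
  have w: "rad n *\<^sub>R (\<eta>1, \<eta>2) \<in> bidisc"
    using \<eta> by (intro scaleR_in_bidisc rad_bounds) (simp add: cbidisc_def)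
  have gc: "continuous_on X g" for X unfolding g_def
    by (intro continuous_intros continuous_on_compose2[OF continuous_on_unit_szego[OF w] cont_\<phi>_tor]) (auto simp: maps_tor)
  have low: "(real n + 2)\<^sup>2 * c \<le> g \<theta>" if \<theta>: "\<theta> \<in> S" for \<theta>
  proof -
    have ab': "(a, b) \<in> tbox" using ab by (auto simp: cbox_Pair_eq)
    have "\<bar>fst \<theta> - a\<bar> \<le> \<delta>" "\<bar>snd \<theta> - b\<bar> \<le> \<delta>"
      using lx[of "fst \<theta>"] kx[of "snd \<theta>"] \<theta> unfolding S_def by (auto simp: cbox_Pair_eq mem_Times_iff)
    moreover have "norm (\<theta> - (a, b)) \<le> \<bar>fst \<theta> - a\<bar> + \<bar>snd \<theta> - b\<bar>"
      using norm_Pair_le[of "fst \<theta> - a" "snd \<theta> - b"] by (cases \<theta>) simp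
    ultimately have d: "norm (\<theta> - (a, b)) \<le> 2 * \<delta>" by simp
    have tS: "\<theta> \<in> tbox" using \<theta> sub by blast
    have "cmod (fst (\<phi> (tor \<theta>)) - \<eta>1) \<le> (2 * K1) * \<delta>"
      using K1(2)[OF tS ab'] mult_left_mono[OF d K1(1)] by (simp add: \<eta>1_def ab(3) mult_ac)
    then have 1: "(real n + 2) / (1 + 2 * K1)\<^sup>2 \<le> (1 - (rad n)\<^sup>2) / (cmod (1 - of_real (rad n) * cnj \<eta>1 * fst (\<phi> (tor \<theta>))))\<^sup>2"
      unfolding \<delta>_def using K1(1) by (intro kernel_lower_bound[OF f1.le1_F \<eta>(1)]) auto
    have "cmod (snd (\<phi> (tor \<theta>)) - \<eta>2) \<le> (2 * K2) * \<delta>"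
      using K2(2)[OF tS ab'] mult_left_mono[OF d K2(1)] by (simp add: \<eta>2_def ab(3) mult_ac)
    then have 2: "(real n + 2) / (1 + 2 * K2)\<^sup>2 \<le> (1 - (rad n)\<^sup>2) / (cmod (1 - of_real (rad n) * cnj \<eta>2 * snd (\<phi> (tor \<theta>))))\<^sup>2"
      unfolding \<delta>_def using K2(1) by (intro kernel_lower_bound[OF f2.le1_F \<eta>(2)]) auto
    have "(real n + 2)\<^sup>2 * c = ((real n + 2) / (1 + 2 * K1)\<^sup>2) * ((real n + 2) / (1 + 2 * K2)\<^sup>2)"
      by (simp add: c_def power2_eq_square)
    also have "\<dots> \<le> ((1 - (rad n)\<^sup>2) / (cmod (1 - of_real (rad n) * cnj \<eta>1 * fst (\<phi> (tor \<theta>))))\<^sup>2) *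
        ((1 - (rad n)\<^sup>2) / (cmod (1 - of_real (rad n) * cnj \<eta>2 * snd (\<phi> (tor \<theta>))))\<^sup>2)"
    proof (rule mult_mono[OF 1 2])
      show "0 \<le> (real n + 2) / (1 + 2 * K2)\<^sup>2" by simp
      show "0 \<le> (1 - (rad n)\<^sup>2) / (cmod (1 - of_real (rad n) * cnj \<eta>1 * fst (\<phi> (tor \<theta>))))\<^sup>2"
        by (rule order_trans[OF _ 1]) simp
    qed
    also have "\<dots> = g \<theta>" unfolding g_def
      using norm_unit_szego_dilated_square[OF rad_bounds eq_refl[OF \<eta>(1)] eq_refl[OF \<eta>(2)]] \<eta> by (simp only: mult_1_right)
    finally show ?thesis .
  qed
  have "c = integral S (\<lambda>_. (real n + 2)\<^sup>2 * c)"
    using \<delta> unfolding S_def by (simp add: content_Pair \<delta>_def power2_eq_square)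
  also have "\<dots> \<le> integral S g"
    using low unfolding S_def by (intro integral_le integrable_continuous gc) (auto intro: continuous_on_const)
  also have "\<dots> \<le> integral tbox g"
    using sub unfolding S_def by (intro integral_subset_le integrable_continuous gc) (auto simp: g_def)
  also have "\<dots> < c" using n unfolding g_def .
  finally show False by simp
qed

lemma truly_2d_of_compact:
  assumes C: "compact_comp_H2 \<phi>" and \<xi>: "\<xi> \<in> torus2"
  shows "cmod (fst (\<phi> \<xi>)) = 1 \<Longrightarrow> truly_2d (\<lambda>z. fst (\<phi> z)) \<xi>"
    and "cmod (snd (\<phi> \<xi>)) = 1 \<Longrightarrow> truly_2d (\<lambda>z. snd (\<phi> z)) \<xi>"
  using f1.truly_2d_of_vanishing_torus[OF vanishing_of_compact(1)[OF C] \<xi>]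
    f2.truly_2d_of_vanishing_torus[OF vanishing_of_compact(2)[OF C] \<xi>] by blast+

end

lemma smooth_self_mapI:
  assumes holo: "holo2_on bidisc (\<lambda>z. fst (\<phi> z))" "holo2_on bidisc (\<lambda>z. snd (\<phi> z))"
    and maps: "\<phi> ` bidisc \<subseteq> bidisc" and smooth: "Ck_on 3 cbidisc \<phi>"
  obtains p1 p2 U where "smooth_self_map \<phi> p1 p2 U"
proof -
  obtain U g where U: "open U" "cbidisc \<subseteq> U" and g: "Ck_open 3 U g" "\<And>z. z \<in> cbidisc \<Longrightarrow> g z = \<phi> z"
    using smooth unfolding Ck_on_def by blast
  have lt: "cmod (fst (\<phi> z)) < 1 \<and> cmod (snd (\<phi> z)) < 1" if "z \<in> bidisc" for z
  proof -
    have "\<phi> z \<in> bidisc" using maps that by blast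
    then show ?thesis by (simp add: bidisc_def mem_Times_iff)
  qed
  have "smooth_symbol (\<lambda>z. fst (\<phi> z)) (\<lambda>z. fst (g z)) U"
    by unfold_locales (use U g Ck_open_bounded_linear[OF U(1) bounded_linear_fst g(1)] holo lt in auto)
  moreover have "smooth_symbol (\<lambda>z. snd (\<phi> z)) (\<lambda>z. snd (g z)) U"
    by unfold_locales (use U g Ck_open_bounded_linear[OF U(1) bounded_linear_snd g(1)] holo lt in auto)
  ultimately show thesis by (intro that smooth_self_map.intro)
qed

theorem mainTheorem15:
  fixes \<phi> :: "complex \<times> complex \<Rightarrow> complex \<times> complex"
  assumes "holo2_on bidisc (\<lambda>z. fst (\<phi> z))"
      and "holo2_on bidisc (\<lambda>z. snd (\<phi> z))"
      and "\<phi> ` bidisc \<subseteq> bidisc"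
      and "Ck_on 3 cbidisc \<phi>"
  shows "(compact_comp_H2 \<phi> \<longrightarrow>
            \<phi> ` torus2 \<inter> torus2 = {} \<and>
            (\<forall>\<xi>\<in>torus2.
               (cmod (fst (\<phi> \<xi>)) = 1 \<longrightarrow> truly_2d (\<lambda>z. fst (\<phi> z)) \<xi>) \<and>
               (cmod (snd (\<phi> \<xi>)) = 1 \<longrightarrow> truly_2d (\<lambda>z. snd (\<phi> z)) \<xi>)))
       \<and> ((\<phi> ` torus2 \<inter> torus2 = {} \<and>
            (\<forall>\<xi>\<in>torus2.
               (cmod (fst (\<phi> \<xi>)) = 1 \<longrightarrow> truly_2d_ord2 (\<lambda>z. fst (\<phi> z)) \<xi>) \<and>
               (cmod (snd (\<phi> \<xi>)) = 1 \<longrightarrow> truly_2d_ord2 (\<lambda>z. snd (\<phi> z)) \<xi>)))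
          \<longrightarrow> compact_comp_H2 \<phi>)"
proof -
  obtain p1 p2 U where "smooth_self_map \<phi> p1 p2 U"
    using smooth_self_mapI[OF assms] by blast
  then interpret smooth_self_map \<phi> p1 p2 U .
  show ?thesis
    using disjoint_of_compact truly_2d_of_compact compact_comp_of_order2 by blast
qed

end
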